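(* Let $n\ge3$. For all $S\subseteq\{1,\dots,n\}$ with $|S|\ge3$ and all $i=1,\dots,n-1$, $$r_i(\omega_S)=\bar r_i(\omega_S)=\omega_{(i,i+1)\cdot S},$$ where $(i,i+1)\cdot S$ is the image of the subset $S$ under the transposition exchanging $i$ and $i+1$.
   Context: Base field $\mathbb{C}(q)$, $q$ an indeterminate. $[A,B]=AB-BA$, $[A,B]_q=\frac{1}{q-q^{-1}}(qAB-q^{-1}BA)$. For $I,J\subseteq\{1,\dots,n\}$, $I<J$ means every element of $I$ is strictly smaller than every element of $J$. A connected subset is a non-empty set of consecutive integers. Two disjoint connected subsets are adjacent if their union is connected. A sequence $(I_1,\dots,I_k)$ of connected subsets is monotonic if $I_1<\dots<I_k$ or $I_1>\dots>I_k$; it is a monotonic sequence of adjacent subsets if moreover $I_j,I_{j+1}$ are adjacent for all $j$. Elements: $C_I$ for $I\subseteq\{1,\dots,n\}$ connected; $C_\varnothing:=1$; $C_{j\dots k}:=C_{\{j,\dots,k\}}$. Adjacent sets in an index are merged (e.g. $C_{I_1I_2}=C_{I_2I_1}:=C_{I_1\cup I_2}$ if $I_1,I_2$ are adjacent; $C_{I_1I_3I_4}$ with $I_3,I_4$ adjacent means $C_{I_1(I_3\cup I_4)}$); empty sets are dropped. For a monotonic sequence $(I_1,\dots,I_k)$, $k\ge2$, of connected subsets with non-empty holes $H_a$ (the set of integers strictly between $I_a$ and $I_{a+1}$), define recursively on $k$, for any choice of $a\in\{1,\dots,k-1\}$ (the result does not depend on $a$; one may take $a=1$), $$C_{I_1\dots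 I_k}:=-[C_{I_1\dots I_aH_a},C_{H_aI_{a+1}\dots I_k}]_q+C_{I_1\dots I_a}C_{I_{a+1}\dots I_k}+C_{H_a}C_{I_1\dots I_aH_aI_{a+1}\dots I_k}.$$ For $k=2$ this reads $C_{I_1I_2}=-[C_{I_1H},C_{HI_2}]_q+C_{I_1}C_{I_2}+C_HC_{I_1HI_2}$, with $H$ the hole between $I_1$ and $I_2$ (the order of the sequence matters). The algebra $\mathfrak{aw}(n)$ is the unital associative algebra generated by the $C_I$, $I$ a connected subset of $\{1,\dots,n\}$, with relations: (i) $[C_I,C_J]=0$ for connected $I,J$ with $I\cap J=\varnothing$ or $I\subset J$; (ii) $C_{I_1I_2}=-[C_{I_2I_3},C_{I_1I_3}]_q+C_{I_1}C_{I_2}+C_{I_3}C_{I_1I_2I_3}$ for every monotonic sequence $(I_1,I_2,I_3)$ of adjacent connected subsets; (iii) $C_{I_1I_4}=-[C_{I_1I_3},C_{I_3I_4}]_q+C_{I_1}C_{I_4}+C_{I_3}C_{I_1I_3I_4}$ for every monotonic sequence $(I_1,I_2,I_3,I_4)$ of adjacent connected subsets. For $1\le i\le n-1$, $r_i$ is the algebra automorphism of $\mathfrak{aw}(n)$ (known to be well defined) given on generators by $r_i(C_{i+1\dots k})=C_{\{i\}\{i+2,\dots,k\}}$ for $k\ge i+1$; $r_i(C_{j\dots i})=C_{\{i+1\}\{j,\dots,i-1\}}$ for $j\le i$; $r_i(C_{j\dots k})=C_{j\dots k}$ if $\{i,i+1\}\subset\{j,\dots,k\}$ or $\{i,i+1\}\cap\{j,\dots,k\}=\varnothing$.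 $\bar r_i$ is the inverse of $r_i$. For an arbitrary subset $S\subseteq\{1,\dots,n\}$ with maximal connected components $S_1<\dots<S_k$, write $C_S:=C_{S_1\dots S_k}$ (increasing order). For subsets $I_1<I_2<I_3$ (arbitrary, possibly empty or not connected, not necessarily adjacent), write $C_{I_1I_2}=C_{I_1\cup I_2}$ etc., and set $$\begin{aligned}\varOmega_{I_1,I_2,I_3}={}&qC_{I_1I_2}C_{I_2I_3}C_{I_1I_3}+\frac{q^2C_{I_1I_2}^2+q^{-2}C_{I_2I_3}^2+q^2C_{I_1I_3}^2+C_{I_1I_2I_3}^2+C_{I_1}^2+C_{I_2}^2+C_{I_3}^2}{q+q^{-1}}\\&-qC_{I_1I_2}(C_{I_1}C_{I_2}+C_{I_3}C_{I_1I_2I_3})-q^{-1}C_{I_2I_3}(C_{I_2}C_{I_3}+C_{I_1}C_{I_1I_2I_3})\\&-qC_{I_1I_3}(C_{I_1}C_{I_3}+C_{I_2}C_{I_1I_2I_3})+(q+q^{-1})C_{I_1}C_{I_2}C_{I_3}C_{I_1I_2I_3}-\frac{1}{q+q^{-1}},\end{aligned}$$ which is $0$ if one of the $I_j$ is empty. For $|S|\ge3$, choose non-empty $I_1<I_2<I_3$ with $I_1\cup I_2\cup I_3=S$ and set $$\omega_S=\sum_{I\subseteq I_1,\ J\subseteq I_2,\ K\subseteq I_3}(-1)^{|S|-|I|-|J|-|K|}\,\varOmega_{I,J,K},$$ which does not depend on the choice of $I_1,I_2,I_3$. *)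

theory Defs
  imports
    "HOL-Library.Poly_Mapping"
    "HOL-Computational_Algebra.Polynomial"
    "HOL-Computational_Algebra.Fraction_Field"
    "HOL-Combinatorics.Transposition"
    "HOL-Algebra.QuotRing"
begin

section \<open>Connected subsets and sequences of them\<close>

definition connected_set :: "nat set \<Rightarrow> bool"
  where "connected_set I \<longleftrightarrow> (\<exists>a b. a \<le> b \<and> I = {a..b})"

definition connected_in :: "nat \<Rightarrow> nat set \<Rightarrow> bool"
  where "connected_in n I \<longleftrightarrow> connected_set I \<and> I \<subseteq> {1..n}"

definition set_less :: "nat set \<Rightarrow> nat set \<Rightarrow> bool"
  where "set_less I J \<longleftrightarrow> (\<forall>x\<in>I. \<forall>y\<in>J. x < y)"

definition adjacent :: "nat set \<Rightarrow> nat set \<Rightarrow> bool"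
  where "adjacent I J \<longleftrightarrow>
    connected_set I \<and> connected_set J \<and> I \<inter> J = {} \<and> connected_set (I \<union> J)"

definition monotonic :: "nat set list \<Rightarrow> bool"
  where "monotonic Is \<longleftrightarrow>
    (\<forall>I\<in>set Is. connected_set I) \<and>
    (sorted_wrt set_less Is \<or> sorted_wrt (\<lambda>I J. set_less J I) Is)"

definition monotonic_adjacent :: "nat set list \<Rightarrow> bool"
  where "monotonic_adjacent Is \<longleftrightarrow> monotonic Is \<and> successively adjacent Is"

definition hole :: "nat set \<Rightarrow> nat set \<Rightarrow> nat set"
  where "hole I J =
    {x. set_less I {x} \<and> set_less {x} J \<or> set_less J {x} \<and> set_less {x} I}"

definition components :: "nat set \<Rightarrow> nat set set"
  where "components S =
    {T. connected_set T \<and> T \<subseteq> S \<and> (\<forall>T'. connected_set T' \<and> T \<subseteq> T' \<and> T' \<subseteq> S \<longrightarrow> T' = T)}"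

definition component_list :: "nat set \<Rightarrow> nat set list"
  where "component_list S = sorted_key_list_of_set Min (components S)"

text \<open>The convention for index sequences: empty sets are dropped, neighbouring adjacent sets are
  merged.\<close>

fun merge_index :: "nat set list \<Rightarrow> nat set list"
  where
    "merge_index [] = []"
  | "merge_index (I # Is) =
      (if I = {} then merge_index Is
       else case merge_index Is of
         [] \<Rightarrow> [I]
       | J # Js \<Rightarrow> if adjacent I J then (I \<union> J) # Js else I # J # Js)"


section \<open>The free algebra over the field of rational functions\<close>

type_synonym coeff = "complex poly fract"

definition q :: coeff
  where "q = Fract [:0, 1:] 1"

text \<open>Words in the letters \<open>C\<^sub>I\<close>, each letter being represented by its index \<open>I\<close>. As
  a monoid under concatenation (written additively, as \<^theory>\<open>HOL-Library.Poly_Mapping\<close> requires) they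
  make \<open>aw_word \<Rightarrow>\<^sub>0 coeff\<close> the free algebra, with multiplication given by convolution.\<close>

datatype aw_word = Word (letters: "nat set list")

instantiation aw_word :: monoid_add
begin

definition zero_aw_word :: aw_word
  where "0 = Word []"

definition plus_aw_word :: "aw_word \<Rightarrow> aw_word \<Rightarrow> aw_word"
  where "u + v = Word (letters u @ letters v)"

instance
  by standard (simp_all add: zero_aw_word_def plus_aw_word_def)

end

type_synonym free_alg = "aw_word \<Rightarrow>\<^sub>0 coeff"

definition scalar :: "coeff \<Rightarrow> free_alg"
  where "scalar c = Poly_Mapping.single 0 c"

definition smult_q :: "coeff \<Rightarrow> free_alg \<Rightarrow> free_alg"  (infixr "*\<^sub>q" 75)
  where "c *\<^sub>q A = scalar c * A"

definition comm :: "free_alg \<Rightarrow> free_alg \<Rightarrow> free_alg"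
  where "comm A B = A * B - B * A"

definition qcomm :: "free_alg \<Rightarrow> free_alg \<Rightarrow> free_alg"
  where "qcomm A B =
    (1 / (q - inverse q)) *\<^sub>q (q *\<^sub>q (A * B) - inverse q *\<^sub>q (B * A))"


section \<open>The elements \<open>C\<close>, as elements of the free algebra\<close>

definition C_conn :: "nat set \<Rightarrow> free_alg"
  where "C_conn I = (if I = {} then 1 else Poly_Mapping.single (Word [I]) 1)"

text \<open>The recursion for a monotonic sequence with non-empty holes, always
  splitting at the first hole.\<close>

fun C_rec :: "nat set list \<Rightarrow> free_alg"
  where
    "C_rec [] = 1"
  | "C_rec [I] = C_conn I"
  | "C_rec (I # J # Js) =
      (let H = hole I J in
        - qcomm (C_conn (I \<union> H)) (C_rec ((H \<union> J) # Js))
        + C_conn I * C_rec (J # Js)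
        + C_conn H * C_rec ((I \<union> H \<union> J) # Js))"

definition C_seq :: "nat set list \<Rightarrow> free_alg"
  where "C_seq Is = C_rec (merge_index Is)"

definition C_set :: "nat set \<Rightarrow> free_alg"
  where "C_set S = C_seq (component_list S)"


section \<open>The algebra \<open>aw(n)\<close>\<close>

definition free_aw :: "nat \<Rightarrow> free_alg ring"
  where "free_aw n =
    \<lparr>carrier = {A. \<forall>w\<in>Poly_Mapping.keys A. \<forall>I\<in>set (letters w). connected_in n I},
     mult = (*), one = 1, zero = 0, add = (+)\<rparr>"

definition aw_relators :: "nat \<Rightarrow> free_alg set"
  where "aw_relators n =
    {comm (C_seq [I]) (C_seq [J]) | I J.
       connected_in n I \<and> connected_in n J \<and> (I \<inter> J = {} \<or> I \<subseteq> J)}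
    \<union>
    {C_seq [I1, I2]
       - (- qcomm (C_seq [I2, I3]) (C_seq [I1, I3])
          + C_seq [I1] * C_seq [I2] + C_seq [I3] * C_seq [I1, I2, I3]) | I1 I2 I3.
       monotonic_adjacent [I1, I2, I3] \<and> (\<forall>I\<in>{I1, I2, I3}. I \<subseteq> {1..n})}
    \<union>
    {C_seq [I1, I4]
       - (- qcomm (C_seq [I1, I3]) (C_seq [I3, I4])
          + C_seq [I1] * C_seq [I4] + C_seq [I3] * C_seq [I1, I3, I4]) | I1 I2 I3 I4.
       monotonic_adjacent [I1, I2, I3, I4] \<and> (\<forall>I\<in>{I1, I2, I3, I4}. I \<subseteq> {1..n})}"

definition aw_ideal :: "nat \<Rightarrow> free_alg set"
  where "aw_ideal n = genideal (free_aw n) (aw_relators n)"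

definition aw :: "nat \<Rightarrow> free_alg set ring"
  where "aw n = free_aw n Quot aw_ideal n"

definition aw_class :: "nat \<Rightarrow> free_alg \<Rightarrow> free_alg set"
  where "aw_class n A = aw_ideal n +>\<^bsub>free_aw n\<^esub> A"

definition aw_automorphism :: "nat \<Rightarrow> (free_alg set \<Rightarrow> free_alg set) \<Rightarrow> bool"
  where "aw_automorphism n f \<longleftrightarrow>
    f \<in> ring_iso (aw n) (aw n) \<and> (\<forall>c. f (aw_class n (scalar c)) = aw_class n (scalar c))"

text \<open>\<open>f\<close> is the automorphism \<open>r\<^sub>i\<close>; its values on the generators determine it on the carrier of
  \<open>aw n\<close>.\<close>

definition is_r :: "nat \<Rightarrow> nat \<Rightarrow> (free_alg set \<Rightarrow> free_alg set) \<Rightarrow> bool"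
  where "is_r n i f \<longleftrightarrow>
    aw_automorphism n f \<and>
    (\<forall>k. i + 1 \<le> k \<and> k \<le> n \<longrightarrow>
      f (aw_class n (C_seq [{i+1..k}])) = aw_class n (C_seq [{i}, {i+2..k}])) \<and>
    (\<forall>j. 1 \<le> j \<and> j \<le> i \<longrightarrow>
      f (aw_class n (C_seq [{j..i}])) = aw_class n (C_seq [{i+1}, {j..i-1}])) \<and>
    (\<forall>j k. 1 \<le> j \<and> j \<le> k \<and> k \<le> n \<and> ({i, i+1} \<subseteq> {j..k} \<or> {i, i+1} \<inter> {j..k} = {}) \<longrightarrow>
      f (aw_class n (C_seq [{j..k}])) = aw_class n (C_seq [{j..k}]))"


section \<open>The elements \<open>\<Omega>\<close> and \<open>\<omega>\<close>, as elements of the free algebra\<close>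

definition Omega :: "nat set \<Rightarrow> nat set \<Rightarrow> nat set \<Rightarrow> free_alg"
  where "Omega I1 I2 I3 =
    (let C1 = C_set I1; C2 = C_set I2; C3 = C_set I3;
         C12 = C_set (I1 \<union> I2); C23 = C_set (I2 \<union> I3); C13 = C_set (I1 \<union> I3);
         C123 = C_set (I1 \<union> I2 \<union> I3)
     in q *\<^sub>q (C12 * C23 * C13)
        + (1 / (q + inverse q)) *\<^sub>q
            ((q^2) *\<^sub>q C12^2 + (inverse q ^ 2) *\<^sub>q C23^2 + (q^2) *\<^sub>q C13^2
             + C123^2 + C1^2 + C2^2 + C3^2)
        - q *\<^sub>q (C12 * (C1 * C2 + C3 * C123))
        - inverse q *\<^sub>q (C23 * (C2 * C3 + C1 * C123))
        - q *\<^sub>q (C13 * (C1 * C3 + C2 * C123))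
        + (q + inverse q) *\<^sub>q (C1 * C2 * C3 * C123)
        - scalar (1 / (q + inverse q)))"

definition ordered_splitting :: "nat set \<Rightarrow> nat set \<Rightarrow> nat set \<Rightarrow> nat set \<Rightarrow> bool"
  where "ordered_splitting S I1 I2 I3 \<longleftrightarrow>
    I1 \<noteq> {} \<and> I2 \<noteq> {} \<and> I3 \<noteq> {} \<and> set_less I1 I2 \<and> set_less I2 I3 \<and> I1 \<union> I2 \<union> I3 = S"

text \<open>For a splitting of \<open>S\<close> this represents \<open>\<omega>\<^sub>S\<close>. That the class in \<open>aw n\<close> depends
  only on \<open>S\<close> is a theorem, so the splitting is kept as an argument.\<close>

definition omega :: "nat set \<Rightarrow> nat set \<Rightarrow> nat set \<Rightarrow> free_alg"
  where "omega I1 I2 I3 =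
    (\<Sum>I\<in>Pow I1. \<Sum>J\<in>Pow I2. \<Sum>K\<in>Pow I3.
       (-1) ^ (card (I1 \<union> I2 \<union> I3) - card I - card J - card K) * Omega I J K)"

end

theory Submission
  imports Defs
begin

text \<open>Writing \<open>c i k\<close> for \<open>C\<close> of the interval from \<open>i + 1\<close> to \<open>k\<close>, the relations of
  \<open>aw(n)\<close> say that consecutive intervals behave like the sides and diagonals of a convex polygon. The
  image \<open>t\<close> of the family \<open>c\<close> under \<open>r\<^sub>i\<close> satisfies the same relations, and moving the holes of a set
  to the left by such twists reduces every statement about arbitrary sets to intervals. The elements
  \<open>\<Omega>\<close> satisfy an exchange identity for four consecutive sets \<open>A, B, C, D\<close>, of the shape
  \<open>f(AB) = f(BC) = f(CD) = f(DA)\<close>. It makes \<open>\<omega>\<close> independent of the splitting, and together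
  with the invariance of \<open>\<Omega>({i}, {i+1}, K)\<close> under \<open>r\<^sub>i\<close> it gives
  \<open>r\<^sub>i(\<Omega>(A, {i}, D)) = \<Omega>(A, {i+1}, D)\<close>, the only case in which \<open>r\<^sub>i\<close> does not merely permute
  the letters.\<close>

section \<open>Commutation and the q-bracket\<close>

text \<open>The \<open>f\<close> of the exchange identity is a defect of additivity:
  \<open>f(XY)\<close> is \<Omega> with X and Y merged in one slot, minus \<Omega> with X alone
  there, minus \<Omega> with Y alone there. In an alternating sum over the subsets of S, a term that
  ignores some element of S cancels; this is why \<omega> does not see where S is cut.

  The obstacle is that r_i sends C_X to the C of the exchanged set unless X contains i but not i+1.
  In that case the image is formed with pieces in reversed order and need not be the C of any set,
  so \<Omega>(A,{i},D) cannot be followed letter by letter. The exchange identity expresses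
  \<Omega>(A,{i},D) + \<Omega>(A,{i+1},D) through values of \<Omega> that r_i preserves, and the
  second summand does move letter by letter; subtraction gives the first.

  To iterate twists, \<open>t\<close> must satisfy every relation of aw(n). A letter of
  \<open>t\<close> ending at the cut point i is a linear expression in three letters of
  \<open>c\<close>, so relations linear in such letters transfer at once. Where two of them meet in
  a product, associativity of the q-bracket reduces the claim to neighbouring cut points.\<close>

definition com :: "'a::times \<Rightarrow> 'a \<Rightarrow> bool"
  where "com x y \<longleftrightarrow> x * y = y * x"

lemma com_sym: "com x y \<Longrightarrow> com y x"
  by (simp add: com_def)

lemma com_refl [simp]: "com x x"
  by (simp add: com_def)

lemma com_add [simp]:
  fixes x y z :: "'a::ring"
  shows "com x y \<Longrightarrow> com x z \<Longrightarrow> com x (y + z)"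
    and "com x z \<Longrightarrow> com y z \<Longrightarrow> com (x + y) z"
    and "com x y \<Longrightarrow> com x z \<Longrightarrow> com x (y - z)"
    and "com x z \<Longrightarrow> com y z \<Longrightarrow> com (x - y) z"
    and "com x y \<Longrightarrow> com x (- y)"
    and "com x y \<Longrightarrow> com (- x) y"
    and "com x 0" and "com 0 x"
  by (simp_all add: com_def algebra_simps)

lemma com_mult [simp]:
  fixes x y z :: "'a::semigroup_mult"
  shows "com x y \<Longrightarrow> com x z \<Longrightarrow> com x (y * z)"
    and "com x z \<Longrightarrow> com y z \<Longrightarrow> com (x * y) z"
proof -
  show "com x (y * z)" if "com x y" "com x z"
    using that unfolding com_def by (metis mult.assoc)
  show "com (x * y) z" if "com x z" "com y z"
    using that unfolding com_def by (metis mult.assoc)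
qed

lemma com_one [simp]:
  fixes x :: "'a::monoid_mult"
  shows "com x 1" and "com 1 x"
  by (simp_all add: com_def)

lemma com_sw: "com z x \<Longrightarrow> x * z = z * x"
  by (simp add: com_def)

lemma com_sw2:
  fixes x y z :: "'a::semigroup_mult"
  shows "com z x \<Longrightarrow> x * (z * y) = z * (x * y)"
  unfolding com_def by (metis mult.assoc)

text \<open>Here \<open>a = q / (q - q\<^sup>-\<^sup>1)\<close>, \<open>b = q\<^sup>-\<^sup>1 / (q - q\<^sup>-\<^sup>1)\<close> and \<open>w\<close> is the inverse of \<open>a + b\<close>.\<close>

locale qbracket =
  fixes a b w :: "'a::{ring,monoid_mult}"
  assumes a_central: "a * x = x * a"
    and b_central: "b * x = x * b"
    and a_minus_b: "a - b = 1"
    and w_inverse: "w * (a + b) = 1"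
begin

definition qb :: "'a \<Rightarrow> 'a \<Rightarrow> 'a"
  where "qb x y = a * (x * y) - b * (y * x)"

definition cm :: "'a \<Rightarrow> 'a \<Rightarrow> 'a"
  where "cm x y = x * y - y * x"

lemma com_ab [simp]: "com a x" "com b x" "com x a" "com x b"
  by (simp_all add: com_def a_central b_central)

lemma a_left: "x * (a * y) = a * (x * y)"
  by (simp add: com_sw2)

lemma b_left: "x * (b * y) = b * (x * y)"
  by (simp add: com_sw2)

lemma qb_lin:
  "qb (x + y) z = qb x z + qb y z" "qb x (y + z) = qb x y + qb x z"
  "qb (x - y) z = qb x z - qb y z" "qb x (y - z) = qb x y - qb x z"
  "qb (- x) z = - qb x z" "qb x (- z) = - qb x z"
  "qb 0 z = 0" "qb x 0 = 0"
  by (simp_all add: qb_def algebra_simps)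

lemma qb_com: "com x y \<Longrightarrow> qb x y = x * y"
proof -
  assume "com x y"
  then have "qb x y = (a - b) * (x * y)"
    by (simp add: qb_def com_def left_diff_distrib)
  then show ?thesis
    by (simp add: a_minus_b)
qed

lemma com_qb [simp]:
  "com x y \<Longrightarrow> com x z \<Longrightarrow> com x (qb y z)"
  "com x z \<Longrightarrow> com y z \<Longrightarrow> com (qb x y) z"
  by (simp_all add: qb_def)

lemma qb_scale_left: "com z y \<Longrightarrow> qb (z * x) y = z * qb x y"
proof -
  assume *: "com z y"
  have "y * (z * x) = z * (y * x)"
    using * by (rule com_sw2)
  then show ?thesis
    by (simp add: qb_def algebra_simps a_left [of y] a_left [of z] b_left [of y] b_left [of z])
qed

lemma qb_scale_right: "com z x \<Longrightarrow> qb x (z * y) = z * qb x y"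
proof -
  assume *: "com z x"
  have "x * (z * y) = z * (x * y)"
    using * by (rule com_sw2)
  then show ?thesis
    by (simp add: qb_def algebra_simps a_left [of x] a_left [of z] b_left [of x] b_left [of z])
qed

text \<open>Expanded, the two sides differ only by a multiple of the commutator of \<open>y\<close>
  with \<open>cm x z\<close>. Together with its two companions below this is the main engine: a
  triple with a commuting pair is bracketed in two ways, and known relations evaluate both.\<close>

lemma qb_assoc: "com x z \<Longrightarrow> qb (qb x y) z = qb x (qb y z)"
proof -
  assume *: "com x z"
  then have 1: "z * x = x * z" and 2: "\<And>u. z * (x * u) = x * (z * u)"
    by (simp_all add: com_sw com_sw2)
  show ?thesis
    by (simp add: qb_def algebra_simps a_left [of b] a_left [of x] a_left [of y] a_left [of z] b_left [of x] b_left [of y] b_left [of z] 1 2)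
qed

lemma qb_left_commute: "com x y \<Longrightarrow> qb x (qb y z) = qb y (qb x z)"
proof -
  assume *: "com x y"
  then have 1: "y * x = x * y" and 2: "\<And>u. y * (x * u) = x * (y * u)"
    by (simp_all add: com_sw com_sw2)
  show ?thesis
    by (simp add: qb_def algebra_simps a_left [of b] a_left [of x] a_left [of y] a_left [of z] b_left [of x] b_left [of y] b_left [of z] 1 2)
qed

lemma qb_right_commute: "com y z \<Longrightarrow> qb (qb x y) z = qb (qb x z) y"
proof -
  assume *: "com y z"
  then have 1: "z * y = y * z" and 2: "\<And>u. z * (y * u) = y * (z * u)"
    by (simp_all add: com_sw com_sw2)
  show ?thesis
    by (simp add: qb_def algebra_simps a_left [of b] a_left [of x] a_left [of y] a_left [of z] b_left [of x] b_left [of y] b_left [of z] 1 2)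
qed

text \<open>The cyclic sum of \<open>[x, y z]\<close> vanishes in every ring, and so does that of
  \<open>[x, z y]\<close>; centrality of \<open>a\<close> and \<open>b\<close> does the rest. It
  serves to show that two letters commute when neither is a generator.\<close>

lemma cm_jacobi: "cm x (qb y z) + cm y (qb z x) + cm z (qb x y) = 0"
  by (simp add: qb_def cm_def algebra_simps a_left [of b] a_left [of x] a_left [of y] a_left [of z] b_left [of x] b_left [of y] b_left [of z])

text \<open>Turns the vanishing of a sum of commutators into an identity between brackets taken in
  both orders; \<open>ab_cancel\<close> then divides by \<open>a + b\<close>, whose inverse is
  \<open>w\<close>.\<close>

lemma qb_diff_cm: "qb x y - qb y x = (a + b) * cm x y"
  by (simp add: qb_def cm_def algebra_simps)

lemma ab_cancel: "(a + b) * x = 0 \<Longrightarrow> x = 0"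
  by (metis mult.assoc mult_1 mult_zero_right w_inverse)

lemma cm_eq_0_iff: "cm x y = 0 \<longleftrightarrow> com x y"
  by (simp add: cm_def com_def)

end

section \<open>Four consecutive sets\<close>

text \<open>The letters are the ten intervals formed from four consecutive pieces, \<open>m\<close>
  being the union of all four. Single pieces and \<open>m\<close> commute with every interval; among
  the others only disjoint or nested pairs are assumed to commute.\<close>

locale aw_core = qbracket +
  fixes c1 c2 c3 c4 m C12 C23 C34 C123 C234 :: 'a
  assumes central: "z \<in> {c1, c2, c3, c4, m} \<Longrightarrow>
      x \<in> {c1, c2, c3, c4, m, C12, C23, C34, C123, C234} \<Longrightarrow> com z x"
    and com12_34: "com C12 C34" and com12_123: "com C12 C123" and com23_123: "com C23 C123"
    and com23_234: "com C23 C234" and com34_234: "com C34 C234"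
begin

text \<open>The letters with a hole, built from intervals by the defining recursion for two
  components in increasing order.\<close>

definition "C13 = c1 * c3 + c2 * C123 - qb C12 C23"
definition "C24 = c2 * c4 + c3 * C234 - qb C23 C34"
definition "C14 = c1 * c4 + m * C23 - qb C123 C234"
definition "C124 = c4 * C12 + c3 * m - qb C123 C34"
definition "C134 = c1 * C34 + c2 * m - qb C12 C234"

text \<open>The same holes with the arguments of the bracket exchanged: the elements that belong to
  the decreasing sequence. The twist produces these, so both kinds have to be carried along.\<close>

definition "D13 = c1 * c3 + c2 * C123 - qb C23 C12"
definition "D24 = c2 * c4 + c3 * C234 - qb C34 C23"
definition "D14 = c1 * c4 + m * C23 - qb C234 C123"
definition "D124 = c4 * C12 + c3 * m - qb C34 C123"
definition "D134 = c1 * C34 + c2 * m - qb C234 C12"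

lemmas CD_defs = C13_def C24_def C14_def C124_def C134_def D13_def D24_def D14_def D124_def D134_def

lemma com_gen [simp]:
  "z \<in> {c1, c2, c3, c4, m} \<Longrightarrow> com z c1" "z \<in> {c1, c2, c3, c4, m} \<Longrightarrow> com z c2"
  "z \<in> {c1, c2, c3, c4, m} \<Longrightarrow> com z c3" "z \<in> {c1, c2, c3, c4, m} \<Longrightarrow> com z c4"
  "z \<in> {c1, c2, c3, c4, m} \<Longrightarrow> com z m"
  "z \<in> {c1, c2, c3, c4, m} \<Longrightarrow> com z C12" "z \<in> {c1, c2, c3, c4, m} \<Longrightarrow> com z C23"
  "z \<in> {c1, c2, c3, c4, m} \<Longrightarrow> com z C34" "z \<in> {c1, c2, c3, c4, m} \<Longrightarrow> com z C123"
  "z \<in> {c1, c2, c3, c4, m} \<Longrightarrow> com z C234"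
  by (rule central; simp)+

lemma com_gen' [simp]:
  "z \<in> {c1, c2, c3, c4, m} \<Longrightarrow> com C12 z" "z \<in> {c1, c2, c3, c4, m} \<Longrightarrow> com C23 z"
  "z \<in> {c1, c2, c3, c4, m} \<Longrightarrow> com C34 z" "z \<in> {c1, c2, c3, c4, m} \<Longrightarrow> com C123 z"
  "z \<in> {c1, c2, c3, c4, m} \<Longrightarrow> com C234 z"
  by (rule com_sym; simp)+

lemma com_derived [simp]:
  "z \<in> {c1, c2, c3, c4, m} \<Longrightarrow> com z C13" "z \<in> {c1, c2, c3, c4, m} \<Longrightarrow> com z C24"
  "z \<in> {c1, c2, c3, c4, m} \<Longrightarrow> com z C14" "z \<in> {c1, c2, c3, c4, m} \<Longrightarrow> com z C124"
  "z \<in> {c1, c2, c3, c4, m} \<Longrightarrow> com z C134"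
  "z \<in> {c1, c2, c3, c4, m} \<Longrightarrow> com z D13" "z \<in> {c1, c2, c3, c4, m} \<Longrightarrow> com z D24"
  "z \<in> {c1, c2, c3, c4, m} \<Longrightarrow> com z D14" "z \<in> {c1, c2, c3, c4, m} \<Longrightarrow> com z D124"
  "z \<in> {c1, c2, c3, c4, m} \<Longrightarrow> com z D134"
  by (simp_all add: CD_defs)

lemma com_derived' [simp]:
  "z \<in> {c1, c2, c3, c4, m} \<Longrightarrow> com C13 z" "z \<in> {c1, c2, c3, c4, m} \<Longrightarrow> com C24 z"
  "z \<in> {c1, c2, c3, c4, m} \<Longrightarrow> com C14 z" "z \<in> {c1, c2, c3, c4, m} \<Longrightarrow> com C124 z"
  "z \<in> {c1, c2, c3, c4, m} \<Longrightarrow> com C134 z"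
  "z \<in> {c1, c2, c3, c4, m} \<Longrightarrow> com D13 z" "z \<in> {c1, c2, c3, c4, m} \<Longrightarrow> com D24 z"
  "z \<in> {c1, c2, c3, c4, m} \<Longrightarrow> com D14 z" "z \<in> {c1, c2, c3, c4, m} \<Longrightarrow> com D124 z"
  "z \<in> {c1, c2, c3, c4, m} \<Longrightarrow> com D134 z"
  by (rule com_sym; simp)+

lemmas com_letters = com12_34 com12_123 com23_123 com23_234 com34_234

lemma com_pairs [simp]:
  "com C12 C34" "com C12 C123" "com C23 C123" "com C23 C234" "com C34 C234"
  "com C34 C12" "com C123 C12" "com C123 C23" "com C234 C23" "com C234 C34"
  using com_letters by (auto intro: com_sym)

lemma com_pairs_derived [simp]:
  "com C13 C123" "com D13 C123" "com C24 C234" "com D24 C234"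
  "com C12 C124" "com C12 D124" "com C34 C134" "com C34 D134"
  "com C14 C23" "com D14 C23"
  by (simp_all add: CD_defs)

lemma com_pairs_derived' [simp]:
  "com C123 C13" "com C123 D13" "com C234 C24" "com C234 D24"
  "com C124 C12" "com D124 C12" "com C134 C34" "com D134 C34"
  "com C23 C14" "com C23 D14"
  by (rule com_sym; simp)+

lemma qb_defs:
  "qb C12 C23 = c1 * c3 + c2 * C123 - C13" "qb C23 C34 = c2 * c4 + c3 * C234 - C24"
  "qb C123 C234 = c1 * c4 + m * C23 - C14" "qb C123 C34 = c4 * C12 + c3 * m - C124"
  "qb C12 C234 = c1 * C34 + c2 * m - C134"
  "qb C23 C12 = c1 * c3 + c2 * C123 - D13" "qb C34 C23 = c2 * c4 + c3 * C234 - D24"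
  "qb C234 C123 = c1 * c4 + m * C23 - D14" "qb C34 C123 = c4 * C12 + c3 * m - D124"
  "qb C234 C12 = c1 * C34 + c2 * m - D134"
  by (simp_all add: CD_defs)

lemma scal:
  "z \<in> {c1, c2, c3, c4, m} \<Longrightarrow> com z y \<Longrightarrow> qb (z * x) y = z * qb x y"
  "z \<in> {c1, c2, c3, c4, m} \<Longrightarrow> com z y \<Longrightarrow> qb y (z * x) = z * qb y x"
  by (simp_all add: qb_scale_left qb_scale_right)

lemma central_order:
  "c2 * c1 = c1 * c2" "c3 * c1 = c1 * c3" "c4 * c1 = c1 * c4" "m * c1 = c1 * m"
  "c3 * c2 = c2 * c3" "c4 * c2 = c2 * c4" "m * c2 = c2 * m"
  "c4 * c3 = c3 * c4" "m * c3 = c3 * m" "m * c4 = c4 * m"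
  "c2 * (c1 * x) = c1 * (c2 * x)" "c3 * (c1 * x) = c1 * (c3 * x)" "c4 * (c1 * x) = c1 * (c4 * x)"
  "m * (c1 * x) = c1 * (m * x)" "c3 * (c2 * x) = c2 * (c3 * x)" "c4 * (c2 * x) = c2 * (c4 * x)"
  "m * (c2 * x) = c2 * (m * x)" "c4 * (c3 * x) = c3 * (c4 * x)" "m * (c3 * x) = c3 * (m * x)"
  "m * (c4 * x) = c4 * (m * x)"
  by (rule com_sw com_sw2; simp)+

lemma letter_central:
  assumes "z \<in> {c1, c2, c3, c4, m}"
    and "x \<in> {C12, C23, C34, C123, C234, C13, C24, C14, C124, C134, D13, D24, D14, D124, D134}"
  shows "x * z = z * x" "x * (z * y) = z * (x * y)"
proof -
  have "com z x"
    using assms(2) by (elim insertE emptyE) (simp_all only: com_gen com_derived assms(1))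
  then show "x * z = z * x" "x * (z * y) = z * (x * y)"
    by (fact com_sw com_sw2)+
qed

lemmas letter_central' = letter_central [of c1, simplified] letter_central [of c2, simplified]
  letter_central [of c3, simplified] letter_central [of c4, simplified] letter_central [of m, simplified]

lemma pair_order:
  "C34 * C12 = C12 * C34" "C123 * C12 = C12 * C123" "C123 * C23 = C23 * C123"
  "C234 * C23 = C23 * C234" "C234 * C34 = C34 * C234"
  by (rule com_sw; simp)+

lemmas nf = qb_lin qb_defs scal qb_com central_order letter_central' pair_order algebra_simps

end

text \<open>\<open>Txyz\<close> names the relation
  \<open>qb C_xy C_yz = c_x * c_z + c_y * C_xyz - C_xz\<close> for three pieces met in this cyclic
  order, a union being written as a block of digits; \<open>R134\<close> is a mirrored one. Two
  triangle relations for intervals are held back, since given the rest each implies the other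
  (\<open>T23_41\<close>, \<open>T2_34_1\<close>), and this equivalence is used for the twisted
  family.\<close>

locale aw_core2 = aw_core +
  assumes T231: "qb C23 C13 = c1 * c2 + c3 * C123 - C12"
    and T312: "qb C13 C12 = c2 * c3 + c1 * C123 - C23"
    and T342: "qb C34 C24 = c2 * c3 + c4 * C234 - C23"
    and T423: "qb C24 C23 = c3 * c4 + c2 * C234 - C34"
    and T3412: "qb C34 C124 = c3 * C12 + c4 * m - C123"
    and T4123: "qb C124 C123 = c3 * c4 + m * C12 - C34"
    and T41_23: "qb C14 C123 = c4 * C23 + c1 * m - C234"
    and T34_12: "qb C134 C12 = c2 * C34 + c1 * m - C234"
    and T134: "qb C13 C34 = c1 * c4 + c3 * C134 - C14"
    and R134: "qb D24 C12 = c1 * c4 + c2 * D124 - D14"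
begin

lemmas nf2 = nf T231 T312 T342 T423 T3412 T4123 T41_23 T34_12 T134 R134

text \<open>The bracket is associative here because \<open>x\<close> commutes with itself. This
  carries a relation for a letter \<open>C\<close> over to its reversed letter
  \<open>D\<close>.\<close>

lemma flip: "qb x (qb y x) = qb (qb x y) x"
  by (simp add: qb_assoc)

lemma S231: "qb D13 C23 = c1 * c2 + c3 * C123 - C12"
  using flip [of C23 C12] T231 by (simp add: nf)

lemma S312: "qb C12 D13 = c2 * c3 + c1 * C123 - C23"
  using flip [of C12 C23] T312 by (simp add: nf)

lemma S342: "qb D24 C34 = c2 * c3 + c4 * C234 - C23"
  using flip [of C34 C23] T342 by (simp add: nf)

lemma S423: "qb C23 D24 = c3 * c4 + c2 * C234 - C34"
  using flip [of C23 C34] T423 by (simp add: nf)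

lemma S3412: "qb D124 C34 = c3 * C12 + c4 * m - C123"
  using flip [of C34 C123] T3412 by (simp add: nf)

lemma S4123: "qb C123 D124 = c3 * c4 + m * C12 - C34"
  using flip [of C123 C34] T4123 by (simp add: nf)

lemma S41_23: "qb C123 D14 = c4 * C23 + c1 * m - C234"
  using flip [of C123 C234] T41_23 by (simp add: nf)

lemma S34_12: "qb C12 D134 = c2 * C34 + c1 * m - C234"
  using flip [of C12 C234] T34_12 by (simp add: nf)

text \<open>Pattern of the derivations to come: \<open>C12\<close> and \<open>C34\<close> commute,
  so both bracketings of \<open>C12\<close>, \<open>C23\<close>, \<open>C34\<close> agree, and
  evaluating the inner brackets turns the known \<open>T134\<close> into the new relation.\<close>

lemma T124: "qb C12 C24 = c1 * c4 + c2 * C124 - C14"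
proof -
  have "qb C12 (qb C23 C34) = qb (qb C12 C23) C34"
    by (simp add: qb_assoc)
  then show ?thesis
    by (simp add: nf T134)
qed

lemma R124: "qb C34 D13 = c1 * c4 + c3 * D134 - D14"
proof -
  have "qb C34 (qb C23 C12) = qb (qb C34 C23) C12"
    by (simp add: qb_assoc)
  then show ?thesis
    by (simp add: nf R134)
qed

end

section \<open>Derived relations and commutations for four consecutive pieces\<close>

context aw_core2
begin

lemmas nf3 = nf2 S231 S312 S342 S423 S3412 S4123 S41_23 S34_12 T124 R124

lemma T412: "qb C14 C12 = c2 * c4 + c1 * C124 - C24"
  using qb_right_commute [of C34 C12 C13] by (simp add: nf3)

lemma T341: "qb C34 C14 = c1 * c3 + c4 * C134 - C13"
  using qb_left_commute [of C34 C12 C24] by (simp add: nf3)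

lemma S412: "qb C12 D14 = c2 * c4 + c1 * D124 - D24"
  using qb_left_commute [of C12 C34 D13] by (simp add: nf3)

lemma S341: "qb D14 C34 = c1 * c3 + c4 * D134 - D13"
  using qb_right_commute [of C12 C34 D24] by (simp add: nf3)

lemmas nf4 = nf3 T412 T341 S412 S341

text \<open>Letters of both orders meet here, as in \<open>tR0m\<close> and \<open>R0\<close> below.
  Such relations are needed because the twist reverses some holes and leaves others alone.\<close>

lemma R0m: "qb C123 D24 = c4 * C13 + c2 * m - C134"
  using qb_left_commute [of C123 C12 D14] by (simp add: nf4)

lemma tR0m: "qb C24 C123 = c4 * D13 + c2 * m - D134"
  using qb_right_commute [of C12 C123 C14] by (simp add: nf4)

lemma Um: "qb C124 C23 = c3 * C14 + c2 * m - C134"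
  using qb_assoc [of C123 C23 C34] by (simp add: nf4 R0m)

lemma tUm: "qb C23 D124 = c3 * D14 + c2 * m - D134"
  using qb_assoc [of C23 C123 C34] by (simp add: nf4 tR0m)

lemma U: "qb C23 C134 = c2 * C14 + c3 * m - C124"
  using qb_left_commute [of C23 C123 D24] by (simp add: nf4 R0m)

lemma tU: "qb D134 C23 = c2 * D14 + c3 * m - D124"
  using qb_right_commute [of C23 C123 C24] by (simp add: nf4 tR0m)

lemma R0: "qb D13 C234 = c1 * C24 + c3 * m - C124"
  using qb_assoc [of C23 C234 C12] by (simp add: nf4 U)

lemmas nf5 = nf4 R0m tR0m Um tUm U tU R0

lemma T413: "qb C14 C13 = c3 * c4 + c1 * C134 - C34"
  using qb_assoc [of C14 C23 C12] by (simp add: nf5)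

lemma S124: "qb C234 C124 = c1 * c3 + m * C24 - D13"
  using qb_assoc [of C234 C34 C123] by (simp add: nf5)

lemmas nf6 = nf5 T413 S124

lemma T3412': "qb C134 C124 = c2 * c3 + m * C14 - C23"
  using qb_assoc [of C12 C124 C234] by (simp add: nf6)

lemma cm_lin:
  "cm (x + y) z = cm x z + cm y z" "cm x (y + z) = cm x y + cm x z"
  "cm (x - y) z = cm x z - cm y z" "cm x (y - z) = cm x y - cm x z"
  "cm (- x) z = - cm x z" "cm x (- z) = - cm x z"
  by (simp_all add: cm_def algebra_simps)

lemma cm_com: "com x y \<Longrightarrow> cm x y = 0"
  by (simp add: cm_eq_0_iff)

lemma cm_scal:
  assumes "z \<in> {c1, c2, c3, c4, m}" and *: "com z x"
  shows "cm x (z * y) = z * cm x y" and "cm (z * y) x = z * cm y x"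
proof -
  show "cm x (z * y) = z * cm x y"
    using com_sw2 [OF *] by (simp add: cm_def mult.assoc right_diff_distrib)
  show "cm (z * y) x = z * cm y x"
    using com_sw2 [OF *] by (simp add: cm_def mult.assoc right_diff_distrib)
qed

text \<open>Nested sets should commute, but neither letter is a generator. Jacobi, applied with
  \<open>C124\<close> written as a bracket, leaves \<open>c4\<close> times a sum of three
  commutators; comparing brackets in both orders shows that this sum is zero.\<close>

lemma com24_124 [simp]: "com C24 C124"
proof -
  have 1: "cm C24 C124 = c4 * (cm C24 C12 + cm C123 C234 + cm C34 D13)"
    using cm_jacobi [of C24 C123 C34]
    by (simp add: nf6 cm_lin cm_scal cm_com)
  \<comment> \<open>Neither \<open>qb C24 C12\<close> nor \<open>qb D13 C34\<close> has a value of
    its own; they are compared by bracketing \<open>C23\<close> on the right with \<open>C34\<close>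
    and \<open>C12\<close> in either order.\<close>
  have 2: "qb C24 C12 - c2 * C124 = qb D13 C34 - c3 * D134"
    using qb_right_commute [of C34 C12 C23] by (simp add: nf6)
  have "(a + b) * (cm C24 C12 + cm C123 C234 + cm C34 D13) = 0"
    unfolding distrib_left [of "a + b"] qb_diff_cm [symmetric] using 2
    by (simp add: nf6)
  then have "cm C24 C12 + cm C123 C234 + cm C34 D13 = 0"
    by (rule ab_cancel)
  then have "cm C24 C124 = 0"
    using 1 by simp
  then show ?thesis
    by (simp add: cm_eq_0_iff)
qed

lemma com_D13_D134 [simp]: "com D13 D134"
proof -
  have 1: "cm D13 D134 = c1 * (cm D13 C34 + cm C234 C123 + cm C12 C24)"
    using cm_jacobi [of D13 C234 C12]
    by (simp add: nf6 cm_lin cm_scal cm_com)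
  have 2: "qb C24 C12 - c2 * C124 = qb D13 C34 - c3 * D134"
    using qb_right_commute [of C34 C12 C23] by (simp add: nf6)
  have "(a + b) * (cm D13 C34 + cm C234 C123 + cm C12 C24) = 0"
    unfolding distrib_left [of "a + b"] qb_diff_cm [symmetric] using 2
    by (simp add: nf6)
  then have "cm D13 C34 + cm C234 C123 + cm C12 C24 = 0"
    by (rule ab_cancel)
  then have "cm D13 D134 = 0"
    using 1 by simp
  then show ?thesis
    by (simp add: cm_eq_0_iff)
qed

lemma D14_13: "D14 = c1 * c4 + c3 * D134 - qb C34 D13"
  by (simp add: R124)

lemma com_D14_D134 [simp]: "com D14 D134"
  by (subst D14_13) simp

lemma D124_134: "D124 = c2 * D14 + c3 * m - qb D134 C23"
  by (simp add: tU)

lemma com_D124_D14 [simp]: "com D14 D124"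
  by (subst D124_134) simp

lemma D24_14: "D24 = c2 * c4 + c1 * D124 - qb C12 D14"
  by (simp add: S412)

lemma com_D24_D124 [simp]: "com D24 D124"
  by (subst D24_14) (simp add: com_sym [OF com_D124_D14] com_D124_D14)

lemma C14_24: "C14 = c1 * c4 + c2 * C124 - qb C12 C24"
  by (simp add: T124)

lemma com14_124 [simp]: "com C14 C124"
  unfolding C14_24 by simp

lemma C134_124: "C134 = c3 * C14 + c2 * m - qb C124 C23"
  by (simp add: Um)

lemma com14_134 [simp]: "com C14 C134"
  by (subst C134_124) simp

lemma C13_14: "C13 = c1 * c3 + c4 * C134 - qb C34 C14"
  by (simp add: T341)

lemma com13_134 [simp]: "com C13 C134"
  by (subst C13_14) simp

lemma com_pairs2 [simp]: "com C124 C24" "com C124 C14" "com C134 C14" "com C134 C13"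
  by (rule com_sym; simp)+

text \<open>The index sets interlace, yet the opposite orders let the letters commute: pictured as
  loops, they avoid each other by passing on opposite sides. For the twisted family this becomes the
  commutation of two disjoint intervals that meet at the cut point \<open>s\<close>.\<close>

lemma com_D13_C24 [simp]: "com D13 C24"
proof -
  have 1: "cm D13 C24 = c3 * (cm C34 C123 + cm C23 D134 + cm D13 C234)"
    using cm_jacobi [of D13 C23 C34]
    by (simp add: nf6 cm_lin cm_scal cm_com)
  have 2: "qb C234 D13 = qb C23 D134 + c1 * C24 - c2 * D14"
    using qb_left_commute [of C234 C23 C12] by (simp add: nf6)
  have "(a + b) * (cm C34 C123 + cm C23 D134 + cm D13 C234) = 0"
    unfolding distrib_left [of "a + b"] qb_diff_cm [symmetric]
    by (simp add: nf6 2)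
  then have "cm C34 C123 + cm C23 D134 + cm D13 C234 = 0"
    by (rule ab_cancel)
  then have "cm D13 C24 = 0"
    using 1 by simp
  then show ?thesis
    by (simp add: cm_eq_0_iff)
qed

lemma D24a: "qb D134 C24 = qb C234 C14 - c1 * C23 + c2 * D13"
  using qb_assoc [of C234 C24 C12] by (simp add: nf6)

text \<open>Together with its converse \<open>T2_34_1\<close> this trades a triangle relation for
  the one cut at a neighbouring place. For the twisted family only one of the two is known at
  first.\<close>

lemma T23_41:
  assumes "qb D134 C234 = c1 * c2 + m * C34 - C12"
  shows "qb C234 C14 = c1 * C23 + c4 * m - C123"
proof -
  have "qb D134 C24 = c2 * D13 + c4 * m - C123"
    using qb_assoc [of D134 C34 C23] assms by (simp add: nf6)
  then show ?thesis using D24a by (simp add: algebra_simps)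
qed

lemma T2_34_1:
  assumes "qb C234 C14 = c1 * C23 + c4 * m - C123"
  shows "qb D134 C234 = c1 * c2 + m * C34 - C12"
proof -
  have *: "qb C24 C14 = c1 * c2 + c4 * C124 - C12"
    using qb_assoc [of C23 C14 C34] assms by (simp add: nf6)
  then show ?thesis
    using qb_assoc [of C24 C234 C123] by (simp add: nf6 *)
qed

end

locale aw4 = aw_core2 +
  assumes T23_41': "qb C234 C14 = c1 * C23 + c4 * m - C123"
    and T2_34_1': "qb C234 C134 = c1 * c2 + m * C34 - C12"
begin

lemma T241: "qb C24 C14 = c1 * c2 + c4 * C124 - C12"
  using qb_assoc [of C23 C14 C34] by (simp add: nf6 T23_41')

text \<open>The triangle relation for the pieces 12, 3, 4 after the exchange of 2 and 3:
  \<open>C12\<close>, \<open>C34\<close>, \<open>c3\<close> have become \<open>D13\<close>,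
  \<open>C24\<close>, \<open>c2\<close>. The letter \<open>C34\<close> occurs in both arguments of a
  bracket, so the relation does not transfer by linearity.\<close>

lemma twisted_T34_12:
  "qb C24 (c4 * D13 + c2 * m - qb C123 C24) = c2 * D13 + c4 * m - C123"
proof -
  have 1: "qb C123 C24 = c4 * D13 + qb C23 C124 - c3 * C14"
    using qb_left_commute [of C123 C23 C34] by (simp add: nf6)
  have "qb C24 (qb C23 C124) = qb (qb C24 C23) C124"
    by (simp add: qb_assoc)
  then have 2: "qb C24 (qb C23 C124) =
      c3 * (c4 * C124) + c2 * (c1 * c3 + m * C24 - D13) - (c3 * C12 + c4 * m - C123)"
    by (simp add: nf6)
  have 3: "qb C24 D13 = D13 * C24"
    using com_D13_C24 by (simp add: qb_com com_sym com_sw)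
  show ?thesis
    by (simp add: nf6 1 2 3 T241 )
qed

lemma S23_41: "qb D14 C234 = c1 * C23 + c4 * m - C123"
  using flip [of C234 C123] T23_41' by (simp add: nf6)

text \<open>The same for the pieces 1, 2, 3 after the exchange of 3 and 4: \<open>c3\<close>,
  \<open>C23\<close>, \<open>C123\<close> have become \<open>c4\<close>, \<open>D24\<close>,
  \<open>D124\<close>.\<close>

lemma twisted_T2_34_1:
  "qb D24 (c1 * c4 + c2 * D124 - qb C12 D24) = c1 * c2 + c4 * D124 - C12"
proof -
  have 1: "qb D14 D24 = c1 * c2 + c4 * D124 - C12"
    using qb_assoc [of D14 C23 C34] by (simp add: nf6 S23_41)
  have 2: "qb D24 (qb C12 D24) = qb (qb D24 C12) D24"
    by (rule flip)
  have 3: "qb D124 D24 = D24 * D124" "qb D24 D124 = D24 * D124"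
    using com_D24_D124 by (simp_all add: qb_com com_sym com_sw)
  show ?thesis
    by (simp add: nf6 1 2 3)
qed

end

section \<open>Casimir elements and a cyclically symmetric system of relations\<close>

locale qscalars = qbracket +
  fixes q qi k h :: 'a
  assumes scalar_central: "z \<in> {q, qi, k, h} \<Longrightarrow> z * x = x * z"
    and a_eq: "a = k * q" and b_eq: "b = k * qi"
    and q_qi: "q * qi = 1"
    and h_eq: "h * (q + qi) = 1"
begin

text \<open>The expression \<Omega> as a function of its letters: \<open>x\<close>,
  \<open>y\<close>, \<open>z\<close> for the single sets, \<open>A\<close>, \<open>B\<close>,
  \<open>C\<close> for the pairs 12, 23, 13 and \<open>u\<close> for the triple. The scalars
  \<open>qi\<close>, \<open>k\<close>, \<open>h\<close> are the inverses of \<open>q\<close>,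
  \<open>q - qi\<close>, \<open>q + qi\<close>. With free letters, reversed ones can be inserted
  too.\<close>

definition Casimir :: "'a \<Rightarrow> 'a \<Rightarrow> 'a \<Rightarrow> 'a \<Rightarrow> 'a \<Rightarrow> 'a \<Rightarrow> 'a \<Rightarrow> 'a"
  where "Casimir x y z A B C u =
    q * (A * B * C) + h * (q * q * (A * A) + qi * qi * (B * B) + q * q * (C * C) + u * u + x * x + y * y + z * z)
    - q * (A * (x * y + z * u)) - qi * (B * (y * z + x * u)) - q * (C * (x * z + y * u))
    + (q + qi) * (x * y * z * u) - h"

end

text \<open>Four pieces placed on a circle, with union \<open>m\<close>: pairs whose hulls are
  disjoint or nested commute, and any three pieces in cyclic order, neighbours possibly merged,
  satisfy triangle relations. No piece comes first, so the system survives a cyclic shift.\<close>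

locale convex4 = qscalars +
  fixes c1 c2 c3 c4 m C12 C23 C34 C14 C13 C24 C123 C234 C134 C124 :: 'a
  assumes central: "z \<in> {c1, c2, c3, c4, m} \<Longrightarrow>
      x \<in> {c1, c2, c3, c4, m, C12, C23, C34, C14, C13, C24, C123, C234, C134, C124} \<Longrightarrow> com z x"
    and noncrossing: "com C12 C34"
      "com C14 C23"
      "com C12 C123"
      "com C23 C123"
      "com C13 C123"
      "com C23 C234"
      "com C34 C234"
      "com C24 C234"
      "com C13 C134"
      "com C34 C134"
      "com C14 C134"
      "com C12 C124"
      "com C24 C124"
      "com C14 C124"
    and T_1_2_3: "qb C12 C23 = c1 * c3 + c2 * C123 - C13"
    and T_2_3_1: "qb C23 C13 = c1 * c2 + c3 * C123 - C12"
    and T_3_1_2: "qb C13 C12 = c2 * c3 + c1 * C123 - C23"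
    and T_2_3_4: "qb C23 C34 = c2 * c4 + c3 * C234 - C24"
    and T_3_4_2: "qb C34 C24 = c2 * c3 + c4 * C234 - C23"
    and T_4_2_3: "qb C24 C23 = c3 * c4 + c2 * C234 - C34"
    and T_12_3_4: "qb C123 C34 = c4 * C12 + c3 * m - C124"
    and T_3_4_12: "qb C34 C124 = c3 * C12 + c4 * m - C123"
    and T_4_12_3: "qb C124 C123 = c3 * c4 + m * C12 - C34"
    and T_1_23_4: "qb C123 C234 = c1 * c4 + m * C23 - C14"
    and T_23_4_1: "qb C234 C14 = c1 * C23 + c4 * m - C123"
    and T_4_1_23: "qb C14 C123 = c4 * C23 + c1 * m - C234"
    and T_1_2_34: "qb C12 C234 = c1 * C34 + c2 * m - C134"
    and T_2_34_1: "qb C234 C134 = c1 * c2 + m * C34 - C12"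
    and T_34_1_2: "qb C134 C12 = c2 * C34 + c1 * m - C234"
    and T_1_2_4: "qb C12 C24 = c1 * c4 + c2 * C124 - C14"
    and T_2_4_1: "qb C24 C14 = c1 * c2 + c4 * C124 - C12"
    and T_4_1_2: "qb C14 C12 = c2 * c4 + c1 * C124 - C24"
    and T_1_3_4: "qb C13 C34 = c1 * c4 + c3 * C134 - C14"
    and T_3_4_1: "qb C34 C14 = c1 * c3 + c4 * C134 - C13"
    and T_4_1_3: "qb C14 C13 = c3 * c4 + c1 * C134 - C34"
    and T_2_3_41: "qb C23 C134 = c2 * C14 + c3 * m - C124"
    and T_3_41_2: "qb C134 C124 = c2 * c3 + m * C14 - C23"
    and T_41_2_3: "qb C124 C23 = c3 * C14 + c2 * m - C134"
begin

lemmas T = T_1_2_3 T_2_3_1 T_3_1_2 T_2_3_4 T_3_4_2 T_4_2_3 T_12_3_4 T_3_4_12 T_4_12_3 T_1_23_4 T_23_4_1 T_4_1_23 T_1_2_34 T_2_34_1 T_34_1_2 T_1_2_4 T_2_4_1 T_4_1_2 T_1_3_4 T_3_4_1 T_4_1_3 T_2_3_41 T_3_41_2 T_41_2_3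

lemma com_gen [simp]:
  "z \<in> {c1, c2, c3, c4, m} \<Longrightarrow> com z c1"
  "z \<in> {c1, c2, c3, c4, m} \<Longrightarrow> com z c2"
  "z \<in> {c1, c2, c3, c4, m} \<Longrightarrow> com z c3"
  "z \<in> {c1, c2, c3, c4, m} \<Longrightarrow> com z c4"
  "z \<in> {c1, c2, c3, c4, m} \<Longrightarrow> com z m"
  "z \<in> {c1, c2, c3, c4, m} \<Longrightarrow> com z C12"
  "z \<in> {c1, c2, c3, c4, m} \<Longrightarrow> com z C23"
  "z \<in> {c1, c2, c3, c4, m} \<Longrightarrow> com z C34"
  "z \<in> {c1, c2, c3, c4, m} \<Longrightarrow> com z C14"
  "z \<in> {c1, c2, c3, c4, m} \<Longrightarrow> com z C13"
  "z \<in> {c1, c2, c3, c4, m} \<Longrightarrow> com z C24"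
  "z \<in> {c1, c2, c3, c4, m} \<Longrightarrow> com z C123"
  "z \<in> {c1, c2, c3, c4, m} \<Longrightarrow> com z C234"
  "z \<in> {c1, c2, c3, c4, m} \<Longrightarrow> com z C134"
  "z \<in> {c1, c2, c3, c4, m} \<Longrightarrow> com z C124"
  by (rule central; simp)+

lemma com_gen' [simp]:
  "z \<in> {c1, c2, c3, c4, m} \<Longrightarrow> com C12 z"
  "z \<in> {c1, c2, c3, c4, m} \<Longrightarrow> com C23 z"
  "z \<in> {c1, c2, c3, c4, m} \<Longrightarrow> com C34 z"
  "z \<in> {c1, c2, c3, c4, m} \<Longrightarrow> com C14 z"
  "z \<in> {c1, c2, c3, c4, m} \<Longrightarrow> com C13 z"
  "z \<in> {c1, c2, c3, c4, m} \<Longrightarrow> com C24 z"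
  "z \<in> {c1, c2, c3, c4, m} \<Longrightarrow> com C123 z"
  "z \<in> {c1, c2, c3, c4, m} \<Longrightarrow> com C234 z"
  "z \<in> {c1, c2, c3, c4, m} \<Longrightarrow> com C134 z"
  "z \<in> {c1, c2, c3, c4, m} \<Longrightarrow> com C124 z"
  by (rule com_sym; simp)+

lemma noncrossing' [simp]:
  "com C34 C12"
  "com C23 C14"
  "com C123 C12"
  "com C123 C23"
  "com C123 C13"
  "com C234 C23"
  "com C234 C34"
  "com C234 C24"
  "com C134 C13"
  "com C134 C34"
  "com C134 C14"
  "com C124 C12"
  "com C124 C24"
  "com C124 C14"
  by (rule com_sym, rule noncrossing)+

lemmas noncrossing [simp]

lemma pair_order:
  "C34 * C12 = C12 * C34"
  "C23 * C14 = C14 * C23"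
  "C123 * C12 = C12 * C123"
  "C123 * C23 = C23 * C123"
  "C123 * C13 = C13 * C123"
  "C234 * C23 = C23 * C234"
  "C234 * C34 = C34 * C234"
  "C234 * C24 = C24 * C234"
  "C134 * C13 = C13 * C134"
  "C134 * C34 = C34 * C134"
  "C134 * C14 = C14 * C134"
  "C124 * C12 = C12 * C124"
  "C124 * C24 = C24 * C124"
  "C124 * C14 = C14 * C124"
  by (rule com_sw, rule noncrossing)+

lemma scal:
  "z \<in> {c1, c2, c3, c4, m} \<Longrightarrow> com z y \<Longrightarrow> qb (z * x) y = z * qb x y"
  "z \<in> {c1, c2, c3, c4, m} \<Longrightarrow> com z y \<Longrightarrow> qb y (z * x) = z * qb y x"
  by (simp_all add: qb_scale_left qb_scale_right)

lemma central_order: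
  "c2 * c1 = c1 * c2" "c3 * c1 = c1 * c3" "c4 * c1 = c1 * c4" "m * c1 = c1 * m"
  "c3 * c2 = c2 * c3" "c4 * c2 = c2 * c4" "m * c2 = c2 * m"
  "c4 * c3 = c3 * c4" "m * c3 = c3 * m" "m * c4 = c4 * m"
  "c2 * (c1 * x) = c1 * (c2 * x)" "c3 * (c1 * x) = c1 * (c3 * x)" "c4 * (c1 * x) = c1 * (c4 * x)"
  "m * (c1 * x) = c1 * (m * x)" "c3 * (c2 * x) = c2 * (c3 * x)" "c4 * (c2 * x) = c2 * (c4 * x)"
  "m * (c2 * x) = c2 * (m * x)" "c4 * (c3 * x) = c3 * (c4 * x)" "m * (c3 * x) = c3 * (m * x)"
  "m * (c4 * x) = c4 * (m * x)"
  by (rule com_sw com_sw2; simp)+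

lemma letter_central:
  assumes "z \<in> {c1, c2, c3, c4, m}"
    and "x \<in> {C12, C23, C34, C14, C13, C24, C123, C234, C134, C124}"
  shows "x * z = z * x" "x * (z * y) = z * (x * y)"
proof -
  have "com z x"
    by (rule central) (use assms in blast)+
  then show "x * z = z * x" "x * (z * y) = z * (x * y)"
    by (fact com_sw com_sw2)+
qed

lemmas letter_central' = letter_central [of c1, simplified] letter_central [of c2, simplified]
  letter_central [of c3, simplified] letter_central [of c4, simplified] letter_central [of m, simplified]

lemmas nf = qb_lin T scal qb_com central_order letter_central' pair_order algebra_simps

end

section \<open>The exchange identity\<close>

context qbracket
begin

lemma cm_lin:
  "cm (x + y) z = cm x z + cm y z" "cm x (y + z) = cm x y + cm x z"
  "cm (x - y) z = cm x z - cm y z" "cm x (y - z) = cm x y - cm x z"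
  "cm (- x) z = - cm x z" "cm x (- z) = - cm x z"
  by (simp_all add: cm_def algebra_simps)

lemma cm_com: "com x y \<Longrightarrow> cm x y = 0"
  by (simp add: cm_eq_0_iff)

lemma cm_scale:
  assumes "com z x"
  shows "cm x (z * y) = z * cm x y" and "cm (z * y) x = z * cm y x"
  using com_sw2 [OF assms] by (simp_all add: cm_def mult.assoc right_diff_distrib)

text \<open>A Leibniz rule in which the middle terms \<open>b * (u * z * v)\<close> cancel: the
  commutator of \<open>z\<close> with a product is known as soon as one suitable bracket of
  \<open>z\<close> with each factor is.\<close>

lemma a_cm_mult:
  "a * cm z (u * v) = qb z u * v - u * qb v z"
  by (simp add: cm_def qb_def algebra_simps a_left [of u] b_left [of u])

lemma b_cm_mult:
  "b * cm z (u * v) = u * qb z v - qb u z * v"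
  by (simp add: cm_def qb_def algebra_simps a_left [of u] b_left [of u])

lemma mult_eq_qb: "x * y = qb y x - a * cm y x"
proof -
  have "qb y x - a * cm y x = (a - b) * (x * y)"
    by (simp add: qb_def cm_def algebra_simps)
  then show ?thesis
    by (simp add: a_minus_b)
qed

end

context convex4
begin

abbreviation "D13 \<equiv> c1 * c3 + c2 * C123 - qb C23 C12"
abbreviation "D24 \<equiv> c2 * c4 + c3 * C234 - qb C34 C23"
abbreviation "D124 \<equiv> c4 * C12 + c3 * m - qb C34 C123"

lemma qb_234_13: "qb C234 C13 = c1 * D24 + c3 * m - D124"
  using qb_left_commute [of C234 C34 C14] by (simp add: nf)

lemma qb_124_13:
  "qb C124 C13 = c3 * (c2 * c4 + c1 * C124 - qb C12 C14) - c2 * C34 + qb C12 C134"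
  using qb_left_commute [of C124 C12 C23] by (simp add: nf)

lemma qb_13_234: "qb C13 C234 = qb C134 C23 + c1 * D24 - c2 * C14"
  using qb_right_commute [of C23 C234 C12] by (simp add: nf)

lemma qb_234_124: "qb C234 C124 = m * C24 - c2 * C123 + qb C23 C12"
  using qb_left_commute [of C234 C23 C134] by (simp add: nf)

lemma qb_124_234: "qb C124 C234 = m * C24 - c4 * C134 + qb C14 C34"
  using qb_right_commute [of C34 C234 C123] by (simp add: nf)

text \<open>Both bracket orders of this crossing pair can be computed, and their difference is a
  multiple of the commutator by the invertible \<open>a + b\<close>.\<close>

lemma cm_124_234: "cm C124 C234 = cm C12 C23 - cm C34 C14"
proof -
  have "(a + b) * (cm C124 C234 - cm C12 C23 + cm C34 C14) = 0"
    unfolding distrib_left [of "a + b"] right_diff_distrib [of "a + b"] qb_diff_cm [symmetric]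
    by (simp add: nf qb_234_124 qb_124_234)
  from ab_cancel [OF this] show ?thesis
    by (simp add: algebra_simps)
qed

lemma cm_234_13: "cm C123 C34 + cm C134 C23 + cm C234 C13 = 0"
proof -
  have "(a + b) * (cm C123 C34 + cm C134 C23 + cm C234 C13) = 0"
    unfolding distrib_left [of "a + b"] qb_diff_cm [symmetric]
    by (simp add: nf qb_234_13 qb_13_234)
  then show ?thesis
    by (rule ab_cancel)
qed

lemma qb_13_124: "qb C13 C124 = qb C123 C14 + c3 * (c2 * c4 + c1 * C124 - qb C12 C14) - c4 * C23"
  using qb_right_commute [of C14 C124 C34] by (simp add: nf)

lemma cm_124_13: "cm C134 C12 + cm C123 C14 + cm C124 C13 = 0"
proof -
  have "(a + b) * (cm C134 C12 + cm C123 C14 + cm C124 C13) = 0"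
    unfolding distrib_left [of "a + b"] qb_diff_cm [symmetric]
    by (simp add: nf qb_124_13 qb_13_124)
  then show ?thesis
    by (rule ab_cancel)
qed

end

context qscalars
begin

lemma com_scalars [simp]:
  "com q x" "com qi x" "com k x" "com h x" "com x q" "com x qi" "com x k" "com x h"
proof -
  show *: "com q x" "com qi x" "com k x" "com h x"
    unfolding com_def by (rule scalar_central, simp)+
  show "com x q" "com x qi" "com x k" "com x h"
    by (rule com_sym, rule *)+
qed

lemma q_qi_simps:
  "q * (qi * x) = x" "qi * q = 1" "qi * (q * x) = x"
proof -
  show "qi * q = 1"
    using q_qi scalar_central [of q qi] by simp
  then show "q * (qi * x) = x" "qi * (q * x) = x"
    using q_qi by (simp_all flip: mult.assoc)
qed

lemma k_simps:
  "k * q = k * qi + 1" "k * (q * x) = k * (qi * x) + x"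
  "k * (qi * qi) = k - qi" "k * (qi * (qi * x)) = k * x - qi * x"
proof -
  show 1: "k * q = k * qi + 1"
    using a_minus_b by (simp add: a_eq b_eq algebra_simps)
  then show "k * (q * x) = k * (qi * x) + x"
    by (metis distrib_right mult.assoc mult_1)
  have "k * q * qi = (k * qi + 1) * qi"
    using 1 by simp
  then show 2: "k * (qi * qi) = k - qi"
    by (simp add: mult.assoc q_qi algebra_simps)
  show "k * (qi * (qi * x)) = k * x - qi * x"
    using arg_cong [OF 2, of "\<lambda>y. y * x"] by (simp add: mult.assoc left_diff_distrib)
qed

lemma h_simps:
  "h * (q * q) = q - h" "h * (q * (q * x)) = q * x - h * x"
  "h * (qi * qi) = qi - h" "h * (qi * (qi * x)) = qi * x - h * x"
proof -
  have "h * (q + qi) * q = q" "h * (q + qi) * qi = qi"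
    using h_eq by simp_all
  then show 1: "h * (q * q) = q - h" and 2: "h * (qi * qi) = qi - h"
    by (simp_all add: algebra_simps q_qi q_qi_simps)
  show "h * (q * (q * x)) = q * x - h * x" "h * (qi * (qi * x)) = qi * x - h * x"
    using arg_cong [OF 1, of "\<lambda>y. y * x"] arg_cong [OF 2, of "\<lambda>y. y * x"]
    by (simp_all add: mult.assoc left_diff_distrib)
qed

lemma scalar_order:
  "q * k = k * q" "qi * k = k * qi" "q * h = h * q" "qi * h = h * qi" "h * k = k * h"
  "q * (k * x) = k * (q * x)" "qi * (k * x) = k * (qi * x)" "q * (h * x) = h * (q * x)"
  "qi * (h * x) = h * (qi * x)" "h * (k * x) = k * (h * x)"
  by (rule com_sw com_sw2; simp)+

lemma scalar_left:
  "x * (q * y) = q * (x * y)" "x * (qi * y) = qi * (x * y)" "x * (k * y) = k * (x * y)"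
  "x * (h * y) = h * (x * y)"
  by (rule com_sw2; simp)+

lemma scalar_right: "x * q = q * x" "x * qi = qi * x" "x * k = k * x" "x * h = h * x"
  by (rule com_sw; simp)+

lemmas scalar_move = scalar_left scalar_right
lemmas scalar_simps = q_qi q_qi_simps k_simps h_simps scalar_order

definition casimir_const :: "'a \<Rightarrow> 'a \<Rightarrow> 'a \<Rightarrow> 'a \<Rightarrow> 'a"
  where "casimir_const x y z u = h * (u * u + x * x + y * y + z * z) + (q + qi) * (x * y * z * u) - h"

text \<open>Replacing \<open>x * y + z * u\<close> by \<open>A\<close> plus a bracket, together with
  \<open>q - q * a = - k\<close> and \<open>q * b = k\<close>, turns the cubic term into
  \<open>A\<close> times a commutator. \<open>Casimir_right\<close> arranges for the letter to stand
  behind the commutator instead.\<close>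

lemma Casimir_left:
  assumes "qb B C = x * y + z * u - A"
  shows "Casimir x y z A B C u = k * (A * cm C B) - h * (A * A)
    + h * (qi * (qi * (B * B))) + h * (q * (q * (C * C)))
    - qi * (B * (y * z + x * u)) - q * (C * (x * z + y * u)) + casimir_const x y z u"
proof -
  have eq: "x * y + z * u = A + (a * (B * C) - b * (C * B))"
    using assms by (simp add: qb_def algebra_simps)
  show ?thesis
    unfolding Casimir_def casimir_const_def cm_def eq
    by (simp add: a_eq b_eq algebra_simps scalar_simps scalar_move [of A])
qed

lemma Casimir_right:
  assumes "qb B C = y * x + z * u - A" and "com A (y * x + z * u)"
  shows "Casimir y z x B C A u = k * (cm C B * A) - h * (A * A)
    + h * (q * (q * (B * B))) + h * (qi * (qi * (C * C)))
    - q * (B * (y * z + x * u)) - qi * (C * (z * x + y * u)) + casimir_const y z x u"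
proof -
  have eq: "A * (y * x + z * u) = (A + (a * (B * C) - b * (C * B))) * A"
    using assms by (simp add: qb_def com_def)
  show ?thesis
    unfolding Casimir_def casimir_const_def cm_def eq
    by (simp add: a_eq b_eq algebra_simps scalar_simps)
qed

text \<open>The definition of the bracket solved for one of its two products; it reorders at the
  price of a factor \<open>qi * qi\<close>.\<close>

lemma mult_eq_qb_q: "x * y = qi * (qi * (y * x)) + qb x y - qi * (qi * qb x y)"
proof -
  have "qi * (qi * (y * x)) + qb x y - qi * (qi * qb x y) = (a - qi * qi * a) * (x * y) + (qi * qi - b + qi * qi * b) * (y * x)"
    by (simp add: qb_def algebra_simps scalar_move [of a] scalar_move [of b])
  moreover have "a - qi * qi * a = 1"
    by (simp add: a_eq b_eq algebra_simps scalar_simps)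
  moreover have "qi * qi - b + qi * qi * b = 0"
    by (simp add: a_eq b_eq algebra_simps scalar_simps)
  ultimately show ?thesis
    by simp
qed

text \<open>Rotation moves the factor \<open>qi * qi\<close> from \<open>B\<close> to
  \<open>C\<close>. The difference consists of \<open>q * (A * B * C - B * C * A)\<close> and
  multiples of \<open>q - qi\<close>; the two bracket relations, cleared of their denominator
  \<open>q - qi\<close>, make these cancel.\<close>

lemma Casimir_cyclic:
  assumes B: "qb C A = y * z + x * u - B" and C: "qb A B = x * z + y * u - C"
    and com: "com C (x * z + y * u)"
    and xyzu: "com x y" "com x z" "com x u" "com y z" "com y u" "com z u"
  shows "Casimir x y z A B C u = Casimir y z x B C A u"
proof -
  define \<beta> \<gamma> where \<beta>: "\<beta> = y * z + x * u" and \<gamma>: "\<gamma> = x * z + y * u"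
  have 1: "\<beta> = B + qb C A" "\<gamma> = C + qb A B"
    using B C by (simp_all add: \<beta> \<gamma> algebra_simps)
  have "com C (\<gamma> - C)"
    using com \<gamma> by simp
  then have 2: "C * qb A B = qb A B * C"
    using 1(2) by (simp add: com_def algebra_simps)
  have "Casimir x y z A B C u - Casimir y z x B C A u
      = q * (A * B * C - B * C * A) + (q - qi) * (C * C - B * B) + (q - qi) * (B * \<beta>) - (q - qi) * (C * \<gamma>)"
    unfolding Casimir_def \<beta> \<gamma> by (simp add: xyzu [THEN com_sw] xyzu [THEN com_sw2] algebra_simps scalar_simps)
  also have "\<dots> = 0"
  proof -
    have "(q - qi) * k = 1"
      by (simp add: algebra_simps scalar_simps)
    then have 4: "(q - qi) * qb v w = q * (v * w) - qi * (w * v)" for v w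
    proof -
      have "(q - qi) * qb v w = ((q - qi) * k) * (q * (v * w) - qi * (w * v))"
        unfolding qb_def unfolding a_eq b_eq by (simp add: right_diff_distrib mult.assoc)
      then show ?thesis
        by (simp add: \<open>(q - qi) * k = 1\<close>)
    qed
    have "(q - qi) * (B * qb C A) = B * ((q - qi) * qb C A)"
      by (simp add: left_diff_distrib right_diff_distrib scalar_move [of B])
    moreover have "(q - qi) * (C * qb A B) = (q - qi) * qb A B * C"
      by (simp add: 2 mult.assoc)
    ultimately show ?thesis
      unfolding 1 distrib_left [of B] distrib_left [of C] distrib_left [of "q - qi"]
      by (simp only: 4) (simp add: algebra_simps scalar_move [of B])
  qed
  finally show ?thesis
    by simp
qed

end

context convex4
begin

lemma scalar_letters:
  "x \<in> {c1, c2, c3, c4, m, C12, C23, C34, C14, C13, C24, C123, C234, C134, C124} \<Longrightarrow> x * q = q * x"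
  "x \<in> {c1, c2, c3, c4, m, C12, C23, C34, C14, C13, C24, C123, C234, C134, C124} \<Longrightarrow> x * (q * y) = q * (x * y)"
  "x \<in> {c1, c2, c3, c4, m, C12, C23, C34, C14, C13, C24, C123, C234, C134, C124} \<Longrightarrow> x * qi = qi * x"
  "x \<in> {c1, c2, c3, c4, m, C12, C23, C34, C14, C13, C24, C123, C234, C134, C124} \<Longrightarrow> x * (qi * y) = qi * (x * y)"
  "x \<in> {c1, c2, c3, c4, m, C12, C23, C34, C14, C13, C24, C123, C234, C134, C124} \<Longrightarrow> x * k = k * x"
  "x \<in> {c1, c2, c3, c4, m, C12, C23, C34, C14, C13, C24, C123, C234, C134, C124} \<Longrightarrow> x * (k * y) = k * (x * y)"
  "x \<in> {c1, c2, c3, c4, m, C12, C23, C34, C14, C13, C24, C123, C234, C134, C124} \<Longrightarrow> x * h = h * x"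
  "x \<in> {c1, c2, c3, c4, m, C12, C23, C34, C14, C13, C24, C123, C234, C134, C124} \<Longrightarrow> x * (h * y) = h * (x * y)"
  by (rule scalar_move)+

text \<open>Reordering the crossing pair produces its commutator; \<open>cm_124_13\<close> replaces
  that by two commutators which unfold into products again. In the result \<open>C13\<close> is gone
  and \<open>C124\<close> has only central factors.\<close>

lemma mult_13_124:
  "C13 * C124 = C134 * C12 + C123 * C14 - c3 * qb C12 C14 + c3 * (c2 * c4 + c1 * C124)
    - c2 * C34 - c4 * C23 - c1 * m + C234"
proof -
  have "C13 * C124 = qb C124 C13 + (a * cm C134 C12 + a * cm C123 C14)"
  proof -
    have "cm C124 C13 = - cm C134 C12 - cm C123 C14"
      using cm_124_13 by (simp add: algebra_simps eq_neg_iff_add_eq_0)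
    then show ?thesis
      by (subst mult_eq_qb) (simp add: right_diff_distrib)
  qed
  moreover have "a * cm C134 C12 = C134 * C12 - qb C12 C134"
    by (subst mult_eq_qb) (simp add: cm_def algebra_simps)
  moreover have "a * cm C123 C14 = C123 * C14 - qb C14 C123"
    by (subst mult_eq_qb) (simp add: cm_def algebra_simps)
  ultimately show ?thesis
    by (simp add: qb_124_13 T algebra_simps)
qed

lemma a_b_mult: "a * x = q * (k * x)" "b * x = qi * (k * x)"
  using scalar_central [of k q] scalar_central [of k qi] by (simp_all add: a_eq b_eq mult.assoc flip: mult.assoc)

lemma k_cm:
  "k * cm z (u * v) = qi * (qb z u * v - u * qb v z)"
  "k * cm z (u * v) = q * (u * qb z v - qb u z * v)"
proof -
  have "k = qi * a"
    by (simp add: a_eq scalar_left(3) [of qi] q_qi_simps)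
  then show "k * cm z (u * v) = qi * (qb z u * v - u * qb v z)"
    by (simp only: mult.assoc a_cm_mult)
  have "k = q * b"
    by (simp add: b_eq scalar_left(3) [of q] q_qi)
  then show "k * cm z (u * v) = q * (u * qb z v - qb u z * v)"
    by (simp only: mult.assoc b_cm_mult)
qed

text \<open>The one commutator left over in the exchange identity. To each quadratic summand of
  \<open>mult_13_124\<close> that version of \<open>k_cm\<close> is applied whose two brackets are
  known.\<close>

lemma k_cm_234:
  "k * cm C234 (C13 * C124) =
    qi * ((c1 * c2 + m * C34 - C12) * C12 - C134 * (c1 * C34 + c2 * m - C134))
    + q * (C123 * (c1 * C23 + c4 * m - C123) - (c1 * c4 + m * C23 - C14) * C14)
    - c3 * (k * (q * (q * (C12 * (c1 * C23 + c4 * m - C123) - (c1 * C34 + c2 * m - C134) * C14)))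
      - k * (qi * (qi * ((c1 * C23 + c4 * m - C123) * C12 - C14 * (c1 * C34 + c2 * m - C134)))))
    - c1 * (c3 * (k * cm C12 C23 - k * cm C34 C14))"
proof -
  have 1: "k * cm C234 (C134 * C12) =
      qi * ((c1 * c2 + m * C34 - C12) * C12 - C134 * (c1 * C34 + c2 * m - C134))"
    by (simp only: k_cm(1) T)
  have 2: "k * cm C234 (C123 * C14) =
      q * (C123 * (c1 * C23 + c4 * m - C123) - (c1 * c4 + m * C23 - C14) * C14)"
    by (simp only: k_cm(2) T)
  have 3: "k * cm C234 (qb C12 C14) =
      k * (q * (q * (C12 * (c1 * C23 + c4 * m - C123) - (c1 * C34 + c2 * m - C134) * C14)))
      - k * (qi * (qi * ((c1 * C23 + c4 * m - C123) * C12 - C14 * (c1 * C34 + c2 * m - C134))))"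
  proof -
    have "cm C234 (qb C12 C14) = a * cm C234 (C12 * C14) - b * cm C234 (C14 * C12)"
      by (simp add: qb_def cm_lin cm_scale)
    then have "k * cm C234 (qb C12 C14) = k * (q * (k * cm C234 (C12 * C14))) - k * (qi * (k * cm C234 (C14 * C12)))"
      by (simp add: right_diff_distrib a_b_mult)
    then show ?thesis
      by (simp only: k_cm(2) [of _ C12] k_cm(1) [of _ C14] T)
  qed
  have 4: "k * cm C234 C124 = k * cm C34 C14 - k * cm C12 C23"
  proof -
    have "cm C234 C124 = cm C34 C14 - cm C12 C23"
      using cm_124_234 by (simp add: cm_def algebra_simps)
    then show ?thesis
      by (simp add: right_diff_distrib)
  qed
  have "cm C234 (C13 * C124) = cm C234 (C134 * C12) + cm C234 (C123 * C14)
      - c3 * cm C234 (qb C12 C14) + c1 * (c3 * cm C234 C124)"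
    unfolding mult_13_124 by (simp add: cm_lin cm_scale cm_com central_order algebra_simps)
  then have "k * cm C234 (C13 * C124) = k * cm C234 (C134 * C12) + k * cm C234 (C123 * C14)
      - c3 * (k * cm C234 (qb C12 C14)) + c1 * (c3 * (k * cm C234 C124))"
    by (simp add: distrib_left right_diff_distrib scalar_left [of c3] scalar_left [of c1])
  then show ?thesis
    unfolding 1 2 3 4 by (simp add: algebra_simps)
qed

text \<open>Each Casimir is written so that its cubic term is a commutator times a letter. With
  \<open>C124\<close> and \<open>C13\<close> as these letters, \<open>cm_234_13\<close> and
  \<open>cm_124_234\<close> combine the four terms into the commutator of \<open>C234\<close> with
  \<open>C13 * C124\<close>.\<close>

theorem Casimir_exchange:
  "Casimir C12 c3 c4 C123 C34 C124 m + Casimir c1 c2 c3 C12 C23 C13 C123 =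
    Casimir c2 c3 C14 C23 C134 C124 m + Casimir c1 c3 c4 C13 C34 C14 C134"
proof -
  have kc: "k * (cm C34 C123 * C124) + k * (C13 * cm C23 C12) - k * (cm C134 C23 * C124) - k * (C13 * cm C14 C34)
      = k * cm C234 (C13 * C124)"
  proof -
    have "cm C34 C123 - cm C134 C23 = cm C234 C13"
      using cm_234_13 by (simp add: cm_def algebra_simps)
    moreover have "cm C23 C12 - cm C14 C34 = cm C234 C124"
      using cm_124_234 by (simp add: cm_def algebra_simps)
    ultimately have "k * ((cm C34 C123 - cm C134 C23) * C124 + C13 * (cm C23 C12 - cm C14 C34))
        = k * (cm C234 C13 * C124 + C13 * cm C234 C124)"
      by simp
    also have "cm C234 C13 * C124 + C13 * cm C234 C124 = cm C234 (C13 * C124)"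
      by (simp add: cm_def algebra_simps)
    finally show ?thesis
      by (simp add: algebra_simps)
  qed
  have 1: "Casimir C12 c3 c4 C123 C34 C124 m = k * (cm C34 C123 * C124) - h * (C124 * C124)
    + h * (q * (q * (C123 * C123))) + h * (qi * (qi * (C34 * C34)))
    - q * (C123 * (C12 * c3 + c4 * m)) - qi * (C34 * (c3 * c4 + C12 * m)) + casimir_const C12 c3 c4 m"
    by (rule Casimir_right) (simp_all add: T letter_central')
  have 2: "Casimir c2 c3 C14 C23 C134 C124 m = k * (cm C134 C23 * C124) - h * (C124 * C124)
    + h * (q * (q * (C23 * C23))) + h * (qi * (qi * (C134 * C134)))
    - q * (C23 * (c2 * c3 + C14 * m)) - qi * (C134 * (c3 * C14 + c2 * m)) + casimir_const c2 c3 C14 m"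
    by (rule Casimir_right) (simp_all add: T letter_central')
  have 3: "Casimir c1 c2 c3 C12 C23 C13 C123 = k * (C13 * cm C23 C12) - h * (C13 * C13)
    + h * (qi * (qi * (C12 * C12))) + h * (q * (q * (C23 * C23)))
    - qi * (C12 * (c1 * c2 + c3 * C123)) - q * (C23 * (c3 * c2 + c1 * C123)) + casimir_const c3 c1 c2 C123"
  proof -
    have "Casimir c1 c2 c3 C12 C23 C13 C123 = Casimir c3 c1 c2 C13 C12 C23 C123"
      by (rule Casimir_cyclic [symmetric]) (simp_all add: T central_order)
    also have "\<dots> = k * (C13 * cm C23 C12) - h * (C13 * C13)
      + h * (qi * (qi * (C12 * C12))) + h * (q * (q * (C23 * C23)))
      - qi * (C12 * (c1 * c2 + c3 * C123)) - q * (C23 * (c3 * c2 + c1 * C123)) + casimir_const c3 c1 c2 C123"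
      by (rule Casimir_left) (simp add: T central_order)
    finally show ?thesis .
  qed
  have 4: "Casimir c1 c3 c4 C13 C34 C14 C134 = k * (C13 * cm C14 C34) - h * (C13 * C13)
    + h * (qi * (qi * (C34 * C34))) + h * (q * (q * (C14 * C14)))
    - qi * (C34 * (c3 * c4 + c1 * C134)) - q * (C14 * (c1 * c4 + c3 * C134)) + casimir_const c1 c3 c4 C134"
    by (rule Casimir_left) (simp add: T central_order)
  have 5: "k * cm C12 C23 = k * (C12 * C23) - k * (C23 * C12)" "k * cm C34 C14 = k * (C34 * C14) - k * (C14 * C34)"
    by (simp_all add: cm_def algebra_simps)
  \<comment> \<open>Fixes one order for the products that do not commute; what remains is a
    comparison of normal forms.\<close>
  have 6: "C12 * C23 = qi * (qi * (C23 * C12)) + (c1 * c3 + c2 * C123 - C13) - qi * (qi * (c1 * c3 + c2 * C123 - C13))"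
    "C34 * C14 = qi * (qi * (C14 * C34)) + (c1 * c3 + c4 * C134 - C13) - qi * (qi * (c1 * c3 + c4 * C134 - C13))"
    using mult_eq_qb_q [of C12 C23] mult_eq_qb_q [of C34 C14] by (simp_all add: T)
  have "k * cm C234 (C13 * C124) - h * (C124 * C124)
    + h * (q * (q * (C123 * C123))) + h * (qi * (qi * (C34 * C34)))
    - q * (C123 * (C12 * c3 + c4 * m)) - qi * (C34 * (c3 * c4 + C12 * m)) + casimir_const C12 c3 c4 m
    - h * (C13 * C13)
    + h * (qi * (qi * (C12 * C12))) + h * (q * (q * (C23 * C23)))
    - qi * (C12 * (c1 * c2 + c3 * C123)) - q * (C23 * (c3 * c2 + c1 * C123)) + casimir_const c3 c1 c2 C123
    - (- h * (C124 * C124)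
    + h * (q * (q * (C23 * C23))) + h * (qi * (qi * (C134 * C134)))
    - q * (C23 * (c2 * c3 + C14 * m)) - qi * (C134 * (c3 * C14 + c2 * m)) + casimir_const c2 c3 C14 m)
    - (- h * (C13 * C13)
    + h * (qi * (qi * (C34 * C34))) + h * (q * (q * (C14 * C14)))
    - qi * (C34 * (c3 * c4 + c1 * C134)) - q * (C14 * (c1 * c4 + c3 * C134)) + casimir_const c1 c3 c4 C134) = 0"
    unfolding k_cm_234 5 casimir_const_def
    by (simp add: algebra_simps 6 central_order letter_central' pair_order scalar_letters scalar_simps)
  then show ?thesis
    unfolding 1 2 3 4 kc [symmetric] by (simp add: algebra_simps)
qed

end

context convex4
begin

text \<open>The shift permutes the eight triples, each with its three relations, and fixes
  \<open>m\<close>. So a single computation gives the exchange identity in every position.\<close>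

lemma rotate:
  "convex4 a b w q qi k h c2 c3 c4 c1 m C23 C34 C14 C12 C24 C13 C234 C134 C124 C123"
  by unfold_locales (auto simp: T central_order intro: central)

end

context convex4
begin

interpretation rot1: convex4 a b w q qi k h c2 c3 c4 c1 m C23 C34 C14 C12 C24 C13 C234 C134 C124 C123
  by (rule rotate)

interpretation rot2: convex4 a b w q qi k h c3 c4 c1 c2 m C34 C14 C12 C23 C13 C24 C134 C124 C123 C234
  by (rule rot1.rotate)

lemma Casimir_exchange1:
  "Casimir c1 C23 c4 C123 C234 C14 m + Casimir c2 c3 c4 C23 C34 C24 C234 =
    Casimir C12 c3 c4 C123 C34 C124 m + Casimir c1 c2 c4 C12 C24 C14 C124"
proof -
  have "Casimir C23 c4 c1 C234 C14 C123 m + Casimir c2 c3 c4 C23 C34 C24 C234 =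
    Casimir c3 c4 C12 C34 C124 C123 m + Casimir c2 c4 c1 C24 C14 C12 C124"
    by (rule rot1.Casimir_exchange)
  moreover have "Casimir c1 C23 c4 C123 C234 C14 m = Casimir C23 c4 c1 C234 C14 C123 m"
    by (rule Casimir_cyclic) (simp_all add: T central_order letter_central')
  moreover have "Casimir C12 c3 c4 C123 C34 C124 m = Casimir c3 c4 C12 C34 C124 C123 m"
    by (rule Casimir_cyclic) (simp_all add: T central_order letter_central')
  moreover have "Casimir c1 c2 c4 C12 C24 C14 C124 = Casimir c2 c4 c1 C24 C14 C12 C124"
    by (rule Casimir_cyclic) (simp_all add: T central_order letter_central')
  ultimately show ?thesis
    by simp
qed

lemma Casimir_exchange2:
  "Casimir c1 c2 C34 C12 C234 C134 m + Casimir c1 c3 c4 C13 C34 C14 C134 =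
    Casimir c1 C23 c4 C123 C234 C14 m + Casimir c1 c2 c3 C12 C23 C13 C123"
proof -
  have "Casimir C34 c1 c2 C134 C12 C234 m + Casimir c3 c4 c1 C34 C14 C13 C134 =
    Casimir c4 c1 C23 C14 C123 C234 m + Casimir c3 c1 c2 C13 C12 C23 C123"
    by (rule rot2.Casimir_exchange)
  moreover have "Casimir C34 c1 c2 C134 C12 C234 m = Casimir c1 c2 C34 C12 C234 C134 m"
    by (rule Casimir_cyclic) (simp_all add: T central_order letter_central')
  moreover have "Casimir c1 c3 c4 C13 C34 C14 C134 = Casimir c3 c4 c1 C34 C14 C13 C134"
    by (rule Casimir_cyclic) (simp_all add: T central_order letter_central')
  moreover have "Casimir c4 c1 C23 C14 C123 C234 m = Casimir c1 C23 c4 C123 C234 C14 m"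
    by (rule Casimir_cyclic) (simp_all add: T central_order letter_central')
  moreover have "Casimir c3 c1 c2 C13 C12 C23 C123 = Casimir c1 c2 c3 C12 C23 C13 C123"
    by (rule Casimir_cyclic) (simp_all add: T central_order letter_central')
  ultimately show ?thesis
    by simp
qed

end

locale aw4q = aw4 + qscalars
begin

lemma is_convex4:
  "convex4 a b w q qi k h c1 c2 c3 c4 m C12 C23 C34 C14 C13 C24 C123 C234 C134 C124"
proof unfold_locales
  fix z x
  assume z: "z \<in> {c1, c2, c3, c4, m}"
    and x: "x \<in> {c1, c2, c3, c4, m, C12, C23, C34, C14, C13, C24, C123, C234, C134, C124}"
  show "com z x"
    using x by (elim insertE emptyE) (simp_all only: com_gen [OF z] com_derived [OF z])
qed (simp_all add: nf6 T241 T23_41' T2_34_1' T3412' com_pairs2)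

end

section \<open>Families indexed by intervals\<close>

context qbracket
begin

definition bridge :: "(nat \<Rightarrow> nat \<Rightarrow> 'a) \<Rightarrow> nat \<Rightarrow> nat \<Rightarrow> nat \<Rightarrow> nat \<Rightarrow> 'a"
  where "bridge c i j k l = c i j * c k l + c j k * c i l - qb (c i k) (c j l)"

definition bridge' :: "(nat \<Rightarrow> nat \<Rightarrow> 'a) \<Rightarrow> nat \<Rightarrow> nat \<Rightarrow> nat \<Rightarrow> nat \<Rightarrow> 'a"
  where "bridge' c i j k l = c i j * c k l + c j k * c i l - qb (c j l) (c i k)"

end

text \<open>Relation (ii) for an increasing sequence. \<open>tri'\<close> is the one for a
  decreasing sequence, already rewritten by \<open>bridge_flip\<close> so that both speak of the
  same \<open>bridge\<close>.\<close>

definition (in qbracket) tri :: "(nat \<Rightarrow> nat \<Rightarrow> 'a) \<Rightarrow> nat \<Rightarrow> nat \<Rightarrow> nat \<Rightarrow> nat \<Rightarrow> bool"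
  where "tri c i j k l \<longleftrightarrow> qb (c j l) (bridge c i j k l) = c i j * c j k + c k l * c i l - c i k"

definition (in qbracket) tri' :: "(nat \<Rightarrow> nat \<Rightarrow> 'a) \<Rightarrow> nat \<Rightarrow> nat \<Rightarrow> nat \<Rightarrow> nat \<Rightarrow> bool"
  where "tri' c i j k l \<longleftrightarrow> qb (bridge c i j k l) (c i k) = c j k * c k l + c i j * c i l - c j l"

text \<open>Relation (iii) for an increasing sequence, \<open>quad'\<close> being the decreasing
  case. The hole from \<open>j\<close> to \<open>l\<close> is cut at \<open>k\<close> and its right
  part is used.\<close>

definition (in qbracket) quad :: "(nat \<Rightarrow> nat \<Rightarrow> 'a) \<Rightarrow> nat \<Rightarrow> nat \<Rightarrow> nat \<Rightarrow> nat \<Rightarrow> nat \<Rightarrow> bool"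
  where "quad c i j k l p \<longleftrightarrow>
    qb (bridge c i j k l) (c k p) = c i j * c l p + c k l * bridge c i j k p - bridge c i j l p"

definition (in qbracket) quad' :: "(nat \<Rightarrow> nat \<Rightarrow> 'a) \<Rightarrow> nat \<Rightarrow> nat \<Rightarrow> nat \<Rightarrow> nat \<Rightarrow> nat \<Rightarrow> bool"
  where "quad' c i j k l p \<longleftrightarrow>
    qb (bridge' c j k l p) (c i k) = c i j * c l p + c j k * bridge' c i k l p - bridge' c i j l p"

locale com_family = qbracket +
  fixes n :: nat and c :: "nat \<Rightarrow> nat \<Rightarrow> 'a"
  assumes unit: "i \<le> n \<Longrightarrow> c i i = 1"
    and disjoint: "i \<le> j \<Longrightarrow> j \<le> k \<Longrightarrow> k \<le> l \<Longrightarrow> l \<le> n \<Longrightarrow> com (c i j) (c k l)"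
    and nested: "i \<le> j \<Longrightarrow> j \<le> k \<Longrightarrow> k \<le> l \<Longrightarrow> l \<le> n \<Longrightarrow> com (c j k) (c i l)"
begin

lemma disjoint': "i \<le> j \<Longrightarrow> j \<le> k \<Longrightarrow> k \<le> l \<Longrightarrow> l \<le> n \<Longrightarrow> com (c k l) (c i j)"
  using disjoint by (rule com_sym)

lemma nested': "i \<le> j \<Longrightarrow> j \<le> k \<Longrightarrow> k \<le> l \<Longrightarrow> l \<le> n \<Longrightarrow> com (c i l) (c j k)"
  using nested by (rule com_sym)

lemma com_intervals:
  assumes "i \<le> j" "j \<le> n" "k \<le> l" "l \<le> n"
    and "j \<le> k \<or> l \<le> i \<or> i \<le> k \<and> l \<le> j \<or> k \<le> i \<and> j \<le> l"
  shows "com (c i j) (c k l)"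
  using assms disjoint [of i j k l] disjoint' [of k l i j] nested [of k i j l] nested' [of i k l j]
  by blast

lemma aw_core_intervals:
  assumes "p0 \<le> p1" "p1 \<le> p2" "p2 \<le> p3" "p3 \<le> p4" "p4 \<le> n"
  shows "aw_core a b w (c p0 p1) (c p1 p2) (c p2 p3) (c p3 p4) (c p0 p4)
    (c p0 p2) (c p1 p3) (c p2 p4) (c p0 p3) (c p1 p4)"
proof
  fix z x
  assume "z \<in> {c p0 p1, c p1 p2, c p2 p3, c p3 p4, c p0 p4}"
    and "x \<in> {c p0 p1, c p1 p2, c p2 p3, c p3 p4, c p0 p4, c p0 p2, c p1 p3, c p2 p4, c p0 p3, c p1 p4}"
  then show "com z x"
    using assms by (elim insertE emptyE; hypsubst; intro com_intervals; linarith)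
qed (use assms in \<open>intro com_intervals; linarith\<close>)+

lemma interval_swaps:
  assumes "p0 \<le> p1" "p1 \<le> p2" "p2 \<le> p3" "p3 \<le> p4" "p4 \<le> n"
  shows "c p1 p3 * c p0 p4 = c p0 p4 * c p1 p3" "c p0 p2 * c p3 p4 = c p3 p4 * c p0 p2"
    "c p0 p2 * c p2 p3 = c p2 p3 * c p0 p2" "c p0 p2 * c p0 p4 = c p0 p4 * c p0 p2"
    "c p1 p3 * c p3 p4 = c p3 p4 * c p1 p3"
  by (intro com_sw com_intervals; use assms in linarith)+

lemma aw_core_letters:
  assumes "p0 \<le> p1" "p1 \<le> p2" "p2 \<le> p3" "p3 \<le> p4" "p4 \<le> n"
  shows "aw_core.C13 a b (c p0 p1) (c p1 p2) (c p2 p3) (c p0 p2) (c p1 p3) (c p0 p3) = bridge c p0 p1 p2 p3"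
    and "aw_core.D13 a b (c p0 p1) (c p1 p2) (c p2 p3) (c p0 p2) (c p1 p3) (c p0 p3) = bridge' c p0 p1 p2 p3"
    and "aw_core.C24 a b (c p1 p2) (c p2 p3) (c p3 p4) (c p1 p3) (c p2 p4) (c p1 p4) = bridge c p1 p2 p3 p4"
    and "aw_core.D24 a b (c p1 p2) (c p2 p3) (c p3 p4) (c p1 p3) (c p2 p4) (c p1 p4) = bridge' c p1 p2 p3 p4"
    and "aw_core.C14 a b (c p0 p1) (c p3 p4) (c p0 p4) (c p1 p3) (c p0 p3) (c p1 p4) = bridge c p0 p1 p3 p4"
    and "aw_core.D14 a b (c p0 p1) (c p3 p4) (c p0 p4) (c p1 p3) (c p0 p3) (c p1 p4) = bridge' c p0 p1 p3 p4"
    and "aw_core.C124 a b (c p2 p3) (c p3 p4) (c p0 p4) (c p0 p2) (c p2 p4) (c p0 p3) = bridge c p0 p2 p3 p4"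
    and "aw_core.D124 a b (c p2 p3) (c p3 p4) (c p0 p4) (c p0 p2) (c p2 p4) (c p0 p3) = bridge' c p0 p2 p3 p4"
    and "aw_core.C134 a b (c p0 p1) (c p1 p2) (c p0 p4) (c p0 p2) (c p2 p4) (c p1 p4) = bridge c p0 p1 p2 p4"
    and "aw_core.D134 a b (c p0 p1) (c p1 p2) (c p0 p4) (c p0 p2) (c p2 p4) (c p1 p4) = bridge' c p0 p1 p2 p4"
proof -
  interpret A: aw_core a b w "c p0 p1" "c p1 p2" "c p2 p3" "c p3 p4" "c p0 p4"
      "c p0 p2" "c p1 p3" "c p2 p4" "c p0 p3" "c p1 p4"
    using assms by (rule aw_core_intervals)
  show "A.C13 = bridge c p0 p1 p2 p3" "A.D13 = bridge' c p0 p1 p2 p3"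
    "A.C24 = bridge c p1 p2 p3 p4" "A.D24 = bridge' c p1 p2 p3 p4"
    "A.C14 = bridge c p0 p1 p3 p4" "A.D14 = bridge' c p0 p1 p3 p4"
    "A.C124 = bridge c p0 p2 p3 p4" "A.D124 = bridge' c p0 p2 p3 p4"
    "A.C134 = bridge c p0 p1 p2 p4" "A.D134 = bridge' c p0 p1 p2 p4"
    by (simp_all add: A.CD_defs bridge_def bridge'_def interval_swaps [OF assms])
qed

lemma aw_core2_intervals:
  assumes ord: "p0 \<le> p1" "p1 \<le> p2" "p2 \<le> p3" "p3 \<le> p4" "p4 \<le> n"
    and "tri c p0 p1 p2 p3" "tri' c p0 p1 p2 p3" "tri c p1 p2 p3 p4" "tri' c p1 p2 p3 p4"
      "tri c p0 p2 p3 p4" "tri' c p0 p2 p3 p4" "tri' c p0 p1 p3 p4" "tri' c p0 p1 p2 p4"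
      "quad c p0 p1 p2 p3 p4" "quad' c p0 p1 p2 p3 p4"
  shows "aw_core2 a b w (c p0 p1) (c p1 p2) (c p2 p3) (c p3 p4) (c p0 p4)
    (c p0 p2) (c p1 p3) (c p2 p4) (c p0 p3) (c p1 p4)"
proof -
  interpret A: aw_core a b w "c p0 p1" "c p1 p2" "c p2 p3" "c p3 p4" "c p0 p4"
      "c p0 p2" "c p1 p3" "c p2 p4" "c p0 p3" "c p1 p4"
    using ord by (rule aw_core_intervals)
  show ?thesis
    using assms(6-) unfolding tri_def tri'_def quad_def quad'_def
    by unfold_locales (simp_all add: aw_core_letters [OF ord] interval_swaps [OF ord])
qed

lemma bridge_degenerate:
  "i \<le> k \<Longrightarrow> k \<le> l \<Longrightarrow> l \<le> n \<Longrightarrow> bridge c i i k l = c k l"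
  "i \<le> k \<Longrightarrow> k \<le> l \<Longrightarrow> l \<le> n \<Longrightarrow> bridge' c i i k l = c k l"
  "i \<le> j \<Longrightarrow> j \<le> l \<Longrightarrow> l \<le> n \<Longrightarrow> bridge c i j j l = c i l"
  "i \<le> j \<Longrightarrow> j \<le> l \<Longrightarrow> l \<le> n \<Longrightarrow> bridge' c i j j l = c i l"
  "i \<le> j \<Longrightarrow> j \<le> l \<Longrightarrow> l \<le> n \<Longrightarrow> bridge c i j l l = c i j"
  "i \<le> j \<Longrightarrow> j \<le> l \<Longrightarrow> l \<le> n \<Longrightarrow> bridge' c i j l l = c i j"
proof -
  show "bridge c i i k l = c k l" "bridge' c i i k l = c k l" if "i \<le> k" "k \<le> l" "l \<le> n"
    using that nested [of i i k l] nested' [of i i k l]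
    by (simp_all add: bridge_def bridge'_def unit qb_com) (simp add: com_def)
  show "bridge c i j j l = c i l" "bridge' c i j j l = c i l" if "i \<le> j" "j \<le> l" "l \<le> n"
    using that disjoint [of i j j l] disjoint' [of i j j l]
    by (simp_all add: bridge_def bridge'_def unit qb_com) (simp add: com_def)
  show "bridge c i j l l = c i j" "bridge' c i j l l = c i j" if "i \<le> j" "j \<le> l" "l \<le> n"
    using that nested [of i j l l] nested' [of i j l l]
    by (simp_all add: bridge_def bridge'_def unit qb_com) (simp_all add: com_def)
qed

lemma flip: "qb x (qb y x) = qb (qb x y) x"
  by (simp add: qb_assoc)

text \<open>Reflection of \<open>{1..n}\<close> in terms of cut points. It exchanges increasing and
  decreasing sequences, so most primed relations for the twisted family follow from unprimed
  ones.\<close>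

definition "opp i j = c (n - j) (n - i)"

lemma bridge_opp:
  assumes "i \<le> j" "j \<le> k" "k \<le> l" "l \<le> n"
  shows "bridge opp i j k l = bridge' c (n - l) (n - k) (n - j) (n - i)"
    and "bridge' opp i j k l = bridge c (n - l) (n - k) (n - j) (n - i)"
  using assms by (simp_all add: bridge_def bridge'_def opp_def com_sw [OF disjoint'])

text \<open>The summand \<open>g\<close> common to both bridges commutes with the two intervals; for
  the bracket part the claim is \<open>flip\<close>.\<close>

lemma bridge_flip:
  assumes "i \<le> j" "j \<le> k" "k \<le> l" "l \<le> n"
  shows "qb (bridge' c i j k l) (c j l) = qb (c j l) (bridge c i j k l)"
    and "qb (c i k) (bridge' c i j k l) = qb (bridge c i j k l) (c i k)"
proof -
  define g where "g = c i j * c k l + c j k * c i l"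
  have com: "com g (c j l)" "com (c j l) g" "com g (c i k)" "com (c i k) g"
    using assms by (simp_all add: g_def nested nested' disjoint disjoint')
  have "bridge' c i j k l = g - qb (c j l) (c i k)" "bridge c i j k l = g - qb (c i k) (c j l)"
    by (simp_all add: bridge_def bridge'_def g_def)
  then show "qb (bridge' c i j k l) (c j l) = qb (c j l) (bridge c i j k l)"
    "qb (c i k) (bridge' c i j k l) = qb (bridge c i j k l) (c i k)"
    using com by (simp_all add: qb_lin qb_com com_sw [OF com(1)] com_sw [OF com(3)]
      flip [of "c j l" "c i k"] flip [of "c i k" "c j l"])
qed

lemma com_family_opp: "com_family a b w n opp"
proof
  fix i j k l
  assume "i \<le> j" "j \<le> k" "k \<le> l" "l \<le> n"
  then have ord: "n - l \<le> n - k" "n - k \<le> n - j" "n - j \<le> n - i" "n - i \<le> n"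
    by simp_all
  show "com (opp i j) (opp k l)" "com (opp j k) (opp i l)"
    unfolding opp_def by (rule disjoint' [OF ord], rule nested [OF ord])
qed (simp add: opp_def unit)

lemma tri_opp:
  assumes ord: "i \<le> j" "j \<le> k" "k \<le> l" "l \<le> n"
  shows "tri opp i j k l \<longleftrightarrow> tri' c (n - l) (n - k) (n - j) (n - i)"
    and "tri' opp i j k l \<longleftrightarrow> tri c (n - l) (n - k) (n - j) (n - i)"
proof -
  have ord': "n - l \<le> n - k" "n - k \<le> n - j" "n - j \<le> n - i" "n - i \<le> n"
    using ord by simp_all
  have swap: "opp i j * opp j k = opp j k * opp i j" "opp k l * opp j k = opp j k * opp k l"
    unfolding opp_def by (intro com_sw com_intervals; use ord' in linarith)+
  show "tri opp i j k l \<longleftrightarrow> tri' c (n - l) (n - k) (n - j) (n - i)"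
    using bridge_flip [OF ord']
    by (simp add: tri_def tri'_def bridge_opp [OF ord] swap) (simp add: opp_def)
  show "tri' opp i j k l \<longleftrightarrow> tri c (n - l) (n - k) (n - j) (n - i)"
    using bridge_flip [OF ord']
    by (simp add: tri_def tri'_def bridge_opp [OF ord] swap [symmetric]) (simp add: opp_def)
qed

lemma quad_opp:
  assumes ord: "i \<le> j" "j \<le> k" "k \<le> l" "l \<le> p" "p \<le> n"
  shows "quad opp i j k l p \<longleftrightarrow> quad' c (n - p) (n - l) (n - k) (n - j) (n - i)"
    and "quad' opp i j k l p \<longleftrightarrow> quad c (n - p) (n - l) (n - k) (n - j) (n - i)"
proof -
  have ord': "n - p \<le> n - l" "n - l \<le> n - k" "n - k \<le> n - j" "n - j \<le> n - i" "n - i \<le> n"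
    using ord by simp_all
  have swap: "opp i j * opp l p = opp l p * opp i j"
    unfolding opp_def by (intro com_sw com_intervals; use ord' in linarith)
  show "quad opp i j k l p \<longleftrightarrow> quad' c (n - p) (n - l) (n - k) (n - j) (n - i)"
    "quad' opp i j k l p \<longleftrightarrow> quad c (n - p) (n - l) (n - k) (n - j) (n - i)"
    using ord by (simp_all add: quad_def quad'_def bridge_opp swap) (simp_all add: opp_def)
qed

text \<open>Counterpart of \<open>quad\<close> without reversing the order of the sequence: the hole
  is cut at \<open>k\<close>, but now its left part is used, joined to the first interval.\<close>

definition "quad2 f i j k l p \<longleftrightarrow>
  bridge f i j l p = f i j * f l p + f j k * bridge f i k l p - qb (f i k) (bridge f j k l p)"

text \<open>The hole is cut at both \<open>j'\<close> and \<open>k\<close>. Expanding the inner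
  bridges by the left cut and moving the left factor out by associativity shows that a splitting at
  the right cut amounts to one at the left cut.\<close>

lemma bridge_assoc:
  assumes ord: "i \<le> j" "j \<le> j'" "j' \<le> k" "k \<le> l" "l \<le> p" "p \<le> n"
    and "quad2 c i j j' k l" "quad2 c i j j' k p" "quad c j j' k l p" "quad c i j' k l p"
  shows "quad c i j k l p \<longleftrightarrow> quad2 c i j j' l p"
proof -
  have com: "com (c i j) (c k p)" "com (c j j') (c k p)" "com (c k l) (c i j')" "com (c k l) (c k p)"
    "com (c l p) (c i j')" "com (c j j') (c i j')" "com (c i j) (c k l)" "com (c j j') (c k l)" "com (c i j') (c k p)"
    by (intro com_intervals; use ord in linarith)+
  have e: "bridge c i j k l = c i j * c k l + c j j' * bridge c i j' k l - qb (c i j') (bridge c j j' k l)"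
    "bridge c i j k p = c i j * c k p + c j j' * bridge c i j' k p - qb (c i j') (bridge c j j' k p)"
    "qb (bridge c j j' k l) (c k p) = c j j' * c l p + c k l * bridge c j j' k p - bridge c j j' l p"
    "qb (bridge c i j' k l) (c k p) = c i j' * c l p + c k l * bridge c i j' k p - bridge c i j' l p"
    using assms(7-) by (simp_all add: quad2_def quad_def)
  have "qb (bridge c i j k l) (c k p) = c i j * (c k l * c k p)
      + c j j' * (c i j' * c l p + c k l * bridge c i j' k p - bridge c i j' l p)
      - qb (c i j') (c j j' * c l p + c k l * bridge c j j' k p - bridge c j j' l p)"
    unfolding e(1) using com
    by (simp add: qb_lin qb_scale_left qb_com [of "c k l"] qb_assoc e(3,4))
  also have "\<dots> = c k l * bridge c i j k p
      - (c j j' * bridge c i j' l p - qb (c i j') (bridge c j j' l p))"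
    unfolding e(2) using com com_sym [OF com(5)]
    by (simp add: qb_lin qb_scale_right qb_com [of "c i j'" "c l p"] com_sw2 [OF com(7)] com_sw2 [OF com(8)]
        algebra_simps)
  finally have "qb (bridge c i j k l) (c k p) = c k l * bridge c i j k p
      - (c j j' * bridge c i j' l p - qb (c i j') (bridge c j j' l p))" .
  then show ?thesis
    unfolding quad_def quad2_def by (simp only:) (auto simp: algebra_simps)
qed

lemma quad_iff_quad2:
  assumes "i \<le> j" "j \<le> k" "k \<le> l" "l \<le> p" "p \<le> n"
  shows "quad c i j k l p \<longleftrightarrow> quad2 c i j k l p"
proof (rule bridge_assoc)
  show "quad2 c i j k k l" "quad2 c i j k k p"
    using assms by (simp_all add: quad2_def bridge_degenerate) (simp_all add: bridge_def)
  show "quad c j k k l p" "quad c i k k l p"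
    using assms by (simp_all add: quad_def bridge_degenerate) (simp_all add: bridge_def)
qed (use assms in auto)

end

locale aw_family = com_family +
  assumes triple: "i \<le> j \<Longrightarrow> j \<le> k \<Longrightarrow> k \<le> l \<Longrightarrow> l \<le> n \<Longrightarrow> tri c i j k l"
    and triple': "i \<le> j \<Longrightarrow> j \<le> k \<Longrightarrow> k \<le> l \<Longrightarrow> l \<le> n \<Longrightarrow> tri' c i j k l"
    and quadruple: "i \<le> j \<Longrightarrow> j \<le> k \<Longrightarrow> k \<le> l \<Longrightarrow> l \<le> p \<Longrightarrow> p \<le> n \<Longrightarrow> quad c i j k l p"
    and quadruple': "i \<le> j \<Longrightarrow> j \<le> k \<Longrightarrow> k \<le> l \<Longrightarrow> l \<le> p \<Longrightarrow> p \<le> n \<Longrightarrow> quad' c i j k l p"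

context qbracket
begin

text \<open>An empty interval contributes 1 and turns each relation into an identity between
  commuting terms. So the relations for non-empty intervals, which are those that
  \<open>aw(n)\<close> provides, give all degenerate ones.\<close>

lemma aw_family_strictI:
  assumes unit: "\<And>i. i \<le> n \<Longrightarrow> c i i = 1"
    and disjoint: "\<And>i j k l. i < j \<Longrightarrow> j \<le> k \<Longrightarrow> k < l \<Longrightarrow> l \<le> n \<Longrightarrow> com (c i j) (c k l)"
    and nested: "\<And>i j k l. i \<le> j \<Longrightarrow> j < k \<Longrightarrow> k \<le> l \<Longrightarrow> l \<le> n \<Longrightarrow> com (c j k) (c i l)"
    and triple: "\<And>i j k l. i < j \<Longrightarrow> j < k \<Longrightarrow> k < l \<Longrightarrow> l \<le> n \<Longrightarrow> tri c i j k l"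
    and triple': "\<And>i j k l. i < j \<Longrightarrow> j < k \<Longrightarrow> k < l \<Longrightarrow> l \<le> n \<Longrightarrow> tri' c i j k l"
    and quadruple: "\<And>i j k l p. i < j \<Longrightarrow> j < k \<Longrightarrow> k < l \<Longrightarrow> l < p \<Longrightarrow> p \<le> n \<Longrightarrow> quad c i j k l p"
    and quadruple': "\<And>i j k l p. i < j \<Longrightarrow> j < k \<Longrightarrow> k < l \<Longrightarrow> l < p \<Longrightarrow> p \<le> n \<Longrightarrow> quad' c i j k l p"
  shows "aw_family a b w n c"
proof -
  have d: "com (c i j) (c k l)" "com (c k l) (c i j)" if "i \<le> j" "j \<le> k" "k \<le> l" "l \<le> n" for i j k l
  proof -
    show "com (c i j) (c k l)"
      using that disjoint [of i j k l] by (cases "i = j"; cases "k = l") (auto simp: unit)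
    then show "com (c k l) (c i j)"
      by (rule com_sym)
  qed
  have e: "com (c j k) (c i l)" "com (c i l) (c j k)" if "i \<le> j" "j \<le> k" "k \<le> l" "l \<le> n" for i j k l
  proof -
    show "com (c j k) (c i l)"
      using that nested [of i j k l] by (cases "j = k") (auto simp: unit)
    then show "com (c i l) (c j k)"
      by (rule com_sym)
  qed
  interpret com_family a b w n c
    by unfold_locales (use unit d e in auto)
  note b1 = bridge_degenerate(1,2) and b2 = bridge_degenerate(3,4) and b3 = bridge_degenerate(5,6)
  show ?thesis
  proof
    fix i j k l
    assume ord: "i \<le> j" "j \<le> k" "k \<le> l" "l \<le> n"
    have o: "com (c j k) (c i j)" "com (c j l) (c i j)" "com (c j l) (c i l)" "com (c k l) (c i k)" "com (c k l) (c j k)"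
        "com (c k l) (c j l)" "com (c k l) (c i l)" "com (c i l) (c i k)"
      using ord d e by simp_all
    show "tri c i j k l"
      unfolding tri_def
      using triple [of i j k l, unfolded tri_def] ord
      by (cases "i = j"; cases "j = k"; cases "k = l") (auto simp: b1 b2 b3 unit qb_com o com_sw [OF o(1)] com_sw [OF o(2)] d e com_sw [OF o(6)])
    show "tri' c i j k l"
      unfolding tri'_def
      using triple' [of i j k l, unfolded tri'_def] ord
      by (cases "i = j"; cases "j = k"; cases "k = l") (auto simp: b1 b2 b3 unit qb_com o com_sw [OF o(1)] com_sw [OF o(2)] d e com_sw [OF o(5)] com_sw [OF o(8)])
  next
    fix i j k l p
    assume ord: "i \<le> j" "j \<le> k" "k \<le> l" "l \<le> p" "p \<le> n"
    have o: "com (c k l) (c k p)" "com (c i j) (c k p)" "com (c j k) (c i k)" "com (c l p) (c i j)"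
      using ord d e by simp_all
    have f: "com (bridge c i j k l) (c k l)"
      using ord d e by (auto simp: bridge_def)
    have f': "com (bridge' c i k l p) (c i k)"
      using ord d e by (auto simp: bridge'_def)
    show "quad c i j k l p"
    proof -
      consider "i = j" | "j = k" | "k = l" | "l = p" | "i < j" "j < k" "k < l" "l < p"
        using ord by linarith
      then show ?thesis
      proof cases
        case 1
        with ord o show ?thesis
          by (simp add: quad_def b1 unit qb_com)
      next
        case 2
        with ord o show ?thesis
          by (simp add: quad_def b2 unit) (simp add: bridge_def)
      next
        case 3
        with ord o show ?thesis
          by (simp add: quad_def b3 unit qb_com)
      next
        case 4
        with ord f show ?thesis
          by (simp add: quad_def b3 unit qb_com) (simp add: com_def)
      qed (use ord quadruple [of i j k l p] in simp)
    qed
    show "quad' c i j k l p"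
    proof -
      consider "i = j" | "j = k" | "k = l" | "l = p" | "i < j" "j < k" "k < l" "l < p"
        using ord by linarith
      then show ?thesis
      proof cases
        case 1
        with ord f' show ?thesis
          by (simp add: quad'_def b1 unit qb_com) (simp add: com_def)
      next
        case 2
        with ord o show ?thesis
          by (simp add: quad'_def b1 unit qb_com) (simp add: com_def)
      next
        case 3
        with ord o show ?thesis
          by (simp add: quad'_def b2 unit) (simp add: bridge'_def)
      next
        case 4
        with ord o show ?thesis
          by (simp add: quad'_def b3 unit qb_com)
      qed (use ord quadruple' [of i j k l p] in simp)
    qed
  qed
qed

end

context aw_family
begin

lemma aw_family_opp: "aw_family a b w n opp"
proof -
  interpret O: com_family a b w n opp
    by (rule com_family_opp)
  show ?thesis
    by unfold_locales (simp_all add: tri_opp quad_opp triple triple' quadruple quadruple')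
qed

lemma aw4_intervals:
  assumes "p0 \<le> p1" "p1 \<le> p2" "p2 \<le> p3" "p3 \<le> p4" "p4 \<le> n"
  shows "aw4 a b w (c p0 p1) (c p1 p2) (c p2 p3) (c p3 p4) (c p0 p4)
    (c p0 p2) (c p1 p3) (c p2 p4) (c p0 p3) (c p1 p4)"
proof -
  interpret A: aw_core2 a b w "c p0 p1" "c p1 p2" "c p2 p3" "c p3 p4" "c p0 p4"
      "c p0 p2" "c p1 p3" "c p2 p4" "c p0 p3" "c p1 p4"
    using assms by (intro aw_core2_intervals) (auto intro!: triple triple' quadruple quadruple')
  have "c p2 p4 * c p0 p4 = c p0 p4 * c p2 p4"
    by (intro com_sw com_intervals; use assms in linarith)
  then show ?thesis
    using triple [of p0 p1 p3 p4] triple [of p0 p1 p2 p4] assms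
    by unfold_locales (simp_all add: tri_def aw_core_letters [OF assms])
qed

end

section \<open>The twisted family\<close>

locale aw_twist = aw_family +
  fixes e :: nat
  assumes e: "Suc (Suc e) \<le> n"
begin

abbreviation "s \<equiv> Suc e"
abbreviation "cx \<equiv> c e s"
abbreviation "cy \<equiv> c s (Suc s)"
abbreviation "D \<equiv> c e (Suc s)"

text \<open>To be applied to an interval with an end at \<open>s\<close>: \<open>x\<close> is the
  interval itself, \<open>u\<close> and \<open>v\<close> have that end moved to \<open>Suc s\<close>
  and to \<open>e\<close>. One formula thus covers both kinds of end.\<close>

definition lin :: "'a \<Rightarrow> 'a \<Rightarrow> 'a \<Rightarrow> 'a"
  where "lin u v x = cx * u + cy * v - qb D x"

text \<open>The images of the intervals under r_i for \<open>i = s\<close>. An interval with right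
  end \<open>s\<close> receives the reversed order, one with left end \<open>s\<close> the
  increasing order; see \<open>t_left_bridge\<close> and \<open>t_right_bridge\<close>.\<close>

definition t :: "nat \<Rightarrow> nat \<Rightarrow> 'a"
  where "t i k = (if i = s \<and> s < k \<or> k = s \<and> i < s
    then lin (c (if i = s then Suc s else i) (if k = s then Suc s else k))
      (c (if i = s then e else i) (if k = s then e else k)) (c i k)
    else c i k)"

lemma t_right: "s < k \<Longrightarrow> t s k = lin (c (Suc s) k) (c e k) (c s k)"
  and t_left: "i < s \<Longrightarrow> t i s = lin (c i (Suc s)) (c i e) (c i s)"
  and t_other: "i \<noteq> s \<Longrightarrow> k \<noteq> s \<Longrightarrow> t i k = c i k"
  and t_same: "t i i = c i i"
  by (auto simp: t_def)

definition good :: "'a \<Rightarrow> bool"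
  where "good P \<longleftrightarrow> com D P \<and> com cx P \<and> com cy P"

lemma good_c: "i \<le> k \<Longrightarrow> k \<le> n \<Longrightarrow> i \<noteq> s \<Longrightarrow> k \<noteq> s \<Longrightarrow> good (c i k)"
proof -
  assume ik: "i \<le> k" "k \<le> n" "i \<noteq> s" "k \<noteq> s"
  then consider "k \<le> e" | "Suc s \<le> i" | "i \<le> e" "Suc s \<le> k"
    by linarith
  then show ?thesis
    unfolding good_def using ik e by cases (auto intro: disjoint disjoint' nested)
qed

lemma good_closed:
  "good P \<Longrightarrow> good Q \<Longrightarrow> good (P + Q)" "good P \<Longrightarrow> good Q \<Longrightarrow> good (P - Q)"
  "good P \<Longrightarrow> good Q \<Longrightarrow> good (P * Q)" "good P \<Longrightarrow> good Q \<Longrightarrow> good (qb P Q)"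
  by (simp_all add: good_def)

text \<open>Factors that are \<open>good\<close> pass through \<open>lin\<close>. Hence a relation
  with at most one letter ending at \<open>s\<close> in each product holds for \<open>t\<close> as
  the \<open>lin\<close> of three relations for \<open>c\<close>, in which the cut point is
  \<open>Suc s\<close>, \<open>e\<close> and \<open>s\<close>.\<close>

lemma lin_pull:
  "lin u v x + lin u' v' x' = lin (u + u') (v + v') (x + x')"
  "lin u v x - lin u' v' x' = lin (u - u') (v - v') (x - x')"
  "good P \<Longrightarrow> lin u v x * P = lin (u * P) (v * P) (x * P)"
  "good P \<Longrightarrow> P * lin u v x = lin (P * u) (P * v) (P * x)"
  "good P \<Longrightarrow> qb P (lin u v x) = lin (qb P u) (qb P v) (qb P x)"
  "good P \<Longrightarrow> qb (lin u v x) P = lin (qb u P) (qb v P) (qb x P)"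
proof -
  show "lin u v x + lin u' v' x' = lin (u + u') (v + v') (x + x')"
    "lin u v x - lin u' v' x' = lin (u - u') (v - v') (x - x')"
    by (simp_all add: lin_def qb_lin algebra_simps)
  assume P: "good P"
  have 1: "qb D (x * P) = qb D x * P" "qb D (P * x) = P * qb D x"
    using P qb_scale_right [of P D x] 
    by (simp_all add: good_def com_sym qb_def algebra_simps com_def flip: mult.assoc)
       (simp_all add: mult.assoc)
  have 2: "qb D (qb P x) = qb P (qb D x)" "qb D (qb x P) = qb (qb D x) P"
    using P by (simp_all add: good_def qb_left_commute [of D P] qb_assoc [of D P])
  have 3: "P * (cx * v) = cx * (P * v)" "P * (cy * v) = cy * (P * v)" for v
    using P unfolding good_def by (auto intro: com_sw2)
  have 4: "qb P (cx * v) = cx * qb P v" "qb P (cy * v) = cy * qb P v"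
    "qb (cx * v) P = cx * qb v P" "qb (cy * v) P = cy * qb v P" for v
    using P by (simp_all add: good_def qb_scale_left qb_scale_right)
  show "lin u v x * P = lin (u * P) (v * P) (x * P)"
    "P * lin u v x = lin (P * u) (P * v) (P * x)"
    "qb P (lin u v x) = lin (qb P u) (qb P v) (qb P x)"
    "qb (lin u v x) P = lin (qb u P) (qb v P) (qb x P)"
    by (simp_all add: lin_def 1 2 3 4 qb_lin algebra_simps)
qed

lemma triple_t_0:
  assumes "s < j" "j < k" "k < l" "l \<le> n"
  shows "tri t s j k l"
  using assms e triple [of s j k l] triple [of e j k l] triple [of "Suc s" j k l]
  by (simp add: tri_def quad_def bridge_def t_right t_other good_c lin_pull)

lemma triple_t_2:
  assumes "i < j" "j < s" "s < l" "l \<le> n"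
  shows "tri t i j s l"
  using assms e triple [of i j s l] triple [of i j e l] triple [of i j "Suc s" l]
  by (simp add: tri_def quad_def bridge_def t_right t_left t_other good_c lin_pull)

lemma quadruple_t_0:
  assumes "s < j" "j < k" "k < l" "l < p" "p \<le> n"
  shows "quad t s j k l p"
  using assms e quadruple [of s j k l p] quadruple [of e j k l p] quadruple [of "Suc s" j k l p]
  by (simp add: tri_def quad_def bridge_def t_right t_left t_other good_c lin_pull)

lemma quadruple_t_1:
  assumes "i < s" "s < k" "k < l" "l < p" "p \<le> n"
  shows "quad t i s k l p"
  using assms e quadruple [of i s k l p] quadruple [of i e k l p] quadruple [of i "Suc s" k l p]
  by (simp add: tri_def quad_def bridge_def t_right t_left t_other good_c lin_pull)

lemma quadruple_t_3:
  assumes "i < j" "j < k" "k < s" "s < p" "p \<le> n"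
  shows "quad t i j k s p"
  using assms e quadruple [of i j k s p] quadruple [of i j k e p] quadruple [of i j k "Suc s" p]
  by (simp add: tri_def quad_def bridge_def t_right t_left t_other good_c good_closed lin_pull)

lemma quadruple_t_4:
  assumes "i < j" "j < k" "k < l" "l < s"
  shows "quad t i j k l s"
  using assms e quadruple [of i j k l s] quadruple [of i j k l e] quadruple [of i j k l "Suc s"]
  by (simp add: tri_def quad_def bridge_def t_right t_left t_other good_c good_closed lin_pull)

end

context aw_twist
begin

lemma com_lin:
  assumes "com P cx" "com P cy" "com P D" "com P u" "com P v" "com P x"
  shows "com P (lin u v x)" "com (lin u v x) P"
  using assms by (auto simp: lin_def intro: com_sym)

lemma t_left_bridge: "i \<le> e \<Longrightarrow> t i s = bridge' c i e s (Suc s)"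
proof -
  assume "i \<le> e"
  then have "c i e * cy = cy * c i e"
    using e by (intro com_sw disjoint') auto
  with \<open>i \<le> e\<close> show ?thesis
    by (simp add: t_left lin_def bridge'_def algebra_simps)
qed

lemma t_right_bridge: "Suc s \<le> k \<Longrightarrow> t s k = bridge c e s (Suc s) k"
  by (simp add: t_right lin_def bridge_def)

lemma com_left_right: "i \<le> e \<Longrightarrow> Suc s \<le> l \<Longrightarrow> l \<le> n \<Longrightarrow> com (t i s) (t s l)"
proof -
  assume il: "i \<le> e" "Suc s \<le> l" "l \<le> n"
  then have ord: "i \<le> e" "e \<le> s" "s \<le> Suc s" "Suc s \<le> l" "l \<le> n"
    by simp_all
  interpret A: aw4 a b w "c i e" "c e s" "c s (Suc s)" "c (Suc s) l" "c i l"
      "c i s" "c e (Suc s)" "c s l" "c i (Suc s)" "c e l"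
    by (rule aw4_intervals [OF ord])
  show ?thesis
    using A.com_D13_C24 il by (simp add: t_left_bridge t_right_bridge aw_core_letters [OF ord])
qed

lemma com_right_right: "Suc s \<le> k \<Longrightarrow> k \<le> l \<Longrightarrow> l \<le> n \<Longrightarrow> com (t s k) (t s l)"
proof -
  assume kl: "Suc s \<le> k" "k \<le> l" "l \<le> n"
  then have ord: "e \<le> s" "s \<le> Suc s" "Suc s \<le> k" "k \<le> l" "l \<le> n"
    by simp_all
  interpret A: aw4 a b w "c e s" "c s (Suc s)" "c (Suc s) k" "c k l" "c e l"
      "c e (Suc s)" "c s k" "c (Suc s) l" "c e k" "c s l"
    by (rule aw4_intervals [OF ord])
  show ?thesis
    using A.com13_134 kl by (simp add: t_right_bridge aw_core_letters [OF ord])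
qed

lemma com_left_left: "i \<le> j \<Longrightarrow> j \<le> e \<Longrightarrow> com (t j s) (t i s)"
proof -
  assume ij: "i \<le> j" "j \<le> e"
  then have ord: "i \<le> j" "j \<le> e" "e \<le> s" "s \<le> Suc s" "Suc s \<le> n"
    using e by simp_all
  interpret A: aw4 a b w "c i j" "c j e" "c e s" "c s (Suc s)" "c i (Suc s)"
      "c i e" "c j s" "c e (Suc s)" "c i s" "c j (Suc s)"
    by (rule aw4_intervals [OF ord])
  show ?thesis
    using A.com_D24_D124 ij by (simp add: t_left_bridge aw_core_letters [OF ord])
qed

text \<open>Two twisted letters commute by the three preceding lemmas. For a twisted and an
  untwisted one it is enough that the untwisted interval is disjoint from or nested with every
  ingredient of \<open>lin\<close>.\<close>

lemma com_family_t: "com_family a b w n t"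
proof -
  have unit_t: "t i i = 1" if "i \<le> n" for i
    using that by (simp add: t_same unit)
  have l: "com (c i k) (t j s)" "com (t j s) (c i k)"
    if "i \<le> k" "k \<le> n" "j \<le> e" "k \<le> j \<or> Suc s \<le> i \<or> i \<le> j \<and> Suc s \<le> k \<or> j \<le> i \<and> k \<le> e" for i j k
    unfolding t_left [of j, OF le_imp_less_Suc [OF that(3)]]
    by (rule com_lin; intro com_intervals; use that e in linarith)+
  have r: "com (c i k) (t s j)" "com (t s j) (c i k)"
    if "i \<le> k" "k \<le> n" "Suc s \<le> j" "j \<le> n" "j \<le> i \<or> k \<le> e \<or> i \<le> e \<and> j \<le> k \<or> Suc s \<le> i \<and> k \<le> j" for i j k
    unfolding t_right [of j, OF Suc_le_lessD [OF that(3)]]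
    by (rule com_lin; intro com_intervals; use that e in linarith)+
  have disjoint_t: "com (t i j) (t k l)" if "i < j" "j \<le> k" "k < l" "l \<le> n" for i j k l
  proof -
    consider "j = s" "k = s" | "j = s" "k \<noteq> s" | "j \<noteq> s" "k = s" | "i = s" | "l = s"
      | "i \<noteq> s" "j \<noteq> s" "k \<noteq> s" "l \<noteq> s"
      by blast
    then show ?thesis
    proof cases
      case 1 then show ?thesis using that com_left_right [of i l] by simp
    next
      case 2 then show ?thesis using that l [of k l i] by (simp add: t_other)
    next
      case 3 then show ?thesis using that r [of i j l] by (simp add: t_other)
    next
      case 4 then show ?thesis using that r [of k l j] by (simp add: t_other)
    next
      case 5 then show ?thesis using that l [of i j k] by (simp add: t_other)
    next
      case 6 then show ?thesis using that disjoint [of i j k l] by (simp add: t_other)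
    qed
  qed
  have nested_t: "com (t j k) (t i l)" if "i \<le> j" "j < k" "k \<le> l" "l \<le> n" for i j k l
  proof -
    consider "i = s" "j = s" | "k = s" "l = s" | "i = s" "j \<noteq> s" | "i \<noteq> s" "j = s"
      | "k = s" "l \<noteq> s" | "k \<noteq> s" "l = s" | "i \<noteq> s" "j \<noteq> s" "k \<noteq> s" "l \<noteq> s"
      by blast
    then show ?thesis
    proof cases
      case 1 then show ?thesis using that com_right_right [of k l] by simp
    next
      case 2 then show ?thesis using that com_left_left [of i j] by simp
    next
      case 3 then show ?thesis using that r [of j k l] by (simp add: t_other)
    next
      case 4 then show ?thesis using that r [of i l k] by (simp add: t_other)
    next
      case 5 then show ?thesis using that l [of i l j] by (simp add: t_other)
    next
      case 6 then show ?thesis using that l [of j k i] by (simp add: t_other)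
    next
      case 7 then show ?thesis using that nested [of i j k l] by (simp add: t_other)
    qed
  qed
  show ?thesis
  proof
    show "com (t i j) (t k l)" if "i \<le> j" "j \<le> k" "k \<le> l" "l \<le> n" for i j k l
      using that disjoint_t [of i j k l] by (cases "i = j"; cases "k = l") (auto simp: unit_t)
    show "com (t j k) (t i l)" if "i \<le> j" "j \<le> k" "k \<le> l" "l \<le> n" for i j k l
      using that nested_t [of i j k l] by (cases "j = k") (auto simp: unit_t)
  qed (rule unit_t)
qed

end

sublocale aw_twist \<subseteq> T: com_family a b w n t
  by (rule com_family_t)

context aw_twist
begin

text \<open>With \<open>s\<close> as last cut point, two letters ending at \<open>s\<close> meet in
  a bracket and linearity fails. For the neighbouring third cut point \<open>e\<close> all letters
  belong to one \<open>aw4\<close>.\<close>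

lemma triple_t_3_atomic:
  assumes "i < j" "j < e"
  shows "tri t i j e s"
proof -
  have ord: "i \<le> j" "j \<le> e" "e \<le> s" "s \<le> Suc s" "Suc s \<le> n"
    using assms e by simp_all
  interpret A: aw4 a b w "c i j" "c j e" "c e s" "c s (Suc s)" "c i (Suc s)"
      "c i e" "c j s" "c e (Suc s)" "c i s" "c j (Suc s)"
    by (rule aw4_intervals [OF ord])
  have "t e s = cy"
    using ord by (simp add: t_left_bridge bridge_degenerate)
  then show ?thesis
    using A.twisted_T2_34_1 assms ord
    unfolding aw_core_letters [OF ord] tri_def bridge_def [of t]
    by (simp add: t_left_bridge [of i] t_left_bridge [of j] t_other)
qed

lemma triple_t_1_atomic:
  assumes "i < s" "Suc s < l" "l \<le> n"
  shows "tri t i s (Suc s) l"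
proof -
  have ord: "i \<le> e" "e \<le> s" "s \<le> Suc s" "Suc s \<le> l" "l \<le> n"
    using assms by simp_all
  interpret A: aw4 a b w "c i e" "c e s" "c s (Suc s)" "c (Suc s) l" "c i l"
      "c i s" "c e (Suc s)" "c s l" "c i (Suc s)" "c e l"
    by (rule aw4_intervals [OF ord])
  have "t s (Suc s) = cx"
    using ord by (simp add: t_right_bridge bridge_degenerate)
  moreover have "t i s = A.D13" "t s l = A.C24"
    using assms ord by (simp_all add: t_left_bridge t_right_bridge aw_core_letters [OF ord])
  moreover have "A.D13 * c (Suc s) l = c (Suc s) l * A.D13" "A.D13 * cx = cx * A.D13"
    by (rule com_sw; simp)+
  ultimately show ?thesis
    using A.twisted_T34_12 assms
    unfolding tri_def bridge_def [of t] by (simp add: t_other)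
qed

text \<open>The middle cut point occurs in both arguments of the bracket, so linearity fails. With
  neighbours on both sides the letters are again those of an \<open>aw4\<close>, where
  \<open>S231\<close> and \<open>R0\<close> evaluate the mixed brackets.\<close>

lemma quadruple_t_2_atomic:
  assumes "i < e" "Suc s < p" "p \<le> n"
  shows "quad t i e s (Suc s) p"
proof -
  have ord: "i \<le> e" "e \<le> s" "s \<le> Suc s" "Suc s \<le> p" "p \<le> n"
    using assms by simp_all
  interpret A: aw4 a b w "c i e" "c e s" "c s (Suc s)" "c (Suc s) p" "c i p"
      "c i s" "c e (Suc s)" "c s p" "c i (Suc s)" "c e p"
    by (rule aw4_intervals [OF ord])
  have "t s (Suc s) = cx" "t e s = cy"
    using ord by (simp_all add: t_right_bridge t_left_bridge bridge_degenerate)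
  moreover have "t i s = A.D13" "t s p = A.C24"
    using assms ord by (simp_all add: t_left_bridge t_right_bridge aw_core_letters [OF ord])
  moreover have "t i e = c i e" "t i (Suc s) = c i (Suc s)" "t e (Suc s) = c e (Suc s)" "t e p = c e p"
    "t i p = c i p" "t (Suc s) p = c (Suc s) p"
    using assms by (simp_all add: t_other)
  moreover have "bridge t i e (Suc s) p = A.C14"
    unfolding aw_core_letters [OF ord] by (simp add: bridge_def calculation)
  ultimately show ?thesis
    unfolding quad_def bridge_def [of t i e s] by (simp add: A.S231 A.R0 A.T124)
qed

end

context com_family
begin

text \<open>Moves an inner cut point from \<open>p3\<close> to \<open>p2\<close>;
  \<open>tri_23_4_1\<close> goes the other way. They are applied when the starting position is next
  to \<open>s\<close>, where the relation is known already.\<close>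

lemma tri_2_34_1:
  assumes ord: "p0 \<le> p1" "p1 \<le> p2" "p2 \<le> p3" "p3 \<le> p4" "p4 \<le> n"
    and "tri c p0 p1 p2 p3" "tri' c p0 p1 p2 p3" "tri c p1 p2 p3 p4" "tri' c p1 p2 p3 p4"
      "tri c p0 p2 p3 p4" "tri' c p0 p2 p3 p4" "tri' c p0 p1 p3 p4" "tri' c p0 p1 p2 p4"
      "quad c p0 p1 p2 p3 p4" "quad' c p0 p1 p2 p3 p4"
    and T: "tri c p0 p1 p3 p4"
  shows "tri c p0 p1 p2 p4"
proof -
  interpret A: aw_core2 a b w "c p0 p1" "c p1 p2" "c p2 p3" "c p3 p4" "c p0 p4"
      "c p0 p2" "c p1 p3" "c p2 p4" "c p0 p3" "c p1 p4"
    using assms(1-15) by (rule aw_core2_intervals)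
  have "qb (c p1 p4) A.C14 = c p0 p1 * c p1 p3 + c p3 p4 * c p0 p4 - c p0 p3"
    using T unfolding tri_def aw_core_letters [OF ord] by simp
  then have "qb A.D134 (c p1 p4) = c p0 p1 * c p1 p2 + c p0 p4 * c p2 p4 - c p0 p2"
    by (rule A.T2_34_1)
  moreover have "c p0 p4 * c p2 p4 = c p2 p4 * c p0 p4"
    by (intro com_sw com_intervals; use ord in linarith)
  ultimately show ?thesis
    unfolding tri_def aw_core_letters [OF ord] using ord by (simp add: bridge_flip)
qed

lemma tri_23_4_1:
  assumes ord: "p0 \<le> p1" "p1 \<le> p2" "p2 \<le> p3" "p3 \<le> p4" "p4 \<le> n"
    and "tri c p0 p1 p2 p3" "tri' c p0 p1 p2 p3" "tri c p1 p2 p3 p4" "tri' c p1 p2 p3 p4"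
      "tri c p0 p2 p3 p4" "tri' c p0 p2 p3 p4" "tri' c p0 p1 p3 p4" "tri' c p0 p1 p2 p4"
      "quad c p0 p1 p2 p3 p4" "quad' c p0 p1 p2 p3 p4"
    and T: "tri c p0 p1 p2 p4"
  shows "tri c p0 p1 p3 p4"
proof -
  interpret A: aw_core2 a b w "c p0 p1" "c p1 p2" "c p2 p3" "c p3 p4" "c p0 p4"
      "c p0 p2" "c p1 p3" "c p2 p4" "c p0 p3" "c p1 p4"
    using assms(1-15) by (rule aw_core2_intervals)
  have "c p0 p4 * c p2 p4 = c p2 p4 * c p0 p4"
    by (intro com_sw com_intervals; use ord in linarith)
  then have "qb A.D134 (c p1 p4) = c p0 p1 * c p1 p2 + c p0 p4 * c p2 p4 - c p0 p2"
    using T ord unfolding tri_def aw_core_letters [OF ord] by (simp add: bridge_flip)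
  then have "qb (c p1 p4) A.C14 = c p0 p1 * c p1 p3 + c p3 p4 * c p0 p4 - c p0 p3"
    by (rule A.T23_41)
  then show ?thesis
    unfolding tri_def aw_core_letters [OF ord] .
qed

end

section \<open>Reflected twists, and reduction of the non-linear relations to neighbouring cut
  points\<close>

context aw_twist
begin

lemma aw_twist_opp: "aw_twist a b w n opp (n - Suc s)"
proof -
  interpret O: aw_family a b w n opp
    by (rule aw_family_opp)
  show ?thesis
    by unfold_locales (use e in simp)
qed

text \<open>Reflection exchanges the two neighbours of \<open>s\<close>, hence \<open>cx\<close>
  with \<open>cy\<close> and \<open>u\<close> with \<open>v\<close>, which leaves \<open>lin\<close>
  unchanged. The twist at \<open>s\<close> becomes the twist at \<open>n - s\<close>, with
  \<open>n - Suc s\<close> in the role of \<open>e\<close>.\<close>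

lemma t_opp:
  assumes "i \<le> k" "k \<le> n"
  shows "aw_twist.t a b opp (n - Suc s) i k = T.opp i k"
proof -
  interpret O: aw_twist a b w n opp "n - Suc s"
    by (rule aw_twist_opp)
  have s': "Suc (n - Suc s) = n - s" "n - (n - s) = s" "n - (n - Suc s) = Suc s"
    "n - Suc (n - s) = e"
    using e by linarith+
  have lin: "O.lin u v x = lin v u x" for u v x
    unfolding O.lin_def lin_def opp_def s' by (simp add: algebra_simps)
  consider "i = k" | "i < k" "i = n - s" | "i < k" "k = n - s" | "i < k" "i \<noteq> n - s" "k \<noteq> n - s"
    using assms by linarith
  then show ?thesis
  proof cases
    case 1
    then show ?thesis
      by (simp add: O.t_same T.opp_def t_same opp_def)
  next
    case 2
    then have k: "n - k < s" "n - s < k"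
      using assms by linarith+
    have "O.t (n - s) k = lin (c (n - k) (Suc s)) (c (n - k) e) (c (n - k) s)"
      using O.t_right [of k] k(2) unfolding lin opp_def s' by simp
    then show ?thesis
      unfolding 2(2) T.opp_def s' using k(1) by (simp add: t_left)
  next
    case 3
    then have i: "s < n - i" "i < n - s"
      using e by linarith+
    have "O.t i (n - s) = lin (c (Suc s) (n - i)) (c e (n - i)) (c s (n - i))"
      using O.t_left [of i] i(2) unfolding lin opp_def s' by simp
    then show ?thesis
      unfolding 3(2) T.opp_def s' using i(1) by (simp add: t_right)
  next
    case 4
    then have "n - k \<noteq> s" "n - i \<noteq> s"
      using assms by linarith+
    moreover have "O.t i k = opp i k"
      using 4 s'(1) by (intro O.t_other) auto
    ultimately show ?thesis
      by (simp add: T.opp_def opp_def t_other)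
  qed
qed

lemma tri'_t_opp:
  assumes ord: "i \<le> j" "j \<le> k" "k \<le> l" "l \<le> n"
    and "tri (aw_twist.t a b opp (n - Suc s)) (n - l) (n - k) (n - j) (n - i)"
  shows "tri' t i j k l"
proof -
  have ord': "n - l \<le> n - k" "n - k \<le> n - j" "n - j \<le> n - i" "n - i \<le> n"
    using ord by simp_all
  then have "tri T.opp (n - l) (n - k) (n - j) (n - i)"
    using assms(5) ord' by (simp add: tri_def bridge_def t_opp)
  then show ?thesis
    using T.tri_opp(1) [OF ord'] ord by simp
qed

lemma quad'_t_opp:
  assumes ord: "i \<le> j" "j \<le> k" "k \<le> l" "l \<le> p" "p \<le> n"
    and "quad (aw_twist.t a b opp (n - Suc s)) (n - p) (n - l) (n - k) (n - j) (n - i)"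
  shows "quad' t i j k l p"
proof -
  have ord': "n - p \<le> n - l" "n - l \<le> n - k" "n - k \<le> n - j" "n - j \<le> n - i" "n - i \<le> n"
    using ord by simp_all
  then have "quad T.opp (n - p) (n - l) (n - k) (n - j) (n - i)"
    using assms(6) ord' by (simp add: quad_def bridge_def t_opp)
  then show ?thesis
    using T.quad_opp(1) [OF ord'] ord by simp
qed

lemma Suc_opp: "Suc (n - Suc s) = n - s"
  using e by simp

lemma triple'_t_1:
  assumes "i < s" "s < k" "k < l" "l \<le> n"
  shows "tri' t i s k l"
proof -
  interpret O: aw_twist a b w n opp "n - Suc s"
    by (rule aw_twist_opp)
  show ?thesis
    using O.triple_t_2 [of "n - l" "n - k" "n - i"] assms
    by (intro tri'_t_opp) (simp_all add: Suc_opp diff_less_mono2)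
qed

lemma triple'_t_3:
  assumes "i < j" "j < k" "k < s"
  shows "tri' t i j k s"
proof -
  interpret O: aw_twist a b w n opp "n - Suc s"
    by (rule aw_twist_opp)
  show ?thesis
    using O.triple_t_0 [of "n - k" "n - j" "n - i"] assms e
    by (intro tri'_t_opp) (simp_all add: Suc_opp diff_less_mono2)
qed

lemma quadruple'_t_0:
  assumes "s < j" "j < k" "k < l" "l < p" "p \<le> n"
  shows "quad' t s j k l p"
proof -
  interpret O: aw_twist a b w n opp "n - Suc s"
    by (rule aw_twist_opp)
  show ?thesis
    using O.quadruple_t_4 [of "n - p" "n - l" "n - k" "n - j"] assms
    by (intro quad'_t_opp) (simp_all add: Suc_opp diff_less_mono2)
qed

lemma quadruple'_t_1:
  assumes "i < s" "s < k" "k < l" "l < p" "p \<le> n"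
  shows "quad' t i s k l p"
proof -
  interpret O: aw_twist a b w n opp "n - Suc s"
    by (rule aw_twist_opp)
  show ?thesis
    using O.quadruple_t_3 [of "n - p" "n - l" "n - k" "n - i"] assms
    by (intro quad'_t_opp) (simp_all add: Suc_opp diff_less_mono2)
qed

lemma quadruple'_t_3:
  assumes "i < j" "j < k" "k < s" "s < p" "p \<le> n"
  shows "quad' t i j k s p"
proof -
  interpret O: aw_twist a b w n opp "n - Suc s"
    by (rule aw_twist_opp)
  show ?thesis
    using O.quadruple_t_1 [of "n - p" "n - k" "n - j" "n - i"] assms
    by (intro quad'_t_opp) (simp_all add: Suc_opp diff_less_mono2)
qed

lemma quadruple'_t_4:
  assumes "i < j" "j < k" "k < l" "l < s"
  shows "quad' t i j k l s"
proof -
  interpret O: aw_twist a b w n opp "n - Suc s"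
    by (rule aw_twist_opp)
  show ?thesis
    using O.quadruple_t_0 [of "n - l" "n - k" "n - j" "n - i"] assms e
    by (intro quad'_t_opp) (simp_all add: Suc_opp diff_less_mono2)
qed

lemma tri_other: "i \<le> j \<Longrightarrow> j \<le> k \<Longrightarrow> k \<le> l \<Longrightarrow> l \<le> n \<Longrightarrow> i \<noteq> s \<Longrightarrow> j \<noteq> s \<Longrightarrow> k \<noteq> s \<Longrightarrow> l \<noteq> s \<Longrightarrow> tri t i j k l"
  using triple [of i j k l] by (simp add: tri_def bridge_def t_other)

lemma tri'_other: "i \<le> j \<Longrightarrow> j \<le> k \<Longrightarrow> k \<le> l \<Longrightarrow> l \<le> n \<Longrightarrow> i \<noteq> s \<Longrightarrow> j \<noteq> s \<Longrightarrow> k \<noteq> s \<Longrightarrow> l \<noteq> s \<Longrightarrow> tri' t i j k l"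
  using triple' [of i j k l] by (simp add: tri'_def bridge_def t_other)

lemma quad_other: "i \<le> j \<Longrightarrow> j \<le> k \<Longrightarrow> k \<le> l \<Longrightarrow> l \<le> p \<Longrightarrow> p \<le> n \<Longrightarrow>
    i \<noteq> s \<Longrightarrow> j \<noteq> s \<Longrightarrow> k \<noteq> s \<Longrightarrow> l \<noteq> s \<Longrightarrow> p \<noteq> s \<Longrightarrow> quad t i j k l p"
  using quadruple [of i j k l p] by (simp add: quad_def bridge_def t_other)

lemma quad'_other: "i \<le> j \<Longrightarrow> j \<le> k \<Longrightarrow> k \<le> l \<Longrightarrow> l \<le> p \<Longrightarrow> p \<le> n \<Longrightarrow>
    i \<noteq> s \<Longrightarrow> j \<noteq> s \<Longrightarrow> k \<noteq> s \<Longrightarrow> l \<noteq> s \<Longrightarrow> p \<noteq> s \<Longrightarrow> quad' t i j k l p"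
  using quadruple' [of i j k l p] by (simp add: quad'_def bridge'_def t_other)

lemma triple_t_3:
  assumes "i < j" "j < k" "k < s"
  shows "tri t i j k s"
proof (cases "k = e")
  case True
  then show ?thesis
    using assms triple_t_3_atomic by simp
next
  case False
  with assms have k: "k < e"
    by simp
  show ?thesis
  proof (rule T.tri_2_34_1)
    show "tri t i j k e" "tri' t i j k e"
      using assms k e by (auto intro!: tri_other tri'_other)
    show "tri t j k e s" "tri t i k e s" "tri t i j e s"
      using assms k by (auto intro!: triple_t_3_atomic)
    show "tri' t j k e s" "tri' t i k e s" "tri' t i j e s" "tri' t i j k s"
      using assms k by (auto intro!: triple'_t_3)
    show "quad t i j k e s" "quad' t i j k e s"
      using assms k by (auto intro!: quadruple_t_4 quadruple'_t_4)
  qed (use assms e in auto)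
qed

lemma triple'_t_0:
  assumes "s < j" "j < k" "k < l" "l \<le> n"
  shows "tri' t s j k l"
proof -
  interpret O: aw_twist a b w n opp "n - Suc s"
    by (rule aw_twist_opp)
  show ?thesis
    using O.triple_t_3 [of "n - l" "n - k" "n - j"] assms
    by (intro tri'_t_opp) (simp_all add: Suc_opp diff_less_mono2)
qed

lemma triple_t_1:
  assumes "i < s" "s < k" "k < l" "l \<le> n"
  shows "tri t i s k l"
proof (cases "k = Suc s")
  case True
  then show ?thesis
    using assms triple_t_1_atomic by simp
next
  case False
  with assms have k: "Suc s < k"
    by simp
  show ?thesis
  proof (rule T.tri_23_4_1)
    show "tri t i s (Suc s) k" "tri t i s (Suc s) l"
      using assms k by (auto intro!: triple_t_1_atomic)
    show "tri' t i s (Suc s) k" "tri' t i s k l" "tri' t i s (Suc s) l"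
      using assms k by (auto intro!: triple'_t_1)
    show "tri t s (Suc s) k l" "tri' t s (Suc s) k l"
      using assms k by (auto intro!: triple_t_0 triple'_t_0)
    show "tri t i (Suc s) k l" "tri' t i (Suc s) k l"
      using assms k by (auto intro!: tri_other tri'_other)
    show "quad t i s (Suc s) k l" "quad' t i s (Suc s) k l"
      using assms k by (auto intro!: quadruple_t_1 quadruple'_t_1)
  qed (use assms k in auto)
qed

lemma triple'_t_2:
  assumes "i < j" "j < s" "s < l" "l \<le> n"
  shows "tri' t i j s l"
proof -
  interpret O: aw_twist a b w n opp "n - Suc s"
    by (rule aw_twist_opp)
  show ?thesis
    using O.triple_t_1 [of "n - l" "n - j" "n - i"] assms
    by (intro tri'_t_opp) (simp_all add: Suc_opp diff_less_mono2)
qed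

text \<open>The hole from \<open>j\<close> to \<open>Suc s\<close> is cut at both \<open>e\<close>
  and \<open>s\<close>. \<open>bridge_assoc\<close> trades the cut at \<open>s\<close> for the one
  at \<open>e\<close>, and then \<open>s\<close> no longer occurs; \<open>quadruple_t_2\<close> does
  the same on the right with the cut at \<open>Suc s\<close>.\<close>

lemma quadruple_t_2_atomic':
  assumes "i < j" "j < s" "Suc s < p" "p \<le> n"
  shows "quad t i j s (Suc s) p"
proof (cases "j = e")
  case True
  then show ?thesis
    using assms quadruple_t_2_atomic by simp
next
  case False
  with assms have j: "j < e"
    by simp
  have "quad t i j s (Suc s) p \<longleftrightarrow> T.quad2 t i j e (Suc s) p"
  proof (rule T.bridge_assoc)
    have "quad t i j e s (Suc s)" "quad t i j e s p"
      using assms j by (auto intro!: quadruple_t_3)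
    then show "T.quad2 t i j e s (Suc s)" "T.quad2 t i j e s p"
      using assms j by (simp_all add: T.quad_iff_quad2)
    show "quad t j e s (Suc s) p" "quad t i e s (Suc s) p"
      using assms j by (auto intro!: quadruple_t_2_atomic)
  qed (use assms j in auto)
  moreover have "T.quad2 t i j e (Suc s) p"
  proof -
    have "quad t i j e (Suc s) p"
      using assms j by (intro quad_other) auto
    then show ?thesis
      using assms j by (simp add: T.quad_iff_quad2)
  qed
  ultimately show ?thesis
    by simp
qed

lemma quadruple_t_2:
  assumes "i < j" "j < s" "s < l" "l < p" "p \<le> n"
  shows "quad t i j s l p"
proof (cases "l = Suc s")
  case True
  then show ?thesis
    using assms quadruple_t_2_atomic' by simp
next
  case False
  with assms have l: "Suc s < l"
    by simp
  have "quad t i j (Suc s) l p \<longleftrightarrow> T.quad2 t i j s l p"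
  proof (rule T.bridge_assoc)
    have "quad t i j s (Suc s) l" "quad t i j s (Suc s) p"
      using assms l by (auto intro!: quadruple_t_2_atomic')
    then show "T.quad2 t i j s (Suc s) l" "T.quad2 t i j s (Suc s) p"
      using assms l by (simp_all add: T.quad_iff_quad2)
    show "quad t j s (Suc s) l p" "quad t i s (Suc s) l p"
      using assms l by (auto intro!: quadruple_t_1)
  qed (use assms l in auto)
  moreover have "quad t i j (Suc s) l p"
    using assms l by (intro quad_other) auto
  ultimately show ?thesis
    using assms by (simp add: T.quad_iff_quad2)
qed

lemma quadruple'_t_2:
  assumes "i < j" "j < s" "s < l" "l < p" "p \<le> n"
  shows "quad' t i j s l p"
proof -
  interpret O: aw_twist a b w n opp "n - Suc s"
    by (rule aw_twist_opp)
  show ?thesis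
    using O.quadruple_t_2 [of "n - p" "n - l" "n - j" "n - i"] assms
    by (intro quad'_t_opp) (simp_all add: Suc_opp diff_less_mono2)
qed

text \<open>The closure that permits iteration: whatever is proved for an arbitrary family now
  applies to \<open>t\<close>, including a further twist.\<close>

theorem aw_family_t: "aw_family a b w n t"
proof (rule aw_family_strictI)
  fix i j k l
  assume ord: "i < j" "j < k" "k < l" "l \<le> n"
  consider "i = s" | "j = s" | "k = s" | "l = s" | "i \<noteq> s \<and> j \<noteq> s \<and> k \<noteq> s \<and> l \<noteq> s"
    by blast
  then show "tri t i j k l"
  proof cases
    case 1
    then show ?thesis
      using ord triple_t_0 by simp
    next
    case 2
    then show ?thesis
      using ord triple_t_1 by simp
    next
    case 3
    then show ?thesis
      using ord triple_t_2 by simp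
    next
    case 4
    then show ?thesis
      using ord triple_t_3 by simp
    next
    case 5
    then show ?thesis
      using ord by (intro tri_other) auto
  qed
next
  fix i j k l
  assume ord: "i < j" "j < k" "k < l" "l \<le> n"
  consider "i = s" | "j = s" | "k = s" | "l = s" | "i \<noteq> s \<and> j \<noteq> s \<and> k \<noteq> s \<and> l \<noteq> s"
    by blast
  then show "tri' t i j k l"
  proof cases
    case 1
    then show ?thesis
      using ord triple'_t_0 by simp
    next
    case 2
    then show ?thesis
      using ord triple'_t_1 by simp
    next
    case 3
    then show ?thesis
      using ord triple'_t_2 by simp
    next
    case 4
    then show ?thesis
      using ord triple'_t_3 by simp
    next
    case 5
    then show ?thesis
      using ord by (intro tri'_other) auto
  qed
next
  fix i j k l p
  assume ord: "i < j" "j < k" "k < l" "l < p" "p \<le> n"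
  consider "i = s" | "j = s" | "k = s" | "l = s" | "p = s" | "i \<noteq> s \<and> j \<noteq> s \<and> k \<noteq> s \<and> l \<noteq> s \<and> p \<noteq> s"
    by blast
  then show "quad t i j k l p"
  proof cases
    case 1
    then show ?thesis
      using ord quadruple_t_0 by simp
    next
    case 2
    then show ?thesis
      using ord quadruple_t_1 by simp
    next
    case 3
    then show ?thesis
      using ord quadruple_t_2 by simp
    next
    case 4
    then show ?thesis
      using ord quadruple_t_3 by simp
    next
    case 5
    then show ?thesis
      using ord quadruple_t_4 by simp
    next
    case 6
    then show ?thesis
      using ord by (intro quad_other) auto
  qed
next
  fix i j k l p
  assume ord: "i < j" "j < k" "k < l" "l < p" "p \<le> n"
  consider "i = s" | "j = s" | "k = s" | "l = s" | "p = s" | "i \<noteq> s \<and> j \<noteq> s \<and> k \<noteq> s \<and> l \<noteq> s \<and> p \<noteq> s"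
    by blast
  then show "quad' t i j k l p"
  proof cases
    case 1
    then show ?thesis
      using ord quadruple'_t_0 by simp
    next
    case 2
    then show ?thesis
      using ord quadruple'_t_1 by simp
    next
    case 3
    then show ?thesis
      using ord quadruple'_t_2 by simp
    next
    case 4
    then show ?thesis
      using ord quadruple'_t_3 by simp
    next
    case 5
    then show ?thesis
      using ord quadruple'_t_4 by simp
    next
    case 6
    then show ?thesis
      using ord by (intro quad'_other) auto
  qed
next
  show "com (t i j) (t k l)" if "i < j" "j \<le> k" "k < l" "l \<le> n" for i j k l
    using that by (intro T.disjoint) auto
  show "com (t j k) (t i l)" if "i \<le> j" "j < k" "k \<le> l" "l \<le> n" for i j k l
    using that by (intro T.nested) auto
qed (rule T.unit)

end

section \<open>Arbitrary sets\<close>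

context qbracket
begin

text \<open>The recursion for C in cut points: the list alternates between left and right ends of
  components, and the first hole, from \<open>k\<close> to \<open>l\<close>, is resolved. Lists of
  even length encode sets; the value at a single point is a mere default.\<close>

fun E :: "(nat \<Rightarrow> nat \<Rightarrow> 'a) \<Rightarrow> nat list \<Rightarrow> 'a"
  where
    "E c [] = 1"
  | "E c [i] = 1"
  | "E c [i, k] = c i k"
  | "E c (i # k # l # r) = c i k * E c (l # r) + c k l * E c (i # r) - qb (c i l) (E c (k # r))"

lemma E_bridge: "E c [i, j, k, l] = bridge c i j k l"
  by (simp add: bridge_def)

lemma qb_mult_right: "com x z \<Longrightarrow> qb x (y * z) = qb x y * z"
  by (simp add: qb_def com_sw left_diff_distrib mult.assoc)

text \<open>Resolving one hole further left and one further right may be done in either order when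
  the outer factors commute. Both \<open>E_split_hole\<close> and \<open>E_split\<close> rest on
  this.\<close>

lemma split_step:
  assumes "com u M" "com u P" "com x M" "com y M" and z: "com z u" "com z x" "com z y"
  shows "x * (A3 * P + z * B3 - qb F3 M) + y * (A1 * P + z * B1 - qb F1 M) - qb u (A2 * P + z * B2 - qb F2 M) =
    (x * A3 + y * A1 - qb u A2) * P + z * (x * B3 + y * B1 - qb u B2) - qb (x * F3 + y * F1 - qb u F2) M"
  using assms(1-4)
  by (simp add: qb_lin qb_scale_left qb_scale_right [OF z(1)] qb_assoc qb_mult_right
      com_sw2 [OF z(2)] com_sw2 [OF z(3)] algebra_simps)

lemma cut_list_induct [case_names Nil single pair step]:
  fixes P :: "nat list \<Rightarrow> bool"
  assumes "P []" "\<And>i. P [i]" "\<And>i k. P [i, k]"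
    and "\<And>i k l r. P (l # r) \<Longrightarrow> P (i # r) \<Longrightarrow> P (k # r) \<Longrightarrow> P (i # k # l # r)"
  shows "P L"
  by (rule E.induct [of "\<lambda>_ L. P L"]) (rule assms; assumption)+

end

context com_family
begin

text \<open>No cut point lies strictly inside the interval, so it is disjoint from or nested with
  every interval that the recursion produces.\<close>

lemma com_c_E_outside:
  assumes "sorted L" "set L \<subseteq> {..n}" "i \<le> k" "k \<le> n"
    and "\<forall>m\<in>set L. m \<le> i \<or> k \<le> m"
  shows "com (c i k) (E c L)"
  using assms
proof (induction L rule: cut_list_induct)
  case (pair x y)
  then have "x \<le> y" "y \<le> n" "x \<le> i \<or> k \<le> x" "y \<le> i \<or> k \<le> y"
    by simp_all
  with pair(3,4) show ?case
    by (simp, intro com_intervals; linarith)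
next
  case (step x y z r)
  have "com (c i k) (E c (z # r))" "com (c i k) (E c (x # r))" "com (c i k) (E c (y # r))"
    using step.prems by (auto intro!: step.IH)
  moreover have "com (c i k) (c x y)" "com (c i k) (c y z)" "com (c i k) (c x z)"
  proof -
    have "x \<le> y" "y \<le> z" "z \<le> n" "x \<le> i \<or> k \<le> x" "y \<le> i \<or> k \<le> y" "z \<le> i \<or> k \<le> z"
      using step.prems by simp_all
    with step.prems(3,4) show "com (c i k) (c x y)" "com (c i k) (c y z)" "com (c i k) (c x z)"
      by (intro com_intervals; linarith)+
  qed
  ultimately show ?case
    by simp
qed simp_all

text \<open>Independence of the recursion from the hole at which it splits: here the hole from
  \<open>m\<close> to \<open>p\<close> takes the place of the first one. The induction is on the
  components to its left.\<close>

lemma E_split_hole: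
  assumes "odd (length X)" "sorted (X @ m # p # r)" "set (X @ m # p # r) \<subseteq> {..n}" "r \<noteq> []"
  shows "E c (X @ m # p # r) = E c (X @ [m]) * E c (p # r) + c m p * E c (X @ r) - qb (E c (X @ [p])) (E c (m # r))"
  using assms(1-3)
proof (induction X rule: cut_list_induct)
  case (single i)
  obtain r1 r2 where "r = r1 # r2"
    using \<open>r \<noteq> []\<close> by (cases r) auto
  then show ?case
    by simp
next
  case (step i k l X)
  have com: "com (c i l) (E c (m # r))" "com (c i l) (E c (p # r))" "com (c i k) (E c (m # r))" "com (c k l) (E c (m # r))"
    using step.prems by (intro com_c_E_outside; auto simp: sorted_append)+
  have com': "com (c m p) (c i l)" "com (c m p) (c i k)" "com (c m p) (c k l)"
  proof -
    have "i \<le> k" "k \<le> l" "l \<le> m" "m \<le> p" "p \<le> n"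
      using step.prems by (auto simp: sorted_append)
    then show "com (c m p) (c i l)" "com (c m p) (c i k)" "com (c m p) (c k l)"
      by (intro com_intervals; linarith)+
  qed
  have IH: "E c (l # X @ m # p # r) = E c (l # X @ [m]) * E c (p # r) + c m p * E c (l # X @ r) - qb (E c (l # X @ [p])) (E c (m # r))"
    "E c (i # X @ m # p # r) = E c (i # X @ [m]) * E c (p # r) + c m p * E c (i # X @ r) - qb (E c (i # X @ [p])) (E c (m # r))"
    "E c (k # X @ m # p # r) = E c (k # X @ [m]) * E c (p # r) + c m p * E c (k # X @ r) - qb (E c (k # X @ [p])) (E c (m # r))"
    using step.IH(1) step.IH(2) step.IH(3) step.prems by simp_all
  have "E c (i # k # l # X @ m # p # r) =
      c i k * E c (l # X @ m # p # r) + c k l * E c (i # X @ m # p # r) - qb (c i l) (E c (k # X @ m # p # r))"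
    by simp
  also have "\<dots> = (c i k * E c (l # X @ [m]) + c k l * E c (i # X @ [m]) - qb (c i l) (E c (k # X @ [m]))) * E c (p # r)
    + c m p * (c i k * E c (l # X @ r) + c k l * E c (i # X @ r) - qb (c i l) (E c (k # X @ r)))
    - qb (c i k * E c (l # X @ [p]) + c k l * E c (i # X @ [p]) - qb (c i l) (E c (k # X @ [p]))) (E c (m # r))"
    unfolding IH using com com' by (rule split_step)
  finally show ?case
    by simp
qed simp_all

end

context aw_family
begin

text \<open>\<open>quad2\<close> with further components to the right, which
  \<open>E_split_hole\<close> peels off one at a time.\<close>

lemma E_split:
  assumes "even (length r)" "i \<le> j" "j \<le> k" "k \<le> l" "sorted (l # m # r)" "set (l # m # r) \<subseteq> {..n}"
  shows "E c (i # j # l # m # r) = c i j * E c (l # m # r) + c j k * E c (i # k # l # m # r)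
    - qb (c i k) (E c (j # k # l # m # r))"
  using assms(1,5,6)
proof (induction "m # r" arbitrary: m r rule: cut_list_induct)
  case (single m)
  then show ?case
    using quadruple [of i j k l m] assms by (simp add: E_bridge quad_iff_quad2 quad2_def del: E.simps(4))
next
  case (pair m p)
  then show ?case by simp
next
  case (step m p x r)
  have base: "E c [i, j, l, y] = c i j * E c [l, y] + c j k * E c [i, k, l, y] - qb (c i k) (E c [j, k, l, y])"
    if "l \<le> y" "y \<le> n" for y
    using quadruple [of i j k l y] assms that by (simp add: E_bridge quad_iff_quad2 quad2_def del: E.simps(4))
  have IH: "E c (i # j # l # x # r) = c i j * E c (l # x # r) + c j k * E c (i # k # l # x # r)
    - qb (c i k) (E c (j # k # l # x # r))"
    using step by simp
  have sp: "E c (X @ m # p # x # r) = E c (X @ [m]) * E c (p # x # r) + c m p * E c (X @ x # r)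
      - qb (E c (X @ [p])) (E c (m # x # r))" if "X \<in> {[i, j, l], [l], [i, k, l], [j, k, l]}" for X
  proof -
    have "set r \<subseteq> {l..n}" "l \<le> m" "l \<le> p" "l \<le> x" "sorted (m # p # x # r)" "set (m # p # x # r) \<subseteq> {..n}"
      using step.prems by auto
    then show ?thesis
      using that step.prems(1) assms(2-4) by (intro E_split_hole) (fastforce simp: sorted_append)+
  qed
  have ord: "l \<le> m" "m \<le> p" "p \<le> x" "p \<le> n"
    using step.prems by auto
  have com: "com (c i k) (E c (p # x # r))" "com (c i k) (E c (m # x # r))" "com (c i j) (E c (m # x # r))"
    "com (c j k) (E c (m # x # r))"
    using step.prems assms ord by (intro com_c_E_outside; auto)+
  have com': "com (c m p) (c i k)" "com (c m p) (c i j)" "com (c m p) (c j k)"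
    using step.prems assms ord by (intro com_intervals; auto)+
  have "E c (i # j # l # m # p # x # r) = E c [i, j, l, m] * E c (p # x # r) + c m p * E c (i # j # l # x # r)
      - qb (E c [i, j, l, p]) (E c (m # x # r))"
    using sp [of "[i, j, l]"] by (simp del: E.simps)
  also have "\<dots> = c i j * (E c [l, m] * E c (p # x # r) + c m p * E c (l # x # r) - qb (E c [l, p]) (E c (m # x # r)))
      + c j k * (E c [i, k, l, m] * E c (p # x # r) + c m p * E c (i # k # l # x # r) - qb (E c [i, k, l, p]) (E c (m # x # r)))
      - qb (c i k) (E c [j, k, l, m] * E c (p # x # r) + c m p * E c (j # k # l # x # r) - qb (E c [j, k, l, p]) (E c (m # x # r)))"
    unfolding IH base [OF ord(1) order_trans [OF ord(2,4)]] base [OF order_trans [OF ord(1,2)] ord(4)]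
    by (rule split_step [OF com(2,1,3,4) com', symmetric])
  also have "\<dots> = c i j * E c (l # m # p # x # r) + c j k * E c (i # k # l # m # p # x # r)
      - qb (c i k) (E c (j # k # l # m # p # x # r))"
    using sp [of "[l]"] sp [of "[i, k, l]"] sp [of "[j, k, l]"] by (simp del: E.simps)
  finally show ?case .
qed

text \<open>A repeated cut point is an empty component or an empty hole. Only an empty component
  behind another one needs the relations of the family; there the claim is \<open>E_split\<close>
  read backwards.\<close>

lemma E_remove_dup:
  assumes "even (length pre + length post)" "sorted (pre @ k # k # post)" "set (pre @ k # k # post) \<subseteq> {..n}"
  shows "E c (pre @ k # k # post) = E c (pre @ post)"
  using assms
proof (induction pre rule: cut_list_induct)
  case Nil
  show ?case
  proof (cases post)
    case Nil
    then show ?thesis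
      using Nil.prems by (simp add: unit)
  next
    case (Cons l r)
    moreover obtain r1 r2 where "r = r1 # r2"
      using Nil.prems Cons by (cases r) auto
    moreover have "com (c k l) (E c (k # r))"
      using Nil.prems Cons by (intro com_c_E_outside) auto
    ultimately show ?thesis
      using Nil.prems by (simp add: unit qb_com)
  qed
next
  case (single i)
  then obtain l r where "post = l # r"
    by (cases post) auto
  moreover have "com (c i k) (E c (k # post))"
    using single.prems by (intro com_c_E_outside) auto
  ultimately show ?case
    using single.prems by (simp add: unit qb_com)
next
  case (pair i j)
  show ?case
  proof (cases post)
    case Nil
    then show ?thesis
      using pair.prems bridge_degenerate(5) [of i j k] by (simp add: E_bridge del: E.simps(4))
  next
    case (Cons l r')
    then obtain m r where post: "post = l # m # r" "even (length r)"
      using pair.prems by (cases r') auto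
    have "com (c k l) (E c (k # m # r))"
      using pair.prems post by (intro com_c_E_outside) auto
    then have "E c (k # k # l # m # r) = E c (l # m # r)"
      using pair.prems post by (simp add: unit qb_com)
    then have "E c (i # j # k # k # l # m # r) = c i j * E c (l # m # r) + c j k * E c (i # k # l # m # r)
        - qb (c i k) (E c (j # k # l # m # r))"
      by (subst E.simps(4)) simp
    also have "\<dots> = E c (i # j # l # m # r)"
      using pair.prems post by (intro E_split [symmetric]) auto
    finally show ?thesis
      by (simp add: post)
  qed
next
  case (step i j l pre)
  have "E c (l # pre @ k # k # post) = E c (l # pre @ post)" "E c (i # pre @ k # k # post) = E c (i # pre @ post)"
    "E c (j # pre @ k # k # post) = E c (j # pre @ post)"
    using step by auto
  then show ?case
    by simp
qed

end

context aw_twist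
begin

lemma E_t_other: "s \<notin> set L \<Longrightarrow> E t L = E c L"
  by (induction L rule: cut_list_induct) (simp_all add: t_other)

lemma E_t_four: "Suc s \<le> m \<Longrightarrow> E t [s, m] = E c [e, s, Suc s, m]"
  by (simp add: E_bridge t_right_bridge del: E.simps(4))

text \<open>One component precedes the one starting at \<open>s\<close>. The quadruple relation of
  the twisted family, in the form \<open>quad2\<close>, cuts the hole at \<open>e\<close>, and
  \<open>R0\<close> evaluates the two bridges that arise.\<close>

lemma E_t_six:
  assumes "i \<le> k" "k \<le> e" "Suc s \<le> m" "m \<le> n"
  shows "E t [i, k, s, m] = E c [i, k, e, s, Suc s, m]"
proof -
  interpret TF: aw_family a b w n t
    by (rule aw_family_t)
  have ord: "i \<le> e" "e \<le> s" "s \<le> Suc s" "Suc s \<le> m" "m \<le> n"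
    using assms by simp_all
  interpret A: aw4 a b w "c i e" "c e s" "c s (Suc s)" "c (Suc s) m" "c i m"
      "c i s" "c e (Suc s)" "c s m" "c i (Suc s)" "c e m"
    by (rule aw4_intervals [OF ord])
  have "t e s = cy" "t i s = A.D13" "t s m = A.C24"
    using assms ord by (simp_all add: t_left_bridge t_right_bridge bridge_degenerate aw_core_letters [OF ord])
  then have 1: "bridge t i e s m = bridge c i s (Suc s) m"
    using assms by (simp add: bridge_def [of t] t_other A.R0 aw_core_letters(7) [OF ord])
  have "quad t i k e s m"
    using assms by (intro TF.quadruple) auto
  then have "bridge t i k s m = t i k * t s m + t k e * bridge t i e s m - qb (t i e) (bridge t k e s m)"
    using assms by (simp add: T.quad_iff_quad2 T.quad2_def)
  moreover have "bridge t k e s m = bridge c k s (Suc s) m"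
  proof -
    have ord: "k \<le> e" "e \<le> s" "s \<le> Suc s" "Suc s \<le> m" "m \<le> n"
      using assms by simp_all
    interpret B: aw4 a b w "c k e" "c e s" "c s (Suc s)" "c (Suc s) m" "c k m"
        "c k s" "c e (Suc s)" "c s m" "c k (Suc s)" "c e m"
      by (rule aw4_intervals [OF ord])
    have "t e s = cy" "t k s = B.D13" "t s m = B.C24"
      using assms ord by (simp_all add: t_left_bridge t_right_bridge bridge_degenerate aw_core_letters [OF ord])
    then show ?thesis
      using assms by (simp add: bridge_def [of t] t_other B.R0 aw_core_letters(7) [OF ord])
  qed
  moreover have "E c [i, k, e, s, Suc s, m] = c i k * bridge c e s (Suc s) m + c k e * bridge c i s (Suc s) m
      - qb (c i e) (bridge c k s (Suc s) m)"
    by (simp add: bridge_def)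
  ultimately show ?thesis
    using assms by (simp add: E_bridge 1 t_other t_right_bridge del: E.simps(4))
qed

lemma E_t_last:
  assumes "even (length pre)" "sorted pre" "\<forall>x\<in>set pre. x \<le> e" "Suc s \<le> m" "m \<le> n"
  shows "E t (pre @ [s, m]) = E c (pre @ [e, s, Suc s, m])"
  using assms
proof (induction pre rule: cut_list_induct)
  case Nil
  then show ?case
    using E_t_four by simp
next
  case (pair i k)
  then show ?case
    using E_t_six [of i k m] by (simp del: E.simps(4))
next
  case (step i k l pre)
  then show ?case
    by (simp add: t_other)
qed simp_all

text \<open>In terms of sets, a component beginning with \<open>Suc s\<close> gives this element up
  for \<open>s\<close>. The holes further right are split off by \<open>E_split_hole\<close>; the
  split-off factors no longer contain \<open>s\<close>, and \<open>E_t_last\<close> remains.\<close>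

theorem E_t:
  assumes "even (length pre)" "sorted (pre @ s # m # post)" "set (pre @ s # m # post) \<subseteq> {..n}"
    and "\<forall>x\<in>set pre. x \<le> e" "Suc s \<le> m" "even (length post)"
  shows "E t (pre @ s # m # post) = E c (pre @ [e, s, Suc s, m] @ post)"
  using assms(2,3,5,6)
proof (induction post arbitrary: m rule: length_induct)
  case (1 post)
  show ?case
  proof (cases post)
    case Nil
    then show ?thesis
      using 1 assms E_t_last [of pre m] by (simp add: sorted_append)
  next
    case (Cons p r)
    then have "r \<noteq> []"
      using "1.prems" by auto
    then obtain x r' where r: "r = x # r'"
      by (cases r) auto
    have notin: "s \<notin> set (m # post)"
      using "1.prems" by (auto simp: sorted_append)
    have prem: "sorted (pre @ s # x # r')" "set (pre @ s # x # r') \<subseteq> {..n}" "Suc s \<le> x" "even (length r')"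
      "sorted pre" "p \<le> n" "m \<le> p"
      using "1.prems" Cons r by (auto simp: sorted_append)
    have IH: "E t (pre @ s # r) = E c (pre @ [e, s, Suc s] @ r)"
      using 1(1) [rule_format, of r' x] prem Cons r by simp
    have "E t ((pre @ [s]) @ m # p # r) =
        E t ((pre @ [s]) @ [m]) * E t (p # r) + t m p * E t ((pre @ [s]) @ r) - qb (E t ((pre @ [s]) @ [p])) (E t (m # r))"
      using 1 assms(1) Cons \<open>r \<noteq> []\<close> by (intro T.E_split_hole) (simp_all add: sorted_append)
    also have "\<dots> = E c ((pre @ [e, s, Suc s]) @ [m]) * E c (p # r) + c m p * E c ((pre @ [e, s, Suc s]) @ r)
        - qb (E c ((pre @ [e, s, Suc s]) @ [p])) (E c (m # r))"
      using notin Cons E_t_last [OF assms(1) \<open>sorted pre\<close> assms(4), of m]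
        E_t_last [OF assms(1) \<open>sorted pre\<close> assms(4), of p] 1 prem IH
      by (simp add: E_t_other t_other)
    also have "\<dots> = E c ((pre @ [e, s, Suc s]) @ m # p # r)"
      using 1 assms(1,4) Cons \<open>r \<noteq> []\<close> e by (intro E_split_hole [symmetric]) (auto simp: sorted_append le_Suc_eq)
    finally show ?thesis
      using Cons by simp
  qed
qed

end

section \<open>Subsets encoded by the places where membership changes\<close>

definition cuts :: "nat \<Rightarrow> nat set \<Rightarrow> nat list"
  where "cuts N S = filter (\<lambda>k. (k \<in> S) \<noteq> (Suc k \<in> S)) [0..<Suc N]"

text \<open>Membership in the set encoded by a list, as a parity. In this form it also makes sense
  for lists with repetitions, where equal cut points cancel in pairs.\<close>

definition odd_below :: "nat list \<Rightarrow> nat \<Rightarrow> bool"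
  where "odd_below L x \<longleftrightarrow> odd (length (filter (\<lambda>y. y < x) L))"

lemma odd_below_simps [simp]:
  "odd_below [] x \<longleftrightarrow> False"
  "odd_below (y # ys) x \<longleftrightarrow> (y < x) \<noteq> odd_below ys x"
  "odd_below (xs @ ys) x \<longleftrightarrow> odd_below xs x \<noteq> odd_below ys x"
  by (auto simp: odd_below_def)

lemma odd_below_top: "set L \<subseteq> {..<x} \<Longrightarrow> odd_below L x \<longleftrightarrow> odd (length L)"
  by (induction L) auto

lemma odd_below_bot: "\<forall>y\<in>set L. x \<le> y \<Longrightarrow> \<not> odd_below L x"
  by (induction L) auto

lemma cuts_props: "sorted (cuts N S)" "distinct (cuts N S)" "set (cuts N S) \<subseteq> {..N}"
proof -
  show "sorted (cuts N S)" "distinct (cuts N S)"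
    unfolding cuts_def by (intro sorted_wrt_filter sorted_upt distinct_filter distinct_upt)+
  show "set (cuts N S) \<subseteq> {..N}"
    by (simp add: cuts_def less_Suc_eq_le subset_iff del: upt_Suc)
qed

lemma set_cuts: "k \<le> N \<Longrightarrow> k \<in> set (cuts N S) \<longleftrightarrow> (k \<in> S) \<noteq> (Suc k \<in> S)"
  by (simp add: cuts_def less_Suc_eq_le del: upt_Suc)

text \<open>Every cut point flips membership, and 0 lies outside \<open>S\<close>.\<close>

lemma odd_below_cuts:
  assumes "S \<subseteq> {1..N}"
  shows "odd_below (cuts N S) x \<longleftrightarrow> x \<in> S"
proof -
  have *: "odd (length (filter (\<lambda>k. (k \<in> S) \<noteq> (Suc k \<in> S)) [0..<y])) \<longleftrightarrow> y \<in> S" for y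
  proof (induction y)
    case 0
    then show ?case
      using assms by auto
  next
    case (Suc y)
    then show ?case
      by (cases "y \<in> S"; cases "Suc y \<in> S") simp_all
  qed
  have "filter (\<lambda>y. y < x) [0..<k] = [0..<min x k]" for k
  proof (induction k)
    case (Suc k)
    then show ?case
      by (cases "x \<le> k"; cases "x = Suc k") (auto simp: min_def)
  qed simp
  then have "filter (\<lambda>y. y < x) (cuts N S) = filter (\<lambda>k. (k \<in> S) \<noteq> (Suc k \<in> S)) [0..<min x (Suc N)]"
    unfolding cuts_def by (subst filter_filter, subst conj_commute, subst filter_filter [symmetric]) simp
  then have "odd_below (cuts N S) x \<longleftrightarrow> min x (Suc N) \<in> S"
    unfolding odd_below_def using * by metis
  then show ?thesis
    using assms by (auto simp: min_def split: if_splits)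
qed

lemma even_length_cuts: "S \<subseteq> {1..N} \<Longrightarrow> even (length (cuts N S))"
  using odd_below_cuts [of S N "Suc N"] odd_below_top [of "cuts N S" "Suc N"] cuts_props(3) [of N S]
  by (auto simp: lessThan_Suc_atMost)

lemma count_list_distinct: "distinct L \<Longrightarrow> count_list L k = (if k \<in> set L then 1 else 0)"
  by (induction L) auto

lemma odd_below_Suc: "odd_below L (Suc k) \<longleftrightarrow> odd_below L k \<noteq> odd (count_list L k)"
  by (induction L) (auto simp: less_Suc_eq)

lemma sorted_not_distinct:
  assumes "sorted L" "\<not> distinct L"
  obtains pre k post where "L = pre @ k # k # post"
proof -
  obtain xs y ys zs where L: "L = xs @ [y] @ ys @ [y] @ zs"
    using not_distinct_decomp [OF assms(2)] by blast
  show thesis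
  proof (cases ys)
    case Nil
    then show thesis
      using L that [of xs y zs] by simp
  next
    case (Cons y' ys')
    then have "y' = y"
      using assms(1) L by (auto simp: sorted_append intro: antisym)
    then show thesis
      using L Cons that [of xs y "ys' @ [y] @ zs"] by simp
  qed
qed

definition (in qbracket) CS :: "nat \<Rightarrow> (nat \<Rightarrow> nat \<Rightarrow> 'a) \<Rightarrow> nat set \<Rightarrow> 'a"
  where "CS N f S = E f (cuts N S)"

context aw_family
begin

text \<open>Cancelling a repeated pair changes neither the parities nor, by
  \<open>E_remove_dup\<close>, the value. The process ends at a list without repetitions, which must
  be \<open>cuts n S\<close>.\<close>

lemma CS_eqI:
  assumes "sorted L" "even (length L)" "set L \<subseteq> {..n}" "\<And>x. x \<in> S \<longleftrightarrow> odd_below L x"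
  shows "CS n c S = E c L"
  using assms
proof (induction L rule: length_induct)
  case (1 L)
  show ?case
  proof (cases "distinct L")
    case True
    have "k \<in> set L \<longleftrightarrow> k \<le> n \<and> (k \<in> S) \<noteq> (Suc k \<in> S)" for k
    proof -
      have "Suc k \<in> S \<longleftrightarrow> (k \<in> S) \<noteq> (k \<in> set L)"
        unfolding "1.prems"(4) odd_below_Suc using count_list_distinct [OF True, of k] by simp
      moreover have "k \<in> set L \<Longrightarrow> k \<le> n"
        using "1.prems"(3) by auto
      ultimately show ?thesis
        by blast
    qed
    then have "set L = set (cuts n S)"
      by (simp add: cuts_def set_eq_iff less_Suc_eq_le del: upt_Suc)
    then have "L = cuts n S"
      using True cuts_props "1.prems"(1) by (intro sorted_distinct_set_unique) auto
    then show ?thesis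
      by (simp add: CS_def)
  next
    case False
    then obtain pre k post where L: "L = pre @ k # k # post"
      using sorted_not_distinct "1.prems"(1) by blast
    have "CS n c S = E c (pre @ post)"
      using "1.prems" L by (intro "1.IH" [rule_format]) (auto simp: sorted_append)
    also have "\<dots> = E c L"
      unfolding L using "1.prems" L by (intro E_remove_dup [symmetric]) auto
    finally show ?thesis .
  qed
qed

lemma CS_interval:
  assumes "\<And>x. x \<in> S \<longleftrightarrow> p < x \<and> x \<le> v" "p \<le> v" "v \<le> n"
  shows "CS n c S = c p v"
proof -
  have "x \<in> S \<longleftrightarrow> odd_below [p, v] x" for x
    unfolding assms(1) odd_below_simps using assms(2) by (cases "p < x"; cases "v < x"; simp)
  then have "CS n c S = E c [p, v]"
    using assms(2,3) by (intro CS_eqI) simp_all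
  then show ?thesis
    by simp
qed

lemma CS_gap:
  assumes "\<And>x. x \<in> S \<longleftrightarrow> p < x \<and> x \<le> v \<or> r < x \<and> x \<le> u" "p \<le> v" "v \<le> r" "r \<le> u" "u \<le> n"
  shows "CS n c S = bridge c p v r u"
proof -
  have "x \<in> S \<longleftrightarrow> odd_below [p, v, r, u] x" for x
    unfolding assms(1) odd_below_simps using assms(2-4)
    by (cases "p < x"; cases "v < x"; cases "r < x"; cases "u < x"; simp)
  then have "CS n c S = E c [p, v, r, u]"
    using assms(2-5) by (intro CS_eqI) simp_all
  then show ?thesis
    by (simp only: E_bridge)
qed

lemma CS_empty: "CS n c {} = 1"
proof -
  have "CS n c {} = c 0 0"
    by (rule CS_interval) auto
  then show ?thesis
    by (simp add: unit)
qed

end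

lemma transpose_image_subset:
  assumes "X \<subseteq> {1..N}" "0 < i" "Suc i \<le> N"
  shows "transpose i (Suc i) ` X \<subseteq> {1..N}"
proof
  fix x assume "x \<in> transpose i (Suc i) ` X"
  then obtain y where "y \<in> X" "x = transpose i (Suc i) y"
    by blast
  then show "x \<in> {1..N}"
    using assms by (cases "y = i"; cases "y = Suc i") (auto simp: transpose_def)
qed

lemma in_transpose_image: "x \<in> transpose i j ` S \<longleftrightarrow> transpose i j x \<in> S"
  by (auto intro: image_eqI [where x = "transpose i j x"])

context aw_twist
begin

lemma CS_t_same: "(s \<in> S \<longleftrightarrow> Suc s \<in> S) \<Longrightarrow> CS n t S = CS n c S"
  using e by (simp add: CS_def E_t_other set_cuts)

text \<open>As \<open>s\<close> is outside and \<open>Suc s\<close> inside, a component starts at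
  the cut point \<open>s\<close>, which is the situation of \<open>E_t\<close>. In the opposite case
  the twist would bring in reversed letters.\<close>

lemma CS_t_swap:
  assumes "s \<notin> S" "Suc s \<in> S" "S \<subseteq> {1..n}"
  shows "CS n t S = CS n c (transpose s (Suc s) ` S)"
proof -
  have "s \<in> set (cuts n S)"
    using assms e by (simp add: set_cuts)
  then obtain pre rest where L: "cuts n S = pre @ s # rest"
    by (auto dest: split_list)
  have ord: "sorted (pre @ s # rest)" "distinct (pre @ s # rest)" "set (pre @ s # rest) \<subseteq> {..n}"
    using cuts_props [of n S] by (simp_all add: L)
  have pre: "\<forall>x\<in>set pre. x \<le> e"
  proof
    fix x assume "x \<in> set pre"
    with ord show "x \<le> e"
      by (cases "x = s") (auto simp: sorted_append le_Suc_eq)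
  qed
  have rest: "\<forall>x\<in>set rest. Suc s \<le> x"
  proof
    fix x assume "x \<in> set rest"
    with ord show "Suc s \<le> x"
      by (cases "x = s") (auto simp: sorted_append Suc_le_eq)
  qed
  have "odd_below pre s \<longleftrightarrow> odd (length pre)"
    using pre by (intro odd_below_top) auto
  moreover have "\<not> odd_below rest s"
    using rest by (intro odd_below_bot) auto
  ultimately have "even (length pre)"
    using odd_below_cuts [OF assms(3), of s] assms(1) by (simp add: L)
  moreover have "even (length (pre @ s # rest))"
    using even_length_cuts [OF assms(3)] by (simp add: L)
  ultimately obtain m post where m: "rest = m # post" and par: "even (length pre)" "even (length post)"
    by (cases rest) auto
  have "CS n t S = E t (pre @ s # m # post)"
    by (simp add: CS_def L m)
  also have "\<dots> = E c (pre @ [e, s, Suc s, m] @ post)"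
    using ord pre rest par by (intro E_t) (auto simp: m)
  \<comment> \<open>The new list has repetitions if \<open>e\<close> was a cut point already or if
    \<open>m = Suc s\<close>, hence the use of \<open>CS_eqI\<close>.\<close>
  also have "\<dots> = CS n c (transpose s (Suc s) ` S)"
  proof (rule CS_eqI [symmetric])
    show "sorted (pre @ [e, s, Suc s, m] @ post)"
    proof -
      have "\<forall>x\<in>set (m # post). Suc s \<le> x"
        using rest m by simp
      then show ?thesis
        using ord(1) pre unfolding m sorted_append sorted_simps by (auto dest: Suc_leD)
    qed
    show "set (pre @ [e, s, Suc s, m] @ post) \<subseteq> {..n}"
      using ord e by (simp add: m)
    show "x \<in> transpose s (Suc s) ` S \<longleftrightarrow> odd_below (pre @ [e, s, Suc s, m] @ post) x" for x
    proof -
      have "x \<in> transpose s (Suc s) ` S \<longleftrightarrow> transpose s (Suc s) x \<in> S"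
        by (rule in_transpose_image)
      moreover have "x \<in> S \<longleftrightarrow> odd_below (pre @ s # m # post) x"
        using odd_below_cuts [OF assms(3), of x] by (simp add: L m)
      ultimately show ?thesis
        using assms(1,2) by (cases "x = s"; cases "x = Suc s") (auto simp: transpose_def)
    qed
  qed (use par in simp)
  finally show ?thesis .
qed

end

text \<open>Besides the relations \<open>aw4\<close> this demands that the holed letters, which
  \<open>aw4\<close> builds from the other letters, are the elements attached to the corresponding
  unions. Only values of \<open>CS\<close> occur, so the statement can be carried along a
  twist.\<close>

definition (in qbracket) four_sets :: "nat \<Rightarrow> (nat \<Rightarrow> nat \<Rightarrow> 'a) \<Rightarrow> nat set \<Rightarrow> nat set \<Rightarrow> nat set \<Rightarrow> nat set \<Rightarrow> bool"
  where "four_sets N f A B C D \<longleftrightarrow>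
    aw4 a b w (CS N f A) (CS N f B) (CS N f C) (CS N f D) (CS N f (A \<union> B \<union> C \<union> D))
      (CS N f (A \<union> B)) (CS N f (B \<union> C)) (CS N f (C \<union> D)) (CS N f (A \<union> B \<union> C)) (CS N f (B \<union> C \<union> D))
    \<and> aw_core.C13 a b (CS N f A) (CS N f B) (CS N f C) (CS N f (A \<union> B)) (CS N f (B \<union> C)) (CS N f (A \<union> B \<union> C)) = CS N f (A \<union> C)
    \<and> aw_core.C24 a b (CS N f B) (CS N f C) (CS N f D) (CS N f (B \<union> C)) (CS N f (C \<union> D)) (CS N f (B \<union> C \<union> D)) = CS N f (B \<union> D)
    \<and> aw_core.C14 a b (CS N f A) (CS N f D) (CS N f (A \<union> B \<union> C \<union> D)) (CS N f (B \<union> C)) (CS N f (A \<union> B \<union> C)) (CS N f (B \<union> C \<union> D)) = CS N f (A \<union> D)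
    \<and> aw_core.C124 a b (CS N f C) (CS N f D) (CS N f (A \<union> B \<union> C \<union> D)) (CS N f (A \<union> B)) (CS N f (C \<union> D)) (CS N f (A \<union> B \<union> C)) = CS N f (A \<union> B \<union> D)
    \<and> aw_core.C134 a b (CS N f A) (CS N f B) (CS N f (A \<union> B \<union> C \<union> D)) (CS N f (A \<union> B)) (CS N f (C \<union> D)) (CS N f (B \<union> C \<union> D)) = CS N f (A \<union> C \<union> D)"

definition ordered4 :: "nat set \<Rightarrow> nat set \<Rightarrow> nat set \<Rightarrow> nat set \<Rightarrow> bool"
  where "ordered4 A B C D \<longleftrightarrow> set_less A B \<and> set_less A C \<and> set_less A D \<and> set_less B C \<and> set_less B D \<and> set_less C D"

lemma up_closed_interval:
  assumes "X \<subseteq> {..m}" "\<And>j. j \<in> X \<Longrightarrow> Suc j \<le> m \<Longrightarrow> Suc j \<in> X"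
  obtains p :: nat where "p \<le> m" "\<And>x. x \<in> X \<longleftrightarrow> p < x \<and> x \<le> m" | "0 \<in> X"
proof (cases "X = {}")
  case True
  then show thesis
    using that(1) [of m] by auto
next
  case False
  define l where "l = (LEAST x. x \<in> X)"
  have l: "l \<in> X" "\<And>x. x \<in> X \<Longrightarrow> l \<le> x"
    using False unfolding l_def by (auto intro: LeastI Least_le)
  have up: "x \<in> X" if "l \<le> x" "x \<le> m" for x
    using that by (induction x rule: dec_induct) (use l assms(2) in auto)
  show thesis
  proof (cases l)
    case 0
    then show thesis
      using l that(2) by simp
  next
    case (Suc p)
    then show thesis
      using that(1) [of p] up l assms(1) by (force simp: Suc_le_eq)
  qed
qed

text \<open>Peels off the topmost block as an interval; what is left satisfies the same hypothesis
  with a smaller bound, so the step can be repeated for four blocks.\<close>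

lemma up_closed_split:
  assumes "set_less X Y" "X \<union> Y \<subseteq> {1..m}" "\<And>j. j \<in> X \<union> Y \<Longrightarrow> Suc j \<le> m \<Longrightarrow> Suc j \<in> X \<union> Y"
  obtains p where "p \<le> m" "\<And>x. x \<in> Y \<longleftrightarrow> p < x \<and> x \<le> m" "X \<subseteq> {1..p}"
    "\<And>j. j \<in> X \<Longrightarrow> Suc j \<le> p \<Longrightarrow> Suc j \<in> X"
proof -
  have less: "x \<in> X \<Longrightarrow> y \<in> Y \<Longrightarrow> x < y" for x y
    using assms(1) by (simp add: set_less_def)
  have "0 \<notin> Y" "Y \<subseteq> {..m}"
    using assms(2) by auto
  moreover have "Suc j \<in> Y" if "j \<in> Y" "Suc j \<le> m" for j
    using assms(3) [of j] that less [of "Suc j" j] by auto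
  ultimately obtain p where p: "p \<le> m" "\<And>x. x \<in> Y \<longleftrightarrow> p < x \<and> x \<le> m"
    using up_closed_interval by metis
  show thesis
  proof (rule that [OF p])
    show "X \<subseteq> {1..p}"
    proof
      fix x assume x: "x \<in> X"
      then have "1 \<le> x" "x \<le> m"
        using assms(2) by auto
      then show "x \<in> {1..p}"
        using less [OF x, of x] p(2) [of x] by auto
    qed
    show "Suc j \<in> X" if "j \<in> X" "Suc j \<le> p" for j
      using assms(3) [of j] that p(1) p(2) [of "Suc j"] by auto
  qed
qed

lemma (in aw_family) four_sets_intervals:
  assumes "p0 \<le> p1" "p1 \<le> p2" "p2 \<le> p3" "p3 \<le> p4" "p4 \<le> n"
    and "\<And>x. x \<in> A \<longleftrightarrow> p0 < x \<and> x \<le> p1" "\<And>x. x \<in> B \<longleftrightarrow> p1 < x \<and> x \<le> p2"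
      "\<And>x. x \<in> C \<longleftrightarrow> p2 < x \<and> x \<le> p3" "\<And>x. x \<in> D \<longleftrightarrow> p3 < x \<and> x \<le> p4"
  shows "four_sets n c A B C D"
proof -
  have "CS n c A = c p0 p1" "CS n c B = c p1 p2" "CS n c C = c p2 p3" "CS n c D = c p3 p4"
    "CS n c (A \<union> B \<union> C \<union> D) = c p0 p4" "CS n c (A \<union> B) = c p0 p2" "CS n c (B \<union> C) = c p1 p3"
    "CS n c (C \<union> D) = c p2 p4" "CS n c (A \<union> B \<union> C) = c p0 p3" "CS n c (B \<union> C \<union> D) = c p1 p4"
    by (rule CS_interval; use assms in auto)+
  moreover have "CS n c (A \<union> C) = bridge c p0 p1 p2 p3" "CS n c (B \<union> D) = bridge c p1 p2 p3 p4"
    "CS n c (A \<union> D) = bridge c p0 p1 p3 p4" "CS n c (A \<union> B \<union> D) = bridge c p0 p2 p3 p4"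
    "CS n c (A \<union> C \<union> D) = bridge c p0 p1 p2 p4"
    by (rule CS_gap; use assms in auto)+
  ultimately show ?thesis
    using aw4_intervals [OF assms(1-5)] aw_core_letters [OF assms(1-5)] by (simp add: four_sets_def)
qed

text \<open>The termination measure of the following reduction: an element moves up into a free
  place.\<close>

lemma sum_less_transpose:
  assumes "finite S" "j \<in> S" "Suc j \<notin> S" "Suc j \<le> n"
  shows "(\<Sum>x\<in>transpose j (Suc j) ` S. n - x) < (\<Sum>x\<in>S. n - x)"
proof -
  have "transpose j (Suc j) ` S = insert (Suc j) (S - {j})"
    using assms(2,3) by (force simp: transpose_def image_iff split: if_splits)
  then have "(\<Sum>x\<in>transpose j (Suc j) ` S. n - x) = (n - Suc j) + (\<Sum>x\<in>S - {j}. n - x)"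
    using assms by simp
  also have "\<dots> < (n - j) + (\<Sum>x\<in>S - {j}. n - x)"
    using assms(4) by simp
  also have "\<dots> = (\<Sum>x\<in>S. n - x)"
    using assms(1,2) by (simp add: sum.remove)
  finally show ?thesis .
qed

lemma set_less_transpose:
  assumes "set_less X Y" "Suc j \<notin> X" "Suc j \<notin> Y"
  shows "set_less (transpose j (Suc j) ` X) (transpose j (Suc j) ` Y)"
  using assms by (force simp: set_less_def transpose_def)

text \<open>Induction on the total distance of the elements from \<open>n\<close>, for all families
  at once. If some \<open>j\<close> has a free place above it, the claim for \<open>c\<close> is the
  claim for its twist at \<open>j\<close> with \<open>j\<close> moved up by one. Otherwise the union
  has no holes up to \<open>n\<close>, and the four sets are consecutive intervals.\<close>

theorem (in qbracket) four_sets: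
  assumes "aw_family a b w n c" "ordered4 A B C D" "A \<union> B \<union> C \<union> D \<subseteq> {1..n}"
  shows "four_sets n c A B C D"
  using assms
proof (induction "\<Sum>x\<in>A \<union> B \<union> C \<union> D. n - x" arbitrary: c A B C D rule: less_induct)
  case less
  define S where "S = A \<union> B \<union> C \<union> D"
  interpret aw_family a b w n c
    by fact
  show ?case
  proof (cases "\<exists>j\<in>S. Suc j \<notin> S \<and> Suc j \<le> n")
    case True
    then obtain j where j: "j \<in> S" "Suc j \<notin> S" "Suc j \<le> n"
      by blast
    have "j \<noteq> 0"
      using j(1) less.prems(3) S_def by auto
    then obtain e where je: "j = Suc e"
      by (cases j) auto
    interpret aw_twist a b w n c e
      by unfold_locales (use je j in simp)
    let ?f = "\<lambda>X. transpose j (Suc j) ` X"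
    \<comment> \<open>No subset of \<open>S\<close> contains \<open>Suc j\<close>, so only the
      favourable direction of the twist occurs.\<close>
    have CS: "CS n t (?f X) = CS n c X" if "X \<subseteq> S" for X
    proof (cases "j \<in> X")
      case True
      have "CS n t (?f X) = CS n c (?f (?f X))"
        unfolding je
      proof (rule CS_t_swap)
        show "s \<notin> transpose s (Suc s) ` X" "Suc s \<in> transpose s (Suc s) ` X"
          using True that j(2) je by (auto simp: transpose_def image_iff split: if_splits)
        show "transpose s (Suc s) ` X \<subseteq> {1..n}"
          using that less.prems(3) S_def j(3) je by (fastforce simp: transpose_def)
      qed
      then show ?thesis
        by (simp add: image_comp transpose_comp_involutory)
    next
      case False
      then have "?f X = X"
        using that j(2) by (force simp: transpose_def image_iff)
      moreover have "CS n t X = CS n c X"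
        using False that j(2) je by (intro CS_t_same) auto
      ultimately show ?thesis
        by simp
    qed
    have "four_sets n t (?f A) (?f B) (?f C) (?f D)"
    proof (rule less.hyps)
      show "(\<Sum>x\<in>?f A \<union> ?f B \<union> ?f C \<union> ?f D. n - x) < (\<Sum>x\<in>A \<union> B \<union> C \<union> D. n - x)"
        using sum_less_transpose [of S j n] j less.prems(3) finite_subset [of S "{1..n}"]
        by (simp add: S_def image_Un)
      show "aw_family a b w n t"
        by (rule aw_family_t)
      show "ordered4 (?f A) (?f B) (?f C) (?f D)"
        using less.prems(2) j(2) by (simp add: ordered4_def S_def set_less_transpose)
      show "?f A \<union> ?f B \<union> ?f C \<union> ?f D \<subseteq> {1..n}"
        unfolding image_Un [symmetric] using less.prems(3) j(3) \<open>j \<noteq> 0\<close>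
        by (intro transpose_image_subset) auto
    qed
    moreover have "A \<subseteq> S" "B \<subseteq> S" "C \<subseteq> S" "D \<subseteq> S"
      by (auto simp: S_def)
    ultimately show ?thesis
      unfolding four_sets_def image_Un [symmetric]
      by (simp only: CS Un_subset_iff simp_thms)
  next
    case False
    then have up: "\<And>j. j \<in> S \<Longrightarrow> Suc j \<le> n \<Longrightarrow> Suc j \<in> S"
      by blast
    have S: "S \<subseteq> {1..n}"
      using less.prems(3) S_def by simp
    have less: "set_less (A \<union> B \<union> C) D" "set_less (A \<union> B) C" "set_less A B" "set_less {} A"
      using less.prems(2) by (simp_all add: ordered4_def set_less_def ball_Un)
    obtain p3 where p3: "p3 \<le> n" "\<And>x. x \<in> D \<longleftrightarrow> p3 < x \<and> x \<le> n"
      and r3: "A \<union> B \<union> C \<subseteq> {1..p3}" "\<And>j. j \<in> A \<union> B \<union> C \<Longrightarrow> Suc j \<le> p3 \<Longrightarrow> Suc j \<in> A \<union> B \<union> C"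
      using up_closed_split [OF less(1) S [unfolded S_def] up [unfolded S_def]] by metis
    obtain p2 where p2: "p2 \<le> p3" "\<And>x. x \<in> C \<longleftrightarrow> p2 < x \<and> x \<le> p3"
      and r2: "A \<union> B \<subseteq> {1..p2}" "\<And>j. j \<in> A \<union> B \<Longrightarrow> Suc j \<le> p2 \<Longrightarrow> Suc j \<in> A \<union> B"
      using up_closed_split [OF less(2) r3] by metis
    obtain p1 where p1: "p1 \<le> p2" "\<And>x. x \<in> B \<longleftrightarrow> p1 < x \<and> x \<le> p2"
      and r1: "A \<subseteq> {1..p1}" "\<And>j. j \<in> A \<Longrightarrow> Suc j \<le> p1 \<Longrightarrow> Suc j \<in> A"
      using up_closed_split [OF less(3) r2] by metis
    obtain p0 where p0: "p0 \<le> p1" "\<And>x. x \<in> A \<longleftrightarrow> p0 < x \<and> x \<le> p1"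
      using up_closed_split [OF less(4), of p1] r1 unfolding Un_empty_left by metis
    show ?thesis
      by (rule four_sets_intervals [OF p0(1) p1(1) p2(1) p3(1) order_refl p0(2) p1(2) p2(2) p3(2)])
  qed
qed

section \<open>Alternating sums\<close>

context qscalars
begin

text \<open>A half twist of the first two pieces sends the pair letters \<open>B\<close>,
  \<open>C\<close> to \<open>C\<close>, \<open>C'\<close>, where \<open>C'\<close> and
  \<open>B\<close> differ by the order of one bracket. Everything is expressed by \<open>A\<close>,
  \<open>C\<close> and \<beta>; what then remains follows because \<open>C\<close> commutes with
  \<gamma>.\<close>

lemma Casimir_swap:
  assumes C: "qb A B = x * z + y * u - C" and B: "qb C A = y * z + x * u - B"
    and C': "qb A C = y * z + x * u - C'"
    and comA: "com x A" "com y A" "com z A" "com u A"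
    and comC: "com x C" "com y C" "com z C" "com u C"
    and xyzu: "com x y" "com x z" "com x u" "com y z" "com y u" "com z u"
  shows "Casimir x y z A B C u = Casimir y x z A C C' u"
proof -
  define \<beta> \<gamma> where \<beta>: "\<beta> = y * z + x * u" and \<gamma>: "\<gamma> = x * z + y * u"
  have com: "com \<beta> A" "com \<beta> C" "com \<gamma> A" "com \<gamma> C"
    using comA comC by (simp_all add: \<beta> \<gamma>)
  have mv: "A * \<beta> = \<beta> * A" "A * (\<beta> * v) = \<beta> * (A * v)" "C * \<beta> = \<beta> * C" "C * (\<beta> * v) = \<beta> * (C * v)" for v
    by (rule com_sw com_sw2; rule com)+
  define p H where p: "p = q - qi" and H: "H = q + qi"
  have "p * k = 1" "H * h = 1"
    using h_eq by (simp_all add: p H algebra_simps scalar_simps)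
  then have pk: "p * (k * v) = v" "H * (h * v) = v" for v
    by (simp_all flip: mult.assoc)
  have ph: "p * (h * v) = h * (p * v)" for v
    by (simp add: com_sw2)
  have qbk: "qb v v' = k * (q * (v * v') - qi * (v' * v))" for v v'
    unfolding qb_def unfolding a_eq b_eq by (simp add: right_diff_distrib mult.assoc)
  have B': "B = \<beta> - k * (q * (C * A) - qi * (A * C))" and C'': "C' = \<beta> - k * (q * (A * C) - qi * (C * A))"
    using B C' by (simp_all add: \<beta> qbk algebra_simps)
  have \<gamma>': "\<gamma> = C + \<beta> * A - k * (q * (A * (k * (q * (C * A) - qi * (A * C)))) - qi * ((k * (q * (C * A) - qi * (A * C))) * A))"
  proof -
    have "qb A \<beta> = \<beta> * A"
      using com(1) by (simp add: qb_com com_sym com_sw)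
    then have "\<gamma> = C + \<beta> * A - qb A (k * (q * (C * A) - qi * (A * C)))"
      using C by (simp add: \<gamma> B' qb_lin algebra_simps)
    then show ?thesis
      unfolding qbk [of A] .
  qed
  have comm\<gamma>: "C * \<gamma> = \<gamma> * C"
    using com(4) by (rule com_sw)
  have "Casimir x y z A B C u - Casimir y x z A C C' u
      = q * (A * B * C) - q * (A * C * C') + h * (qi * qi * (B * B) + q * q * (C * C)) - h * (qi * qi * (C * C) + q * q * (C' * C'))
        - qi * (B * \<beta>) + q * (C' * \<beta>) - (q - qi) * (C * \<gamma>)"
    unfolding Casimir_def \<beta> \<gamma> by (simp add: xyzu [THEN com_sw] xyzu [THEN com_sw2] algebra_simps scalar_simps)
  also have "\<dots> = 0" (is "?T = 0")
  proof -
    note elim = mv scalar_move [of A] scalar_move [of C] scalar_move [of \<beta>] scalar_order q_qi q_qi_simps algebra_simps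
    \<comment> \<open>Up to sign the part of degree four in the commutator of \<open>C\<close> with
      \<gamma>, scaled by \<open>p * p\<close>. That this commutator vanishes is the relation
      between \<open>A\<close> and \<open>C\<close> to be exploited.\<close>
    define X where "X = A * (A * (C * C)) - C * (C * (A * A))
      - (q * q + qi * qi) * (A * (C * (A * C)) - C * (A * (C * A)))"
    have "p * (p * (C * \<gamma> - \<gamma> * C)) = p * (p * (\<beta> * (C * A - A * C))) - X"
      unfolding \<gamma>' X_def by (simp add: elim pk)
    then have rel: "X = p * (p * (\<beta> * (C * A - A * C)))"
      using comm\<gamma> by simp
    \<comment> \<open>Denominators are cleared by \<open>H\<close>, \<open>p\<close> and
      \<open>p\<close>; the factors \<open>h\<close>, \<open>k\<close> and \<open>k\<close> undo
      this afterwards.\<close>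
    have "H * (p * (p * ?T)) = H * (p * (X - p * (p * (\<beta> * (C * A - A * C)))))"
      unfolding \<gamma>' B' C'' X_def by (simp add: elim pk ph) (simp add: p H elim)
    then have "H * (p * (p * ?T)) = 0"
      by (simp add: rel)
    then have "k * (k * (h * (H * (p * (p * ?T))))) = 0"
      by simp
    moreover have "k * (k * (h * (H * (p * (p * v))))) = v" for v
    proof -
      have "h * (H * v) = v" "k * (p * v) = v" for v
        using pk [of v] by (simp_all add: p H algebra_simps scalar_simps)
      then show ?thesis
        by simp
    qed
    ultimately show ?thesis
      by metis
  qed
  finally show ?thesis
    by simp
qed

end

context convex4
begin

text \<open>Half twists of the pieces 2 and 3, here against 4, then against 1, then against the
  union of 4 and 1. The letter \<open>C'\<close> is left open, to be filled by one of the twisted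
  family.\<close>

lemma Casimir_swap_234:
  assumes "qb C23 C24 = c3 * c4 + c2 * C234 - C'"
  shows "Casimir c3 c2 c4 C23 C24 C' C234 = Casimir c2 c3 c4 C23 C34 C24 C234"
  by (rule Casimir_swap [symmetric, OF T_2_3_4 T_4_2_3 assms]) simp_all

lemma Casimir_rotate_123: "Casimir c1 c2 c3 C12 C23 C13 C123 = Casimir c2 c3 c1 C23 C13 C12 C123"
  by (rule Casimir_cyclic) (simp_all add: T central_order letter_central')

lemma Casimir_swap_123:
  assumes "qb C23 C12 = c1 * c3 + c2 * C123 - C'"
  shows "Casimir c3 c2 c1 C23 C12 C' C123 = Casimir c2 c3 c1 C23 C13 C12 C123"
  by (rule Casimir_swap [symmetric]) (simp_all add: T assms central_order)

lemma Casimir_swap_2341: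
  assumes "qb C23 C124 = c3 * C14 + c2 * m - C'"
  shows "Casimir c3 c2 C14 C23 C124 C' m = Casimir c2 c3 C14 C23 C134 C124 m"
  by (rule Casimir_swap [symmetric, OF T_2_3_41 T_41_2_3 assms]) simp_all

end

definition alt :: "nat set \<Rightarrow> (nat set \<Rightarrow> 'b::ab_group_add) \<Rightarrow> 'b"
  where "alt S F = (\<Sum>X\<in>Pow S. if even (card (S - X)) then F X else - F X)"

lemma alt_cong: "(\<And>X. X \<subseteq> S \<Longrightarrow> F X = G X) \<Longrightarrow> alt S F = alt S G"
  unfolding alt_def by (rule sum.cong) auto

lemma alt_0: "alt S (\<lambda>_. 0) = 0"
  unfolding alt_def by (rule sum.neutral) simp

lemma alt_diff: "alt S (\<lambda>X. F X - G X) = alt S F - alt S G"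
  unfolding alt_def by (subst sum_subtractf [symmetric]) (auto intro!: sum.cong)

lemma alt_insert:
  assumes "finite S" "x \<notin> S"
  shows "alt (insert x S) F = alt S (\<lambda>X. F (insert x X)) - alt S F"
proof -
  have inj: "inj_on (insert x) (Pow S)"
    using assms(2) by (auto simp: inj_on_def insert_ident)
  have "Pow S \<inter> insert x ` Pow S = {}"
    using assms(2) by auto
  then have "alt (insert x S) F =
      (\<Sum>X\<in>Pow S. if even (card (insert x S - X)) then F X else - F X)
      + (\<Sum>X\<in>Pow S. if even (card (insert x S - insert x X)) then F (insert x X) else - F (insert x X))"
    unfolding alt_def Pow_insert using assms(1) by (simp add: sum.union_disjoint sum.reindex [OF inj])
  also have "(\<Sum>X\<in>Pow S. if even (card (insert x S - X)) then F X else - F X) = - alt S F"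
    unfolding alt_def sum_negf [symmetric]
  proof (rule sum.cong)
    fix X assume "X \<in> Pow S"
    then have "insert x S - X = insert x (S - X)"
      using assms(2) by auto
    then show "(if even (card (insert x S - X)) then F X else - F X) = - (if even (card (S - X)) then F X else - F X)"
      using assms by simp
  qed simp
  also have "(\<Sum>X\<in>Pow S. if even (card (insert x S - insert x X)) then F (insert x X) else - F (insert x X))
      = alt S (\<lambda>X. F (insert x X))"
    unfolding alt_def
  proof (rule sum.cong)
    fix X assume "X \<in> Pow S"
    then have "insert x S - insert x X = S - X"
      using assms(2) by auto
    then show "(if even (card (insert x S - insert x X)) then F (insert x X) else - F (insert x X))
        = (if even (card (S - X)) then F (insert x X) else - F (insert x X))"
      by simp
  qed simp
  finally show ?thesis
    by simp
qed

text \<open>Subsets with and without \<open>x\<close> have equal values and opposite signs. This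
  removes each term of an exchange identity that ignores some element of \<open>S\<close>.\<close>

lemma alt_eq_0:
  assumes "finite S" "x \<in> S" "\<And>X. X \<subseteq> S \<Longrightarrow> F (insert x X) = F (X - {x})"
  shows "alt S F = 0"
proof -
  have "alt S F = alt (S - {x}) (\<lambda>X. F (insert x X)) - alt (S - {x}) F"
    using alt_insert [of "S - {x}" x F] assms(1,2) by (simp add: insert_absorb)
  moreover have "alt (S - {x}) (\<lambda>X. F (insert x X)) = alt (S - {x}) F"
  proof (rule alt_cong)
    fix X assume "X \<subseteq> S - {x}"
    moreover from this have "X - {x} = X"
      by auto
    ultimately show "F (insert x X) = F X"
      using assms(3) [of X] by auto
  qed
  ultimately show ?thesis
    by simp
qed

lemma alt_image:
  assumes "inj f"
  shows "alt (f ` S) F = alt S (\<lambda>X. F (f ` X))"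
proof -
  have inj: "inj_on ((`) f) (Pow S)"
    using assms by (auto simp: inj_on_def inj_image_eq_iff)
  have "card (f ` S - f ` X) = card (S - X)" for X
    using assms by (simp add: image_set_diff [symmetric] card_image inj_on_subset)
  then show ?thesis
    unfolding alt_def image_Pow_surj [OF refl, symmetric] by (simp add: sum.reindex [OF inj])
qed

section \<open>Independence of the splitting\<close>

locale aw_family_q = aw_family + qscalars

context qscalars
begin

definition Om :: "nat \<Rightarrow> (nat \<Rightarrow> nat \<Rightarrow> 'a) \<Rightarrow> nat set \<Rightarrow> nat set \<Rightarrow> nat set \<Rightarrow> 'a"
  where "Om N f A B C = Casimir (CS N f A) (CS N f B) (CS N f C)
    (CS N f (A \<union> B)) (CS N f (B \<union> C)) (CS N f (A \<union> C)) (CS N f (A \<union> B \<union> C))"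

text \<open>Summation over one subset of the union, instead of a triple of subsets, separates the
  range of the sum from the splitting; \<open>omega_alt\<close> matches it with the triple
  sum.\<close>

definition omega_sum :: "nat \<Rightarrow> (nat \<Rightarrow> nat \<Rightarrow> 'a) \<Rightarrow> nat set \<Rightarrow> nat set \<Rightarrow> nat set \<Rightarrow> 'a"
  where "omega_sum N f A B C = alt (A \<union> B \<union> C) (\<lambda>X. Om N f (X \<inter> A) (X \<inter> B) (X \<inter> C))"

lemma convex4_sets:
  assumes "four_sets N f A B C D"
  shows "convex4 a b w q qi k h (CS N f A) (CS N f B) (CS N f C) (CS N f D) (CS N f (A \<union> B \<union> C \<union> D))
    (CS N f (A \<union> B)) (CS N f (B \<union> C)) (CS N f (C \<union> D)) (CS N f (A \<union> D)) (CS N f (A \<union> C)) (CS N f (B \<union> D))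
    (CS N f (A \<union> B \<union> C)) (CS N f (B \<union> C \<union> D)) (CS N f (A \<union> C \<union> D)) (CS N f (A \<union> B \<union> D))"
proof -
  note F = assms [unfolded four_sets_def]
  interpret A: aw4 a b w "CS N f A" "CS N f B" "CS N f C" "CS N f D" "CS N f (A \<union> B \<union> C \<union> D)"
      "CS N f (A \<union> B)" "CS N f (B \<union> C)" "CS N f (C \<union> D)" "CS N f (A \<union> B \<union> C)" "CS N f (B \<union> C \<union> D)"
    using F by blast
  interpret A: aw4q a b w "CS N f A" "CS N f B" "CS N f C" "CS N f D" "CS N f (A \<union> B \<union> C \<union> D)"
      "CS N f (A \<union> B)" "CS N f (B \<union> C)" "CS N f (C \<union> D)" "CS N f (A \<union> B \<union> C)" "CS N f (B \<union> C \<union> D)" q qi k h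
    by unfold_locales
  show ?thesis
    using A.is_convex4 F by simp
qed

end

context aw_family_q
begin

lemma sets_convex4:
  assumes "ordered4 A B C D" "A \<union> B \<union> C \<union> D \<subseteq> {1..n}"
  shows "convex4 a b w q qi k h (CS n c A) (CS n c B) (CS n c C) (CS n c D) (CS n c (A \<union> B \<union> C \<union> D))
    (CS n c (A \<union> B)) (CS n c (B \<union> C)) (CS n c (C \<union> D)) (CS n c (A \<union> D)) (CS n c (A \<union> C)) (CS n c (B \<union> D))
    (CS n c (A \<union> B \<union> C)) (CS n c (B \<union> C \<union> D)) (CS n c (A \<union> C \<union> D)) (CS n c (A \<union> B \<union> D))"
  by (intro convex4_sets four_sets assms) (rule aw_family_axioms)

text \<open>Rearranged, each line equates two defects of additivity: of merging \<open>A\<close>,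
  \<open>B\<close> and \<open>D\<close>, \<open>A\<close>; of \<open>B\<close>, \<open>C\<close> and
  \<open>A\<close>, \<open>B\<close>; of \<open>C\<close>, \<open>D\<close> and \<open>B\<close>,
  \<open>C\<close>.\<close>

lemma Om_exchange:
  assumes "ordered4 A B C D" "A \<union> B \<union> C \<union> D \<subseteq> {1..n}"
  shows "Om n c (A \<union> B) C D + Om n c A B C = Om n c B C (A \<union> D) + Om n c A C D"
    and "Om n c A (B \<union> C) D + Om n c B C D = Om n c (A \<union> B) C D + Om n c A B D"
    and "Om n c A B (C \<union> D) + Om n c A C D = Om n c A (B \<union> C) D + Om n c A B C"
proof -
  interpret X: convex4 a b w q qi k h "CS n c A" "CS n c B" "CS n c C" "CS n c D" "CS n c (A \<union> B \<union> C \<union> D)"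
    "CS n c (A \<union> B)" "CS n c (B \<union> C)" "CS n c (C \<union> D)" "CS n c (A \<union> D)" "CS n c (A \<union> C)" "CS n c (B \<union> D)"
    "CS n c (A \<union> B \<union> C)" "CS n c (B \<union> C \<union> D)" "CS n c (A \<union> C \<union> D)" "CS n c (A \<union> B \<union> D)"
    using assms by (rule sets_convex4)
  show "Om n c (A \<union> B) C D + Om n c A B C = Om n c B C (A \<union> D) + Om n c A C D"
    using X.Casimir_exchange by (simp add: Om_def Un_ac)
  show "Om n c A (B \<union> C) D + Om n c B C D = Om n c (A \<union> B) C D + Om n c A B D"
    using X.Casimir_exchange1 by (simp add: Om_def Un_ac)
  show "Om n c A B (C \<union> D) + Om n c A C D = Om n c A (B \<union> C) D + Om n c A B C"
    using X.Casimir_exchange2 by (simp add: Om_def Un_ac)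
qed

text \<open>With one set empty the letters are 1, the two other sets and their union, all commuting,
  and the expression collapses.\<close>

lemma Om_empty:
  assumes "set_less A B" "A \<union> B \<subseteq> {1..n}"
  shows "Om n c {} A B = 0" "Om n c A {} B = 0" "Om n c A B {} = 0"
proof -
  have "ordered4 {} A B {}" "{} \<union> A \<union> B \<union> {} \<subseteq> {1..n}"
    using assms by (simp_all add: ordered4_def set_less_def)
  note X = sets_convex4 [OF this]
  have com: "com (CS n c A) (CS n c B)" "com (CS n c A) (CS n c (A \<union> B))" "com (CS n c B) (CS n c (A \<union> B))"
    using convex4.com_gen(3,7) [OF X, of "CS n c A"] convex4.com_gen(7) [OF X, of "CS n c B"] by simp_all
  show "Om n c {} A B = 0" "Om n c A {} B = 0" "Om n c A B {} = 0"
    by (simp_all add: Om_def CS_empty Casimir_def com [THEN com_sw] com [THEN com_sw2] algebra_simps scalar_simps)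
qed

text \<open>\<omega> of \<open>S\<close> split at two thresholds: a change of splitting becomes a
  sequence of moves of a threshold by one.\<close>

definition thr :: "nat set \<Rightarrow> nat \<Rightarrow> nat \<Rightarrow> 'a"
  where "thr S p v = alt S (\<lambda>X. Om n c (X \<inter> {..p}) (X \<inter> {p<..v}) (X \<inter> {v<..}))"

text \<open>Only subsets containing \<open>Suc p\<close> feel the move. For these the exchange
  identity leaves two values of \<Omega>, one ignoring the elements between \<open>Suc p\<close> and
  \<open>v\<close>, the other those up to \<open>p\<close>. As \<open>S\<close> has elements of both
  kinds, both alternating sums vanish.\<close>

lemma thr_step1:
  assumes S: "S \<subseteq> {1..n}" and ne: "S \<inter> {..p} \<noteq> {}" "S \<inter> {Suc p<..v} \<noteq> {}"
  shows "thr S p v = thr S (Suc p) v"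
proof -
  define \<Delta> where "\<Delta> X = Om n c (X \<inter> {..p}) (X \<inter> {p<..v}) (X \<inter> {v<..})
    - Om n c (X \<inter> {..Suc p}) (X \<inter> {Suc p<..v}) (X \<inter> {v<..})" for X
  have fin: "finite S"
    using S finite_subset by blast
  have notin: "\<Delta> X = 0" if "Suc p \<notin> X" for X
  proof -
    have "X \<inter> {..Suc p} = X \<inter> {..p}" "X \<inter> {Suc p<..v} = X \<inter> {p<..v}"
      using that by (auto simp: le_Suc_eq dest: Suc_lessI)
    then show ?thesis
      by (simp add: \<Delta>_def)
  qed
  have "alt S \<Delta> = 0"
  proof (cases "Suc p \<in> S")
    case False
    then have "alt S \<Delta> = alt S (\<lambda>_. 0)"
      by (intro alt_cong notin) auto
    then show ?thesis
      by (simp add: alt_0)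
  next
    case True
    define T where "T = S - {Suc p}"
    have T: "S = insert (Suc p) T" "Suc p \<notin> T" "finite T"
      using True fin by (auto simp: T_def)
    have "\<Delta> (insert (Suc p) X) = Om n c (X \<inter> {..p}) {Suc p} (X \<inter> {v<..}) - Om n c {Suc p} (X \<inter> {Suc p<..v}) (X \<inter> {v<..})"
      if "X \<subseteq> T" for X
    proof -
      have v: "Suc p < v"
        using ne(2) by auto
      have "Suc p \<notin> X"
        using that T(2) by auto
      then have e: "insert (Suc p) X \<inter> {..p} = X \<inter> {..p}" "insert (Suc p) X \<inter> {p<..v} = {Suc p} \<union> X \<inter> {Suc p<..v}"
        "insert (Suc p) X \<inter> {v<..} = X \<inter> {v<..}" "insert (Suc p) X \<inter> {..Suc p} = X \<inter> {..p} \<union> {Suc p}"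
        "insert (Suc p) X \<inter> {Suc p<..v} = X \<inter> {Suc p<..v}"
        using v by (auto simp: le_Suc_eq dest: Suc_lessI)
      have "Om n c (X \<inter> {..p}) ({Suc p} \<union> X \<inter> {Suc p<..v}) (X \<inter> {v<..}) + Om n c {Suc p} (X \<inter> {Suc p<..v}) (X \<inter> {v<..})
        = Om n c (X \<inter> {..p} \<union> {Suc p}) (X \<inter> {Suc p<..v}) (X \<inter> {v<..}) + Om n c (X \<inter> {..p}) {Suc p} (X \<inter> {v<..})"
      proof (rule Om_exchange(2))
        show "ordered4 (X \<inter> {..p}) {Suc p} (X \<inter> {Suc p<..v}) (X \<inter> {v<..})"
          using v by (auto simp: ordered4_def set_less_def)
        show "X \<inter> {..p} \<union> {Suc p} \<union> X \<inter> {Suc p<..v} \<union> X \<inter> {v<..} \<subseteq> {1..n}"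
          using that S T(1) by auto
      qed
      then show ?thesis
        unfolding \<Delta>_def e by (simp add: algebra_simps)
    qed
    then have "alt S \<Delta> = alt T (\<lambda>X. Om n c (X \<inter> {..p}) {Suc p} (X \<inter> {v<..}) - Om n c {Suc p} (X \<inter> {Suc p<..v}) (X \<inter> {v<..})) - alt T \<Delta>"
      unfolding T(1) alt_insert [OF T(3,2)] by (simp cong: alt_cong)
    moreover have "alt T \<Delta> = alt T (\<lambda>_. 0)"
      using T(2) by (intro alt_cong notin) auto
    moreover have "alt T (\<lambda>X. Om n c (X \<inter> {..p}) {Suc p} (X \<inter> {v<..})) = 0"
    proof -
      obtain y where y: "y \<in> S" "Suc p < y" "y \<le> v"
        using ne(2) by auto
      have "insert y X \<inter> {..p} = (X - {y}) \<inter> {..p}" "insert y X \<inter> {v<..} = (X - {y}) \<inter> {v<..}" for X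
        using y by auto
      then show ?thesis
        using T y by (intro alt_eq_0 [of _ y]) (auto simp: T_def)
    qed
    moreover have "alt T (\<lambda>X. Om n c {Suc p} (X \<inter> {Suc p<..v}) (X \<inter> {v<..})) = 0"
    proof -
      obtain y where y: "y \<in> S" "y \<le> p" "y < v"
        using ne by auto
      have "insert y X \<inter> {Suc p<..v} = (X - {y}) \<inter> {Suc p<..v}" "insert y X \<inter> {v<..} = (X - {y}) \<inter> {v<..}" for X
        using y by auto
      then show ?thesis
        using T y by (intro alt_eq_0 [of _ y]) (auto simp: T_def)
    qed
    ultimately show ?thesis
      by (simp add: alt_diff alt_0)
  qed
  then show ?thesis
    unfolding \<Delta>_def alt_diff thr_def by simp
qed

text \<open>The same at the upper threshold, now with the third exchange identity.\<close>

lemma thr_step2: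
  assumes S: "S \<subseteq> {1..n}" and ne: "S \<inter> {p<..v} \<noteq> {}" "S \<inter> {Suc v<..} \<noteq> {}"
  shows "thr S p v = thr S p (Suc v)"
proof -
  define \<Delta> where "\<Delta> X = Om n c (X \<inter> {..p}) (X \<inter> {p<..v}) (X \<inter> {v<..})
    - Om n c (X \<inter> {..p}) (X \<inter> {p<..Suc v}) (X \<inter> {Suc v<..})" for X
  have fin: "finite S"
    using S finite_subset by blast
  have notin: "\<Delta> X = 0" if "Suc v \<notin> X" for X
  proof -
    have "X \<inter> {p<..Suc v} = X \<inter> {p<..v}" "X \<inter> {Suc v<..} = X \<inter> {v<..}"
      using that by (auto simp: le_Suc_eq dest: Suc_lessI)
    then show ?thesis
      by (simp add: \<Delta>_def)
  qed
  have "alt S \<Delta> = 0"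
  proof (cases "Suc v \<in> S")
    case False
    then have "alt S \<Delta> = alt S (\<lambda>_. 0)"
      by (intro alt_cong notin) auto
    then show ?thesis
      by (simp add: alt_0)
  next
    case True
    define T where "T = S - {Suc v}"
    have T: "S = insert (Suc v) T" "Suc v \<notin> T" "finite T"
      using True fin by (auto simp: T_def)
    have "\<Delta> (insert (Suc v) X) = Om n c (X \<inter> {..p}) (X \<inter> {p<..v}) {Suc v} - Om n c (X \<inter> {..p}) {Suc v} (X \<inter> {Suc v<..})"
      if "X \<subseteq> T" for X
    proof -
      have v: "p < v"
        using ne(1) by auto
      have "Suc v \<notin> X"
        using that T(2) by auto
      then have e: "insert (Suc v) X \<inter> {..p} = X \<inter> {..p}" "insert (Suc v) X \<inter> {p<..v} = X \<inter> {p<..v}"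
        "insert (Suc v) X \<inter> {v<..} = {Suc v} \<union> X \<inter> {Suc v<..}" "insert (Suc v) X \<inter> {p<..Suc v} = X \<inter> {p<..v} \<union> {Suc v}"
        "insert (Suc v) X \<inter> {Suc v<..} = X \<inter> {Suc v<..}"
        using v by (auto simp: le_Suc_eq dest: Suc_lessI)
      have "Om n c (X \<inter> {..p}) (X \<inter> {p<..v}) ({Suc v} \<union> X \<inter> {Suc v<..}) + Om n c (X \<inter> {..p}) {Suc v} (X \<inter> {Suc v<..})
        = Om n c (X \<inter> {..p}) (X \<inter> {p<..v} \<union> {Suc v}) (X \<inter> {Suc v<..}) + Om n c (X \<inter> {..p}) (X \<inter> {p<..v}) {Suc v}"
      proof (rule Om_exchange(3))
        show "ordered4 (X \<inter> {..p}) (X \<inter> {p<..v}) {Suc v} (X \<inter> {Suc v<..})"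
          using v by (auto simp: ordered4_def set_less_def)
        show "X \<inter> {..p} \<union> X \<inter> {p<..v} \<union> {Suc v} \<union> X \<inter> {Suc v<..} \<subseteq> {1..n}"
          using that S T(1) by auto
      qed
      then show ?thesis
        unfolding \<Delta>_def e by (simp add: algebra_simps)
    qed
    then have "alt S \<Delta> = alt T (\<lambda>X. Om n c (X \<inter> {..p}) (X \<inter> {p<..v}) {Suc v} - Om n c (X \<inter> {..p}) {Suc v} (X \<inter> {Suc v<..})) - alt T \<Delta>"
      unfolding T(1) alt_insert [OF T(3,2)] by (simp cong: alt_cong)
    moreover have "alt T \<Delta> = alt T (\<lambda>_. 0)"
      using T(2) by (intro alt_cong notin) auto
    moreover have "alt T (\<lambda>X. Om n c (X \<inter> {..p}) (X \<inter> {p<..v}) {Suc v}) = 0"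
    proof -
      obtain y where y: "y \<in> S" "Suc v < y" "p < y"
        using ne by auto
      have "insert y X \<inter> {..p} = (X - {y}) \<inter> {..p}" "insert y X \<inter> {p<..v} = (X - {y}) \<inter> {p<..v}" for X
        using y by auto
      then show ?thesis
        using T y by (intro alt_eq_0 [of _ y]) (auto simp: T_def)
    qed
    moreover have "alt T (\<lambda>X. Om n c (X \<inter> {..p}) {Suc v} (X \<inter> {Suc v<..})) = 0"
    proof -
      obtain y where y: "y \<in> S" "p < y" "y \<le> v"
        using ne by auto
      have "insert y X \<inter> {..p} = (X - {y}) \<inter> {..p}" "insert y X \<inter> {Suc v<..} = (X - {y}) \<inter> {Suc v<..}" for X
        using y by auto
      then show ?thesis
        using T y by (intro alt_eq_0 [of _ y]) (auto simp: T_def)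
    qed
    ultimately show ?thesis
      by (simp add: alt_diff alt_0)
  qed
  then show ?thesis
    unfolding \<Delta>_def alt_diff thr_def by simp
qed

definition valid_thr :: "nat set \<Rightarrow> nat \<Rightarrow> nat \<Rightarrow> bool"
  where "valid_thr S p v \<longleftrightarrow> S \<inter> {..p} \<noteq> {} \<and> S \<inter> {p<..v} \<noteq> {} \<and> S \<inter> {v<..} \<noteq> {}"

lemma thr_lower:
  assumes "S \<subseteq> {1..n}" "m \<in> S" "m \<le> p" "valid_thr S p v"
  shows "thr S p v = thr S m v \<and> valid_thr S m v"
  using assms(3,4)
proof (induction p rule: dec_induct)
  case (step p)
  have "m \<in> S \<inter> {..p}"
    using step.hyps(1) assms(2) by simp
  then have ne: "S \<inter> {..p} \<noteq> {}" "S \<inter> {Suc p<..v} \<noteq> {}" "S \<inter> {v<..} \<noteq> {}"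
    using step.prems unfolding valid_thr_def by blast+
  obtain y where "y \<in> S" "Suc p < y" "y \<le> v"
    using ne(2) by auto
  then have "y \<in> S \<inter> {p<..v}"
    by simp
  then have "S \<inter> {p<..v} \<noteq> {}"
    by blast
  note ne = ne this
  have "valid_thr S p v" "thr S p v = thr S (Suc p) v"
    unfolding valid_thr_def using ne thr_step1 [OF assms(1) ne(1,2)] by blast+
  then show ?case
    using step.IH by simp
qed simp

lemma thr_raise:
  assumes "S \<subseteq> {1..n}" "v \<le> v'" "valid_thr S m v" "valid_thr S m v'"
  shows "thr S m v = thr S m v'"
  using assms(2,4)
proof (induction v' rule: dec_induct)
  case (step u)
  obtain y where "y \<in> S" "m < y" "y \<le> v"
    using assms(3) unfolding valid_thr_def by auto
  then have "y \<in> S \<inter> {m<..u}"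
    using step.hyps by simp
  then have ne: "S \<inter> {m<..u} \<noteq> {}" "S \<inter> {Suc u<..} \<noteq> {}" "S \<inter> {..m} \<noteq> {}"
    using step.prems unfolding valid_thr_def by blast+
  obtain z where "z \<in> S" "Suc u < z"
    using ne(2) by auto
  then have "z \<in> S \<inter> {u<..}"
    by simp
  then have "S \<inter> {u<..} \<noteq> {}"
    by blast
  note ne = ne this
  have "valid_thr S m u" "thr S m u = thr S m (Suc u)"
    unfolding valid_thr_def using ne thr_step2 [OF assms(1) ne(1,2)] by blast+
  then show ?case
    using step.IH by simp
qed simp

text \<open>Both splittings are brought to the smallest possible first block, consisting of
  \<open>Min S\<close> alone; then only the second thresholds have to be compared.\<close>

lemma thr_unique:
  assumes "S \<subseteq> {1..n}" "valid_thr S p v" "valid_thr S p' v'"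
  shows "thr S p v = thr S p' v'"
proof -
  define m where "m = Min S"
  have fin: "finite S"
    by (rule finite_subset [OF assms(1)]) simp
  obtain y y' where y: "y \<in> S" "y \<le> p" "y' \<in> S" "y' \<le> p'"
    using assms(2,3) unfolding valid_thr_def by blast
  have "m \<in> S"
    unfolding m_def using fin y(1) by (intro Min_in) blast+
  moreover have "m \<le> y" "m \<le> y'"
    unfolding m_def by (rule Min_le [OF fin y(1)], rule Min_le [OF fin y(3)])
  ultimately have m: "m \<in> S" "m \<le> p" "m \<le> p'"
    using y(2,4) by simp_all
  have 1: "thr S p v = thr S m v" "valid_thr S m v"
    using thr_lower [OF assms(1) m(1,2) assms(2)] by blast+
  have 2: "thr S p' v' = thr S m v'" "valid_thr S m v'"
    using thr_lower [OF assms(1) m(1,3) assms(3)] by blast+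
  have "thr S m v = thr S m v'"
  proof (cases "v \<le> v'")
    case True
    show ?thesis
      by (rule thr_raise [OF assms(1) True 1(2) 2(2)])
  next
    case False
    then have "v' \<le> v"
      by simp
    then show ?thesis
      by (rule thr_raise [OF assms(1) _ 2(2) 1(2), symmetric])
  qed
  then show ?thesis
    unfolding 1(1) 2(1) .
qed

lemma omega_sum_thr:
  assumes "ordered_splitting S A B C" "finite S"
  shows "omega_sum n c A B C = thr S (Max A) (Max B)" "valid_thr S (Max A) (Max B)"
proof -
  have ne: "A \<noteq> {}" "B \<noteq> {}" "C \<noteq> {}" and S: "S = A \<union> B \<union> C"
    and less: "\<And>x y. x \<in> A \<Longrightarrow> y \<in> B \<Longrightarrow> x < y" "\<And>x y. x \<in> B \<Longrightarrow> y \<in> C \<Longrightarrow> x < y"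
    using assms(1) by (auto simp: ordered_splitting_def set_less_def)
  have fin: "finite A" "finite B"
    using assms(2) S by auto
  define p v where pv: "p = Max A" "v = Max B"
  have M: "p \<in> A" "v \<in> B" "\<And>x. x \<in> A \<Longrightarrow> x \<le> p" "\<And>x. x \<in> B \<Longrightarrow> x \<le> v"
    unfolding pv using fin ne by (simp_all del: Max_less_iff Max_le_iff)
  have A: "x \<in> A \<longleftrightarrow> x \<le> p" and B: "x \<in> B \<longleftrightarrow> p < x \<and> x \<le> v" and C: "x \<in> C \<longleftrightarrow> v < x"
    if xS: "x \<in> S" for x
  proof -
    have pv': "p < v"
      using less(1) [OF M(1,2)] .
    have i: "x \<in> A \<longrightarrow> x \<le> p" "x \<in> B \<longrightarrow> p < x \<and> x \<le> v" "x \<in> C \<longrightarrow> v < x"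
      using M(3) [of x] M(4) [of x] less(1) [OF M(1), of x] less(2) [OF M(2), of x] by blast+
    consider "x \<in> A" | "x \<in> B" | "x \<in> C"
      using xS unfolding S by blast
    then have "(x \<in> A \<longleftrightarrow> x \<le> p) \<and> (x \<in> B \<longleftrightarrow> p < x \<and> x \<le> v) \<and> (x \<in> C \<longleftrightarrow> v < x)"
    proof cases
      case 1
      then have "x \<le> p" "\<not> p < x" "\<not> v < x"
        using i(1) pv' by simp_all
      with 1 i show ?thesis
        by blast
    next
      case 2
      then have "p < x" "x \<le> v" "\<not> x \<le> p" "\<not> v < x"
        using i(2) by simp_all
      with 2 i show ?thesis
        by blast
    next
      case 3
      then have "v < x" "\<not> x \<le> p" "\<not> x \<le> v"
        using i(3) pv' by simp_all
      with 3 i show ?thesis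
        by blast
    qed
    then show "x \<in> A \<longleftrightarrow> x \<le> p" "x \<in> B \<longleftrightarrow> p < x \<and> x \<le> v" "x \<in> C \<longleftrightarrow> v < x"
      by blast+
  qed
  have "omega_sum n c A B C = alt S (\<lambda>X. Om n c (X \<inter> A) (X \<inter> B) (X \<inter> C))"
    by (simp add: omega_sum_def S)
  also have "\<dots> = thr S p v"
    unfolding thr_def
  proof (rule alt_cong)
    fix X assume X: "X \<subseteq> S"
    have "x \<in> X \<inter> A \<longleftrightarrow> x \<in> X \<inter> {..p}" "x \<in> X \<inter> B \<longleftrightarrow> x \<in> X \<inter> {p<..v}" "x \<in> X \<inter> C \<longleftrightarrow> x \<in> X \<inter> {v<..}" for x
      using X A [of x] B [of x] C [of x] unfolding Int_iff atMost_iff greaterThanAtMost_iff greaterThan_iff by blast+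
    then have "X \<inter> A = X \<inter> {..p}" "X \<inter> B = X \<inter> {p<..v}" "X \<inter> C = X \<inter> {v<..}"
      by blast+
    then show "Om n c (X \<inter> A) (X \<inter> B) (X \<inter> C) = Om n c (X \<inter> {..p}) (X \<inter> {p<..v}) (X \<inter> {v<..})"
      by (simp only:)
  qed
  finally show "omega_sum n c A B C = thr S (Max A) (Max B)"
    unfolding pv .
  obtain z where z: "z \<in> C"
    using ne by blast
  have "p \<in> S" "v \<in> S" "z \<in> S" "p < v" "v < z"
    using M(1,2) z less(1) [OF M(1,2)] less(2) [OF M(2) z] unfolding S by blast+
  then have "p \<in> S \<inter> {..p}" "v \<in> S \<inter> {p<..v}" "z \<in> S \<inter> {v<..}"
    by simp_all
  then show "valid_thr S (Max A) (Max B)"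
    unfolding valid_thr_def pv [symmetric] by blast
qed

theorem omega_sum_unique:
  assumes "S \<subseteq> {1..n}" "ordered_splitting S A B C" "ordered_splitting S A' B' C'"
  shows "omega_sum n c A B C = omega_sum n c A' B' C'"
proof -
  have "finite S"
    using assms(1) finite_subset by blast
  then show ?thesis
    using omega_sum_thr assms thr_unique by metis
qed

end

section \<open>Effect of the twist on \<Omega> and \<omega>\<close>

locale aw_twist_q = aw_twist + qscalars
begin

abbreviation "\<sigma> \<equiv> (`) (transpose s (Suc s))"

lemma family_c: "aw_family_q a b w n c q qi k h" and family_t: "aw_family_q a b w n t q qi k h"
  using aw_family_axioms aw_family_t qscalars_axioms by (simp_all add: aw_family_q_def)

lemma \<sigma>_other: "s \<notin> K \<Longrightarrow> Suc s \<notin> K \<Longrightarrow> \<sigma> K = K"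
  by (force simp: transpose_def image_iff)

lemma CS_t_Suc: "s \<notin> K \<Longrightarrow> Suc s \<notin> K \<Longrightarrow> K \<subseteq> {1..n} \<Longrightarrow> CS n t (insert (Suc s) K) = CS n c (insert s K)"
  using CS_t_swap [of "insert (Suc s) K"] \<sigma>_other [of K] e by simp

text \<open>The first three are half twists of \<open>{s}\<close> and \<open>{Suc s}\<close>; in the
  fourth all letters move in the favourable direction. In the last one \<open>{s}\<close> forms
  reversed letters with \<open>A\<close> or \<open>F\<close>, so it is obtained by subtraction from
  a sum that the exchange identity shows to be preserved.\<close>

lemma Om_t_cases:
  assumes "ordered4 A {s} {Suc s} F" "A \<union> {s} \<union> {Suc s} \<union> F \<subseteq> {1..n}"
  shows "Om n t {s} {Suc s} F = Om n c {s} {Suc s} F"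
    and "Om n t A {s} {Suc s} = Om n c A {s} {Suc s}"
    and "Om n t {s} {Suc s} (A \<union> F) = Om n c {s} {Suc s} (A \<union> F)"
    and "Om n t A {Suc s} F = Om n c A {s} F"
    and "Om n t A {s} F = Om n c A {Suc s} F"
proof -
  interpret CF: aw_family_q a b w n c q qi k h
    by (rule family_c)
  interpret TF: aw_family_q a b w n t q qi k h
    by (rule family_t)
  interpret X: convex4 a b w q qi k h "CS n c A" "CS n c {s}" "CS n c {Suc s}" "CS n c F" "CS n c (A \<union> {s} \<union> {Suc s} \<union> F)"
    "CS n c (A \<union> {s})" "CS n c ({s} \<union> {Suc s})" "CS n c ({Suc s} \<union> F)" "CS n c (A \<union> F)" "CS n c (A \<union> {Suc s})" "CS n c ({s} \<union> F)"
    "CS n c (A \<union> {s} \<union> {Suc s})" "CS n c ({s} \<union> {Suc s} \<union> F)" "CS n c (A \<union> {Suc s} \<union> F)" "CS n c (A \<union> {s} \<union> F)"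
    using assms by (rule CF.sets_convex4)
  interpret Y: convex4 a b w q qi k h "CS n t A" "CS n t {s}" "CS n t {Suc s}" "CS n t F" "CS n t (A \<union> {s} \<union> {Suc s} \<union> F)"
    "CS n t (A \<union> {s})" "CS n t ({s} \<union> {Suc s})" "CS n t ({Suc s} \<union> F)" "CS n t (A \<union> F)" "CS n t (A \<union> {Suc s})" "CS n t ({s} \<union> F)"
    "CS n t (A \<union> {s} \<union> {Suc s})" "CS n t ({s} \<union> {Suc s} \<union> F)" "CS n t (A \<union> {Suc s} \<union> F)" "CS n t (A \<union> {s} \<union> F)"
    using assms by (rule TF.sets_convex4)
  have notin: "s \<notin> A" "Suc s \<notin> A" "s \<notin> F" "Suc s \<notin> F"
    using assms(1) by (auto simp: ordered4_def set_less_def)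
  have sub: "A \<subseteq> {1..n}" "F \<subseteq> {1..n}"
    using assms(2) by auto
  have same: "CS n t K = CS n c K" "CS n t ({s} \<union> {Suc s} \<union> K) = CS n c ({s} \<union> {Suc s} \<union> K)"
    if "s \<notin> K" "Suc s \<notin> K" for K
    using that by (intro CS_t_same; simp)+
  have swap: "CS n t (insert (Suc s) K) = CS n c (insert s K)" if "K \<in> {{}, A, F, A \<union> F}" for K
    using that notin sub by (intro CS_t_Suc) auto
  have s1: "CS n t {Suc s} = CS n c {s}"
    using swap [of "{}"] by simp
  \<comment> \<open>A single element has no other piece to be reversed against, so here the
    unfavourable direction holds too.\<close>
  have s2: "CS n t {s} = CS n c {Suc s}"
  proof -
    have "CS n t {s} = t e s"
      using e by (intro TF.CS_interval) auto
    moreover have "CS n c {Suc s} = cy"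
      using e by (intro CS_interval) auto
    ultimately show ?thesis
      using e by (simp add: t_left_bridge bridge_degenerate)
  qed
  have eqs: "CS n t A = CS n c A" "CS n t F = CS n c F" "CS n t {Suc s} = CS n c {s}" "CS n t {s} = CS n c {Suc s}"
    "CS n t (A \<union> F) = CS n c (A \<union> F)" "CS n t ({s} \<union> {Suc s}) = CS n c ({s} \<union> {Suc s})"
    "CS n t (A \<union> {s} \<union> {Suc s}) = CS n c (A \<union> {s} \<union> {Suc s})"
    "CS n t ({s} \<union> {Suc s} \<union> F) = CS n c ({s} \<union> {Suc s} \<union> F)"
    "CS n t (A \<union> {s} \<union> {Suc s} \<union> F) = CS n c (A \<union> {s} \<union> {Suc s} \<union> F)"
    "CS n t (A \<union> {Suc s}) = CS n c (A \<union> {s})" "CS n t ({Suc s} \<union> F) = CS n c ({s} \<union> F)"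
    "CS n t (A \<union> {Suc s} \<union> F) = CS n c (A \<union> {s} \<union> F)"
    using notin s1 s2 swap [of A] swap [of F] swap [of "A \<union> F"]
    by (simp_all add: CS_t_same)
  show 1: "Om n t {s} {Suc s} F = Om n c {s} {Suc s} F"
    unfolding Om_def eqs by (rule X.Casimir_swap_234 [OF Y.T_2_3_4 [unfolded eqs]])
  have "Om n t A {s} {Suc s} = Casimir (CS n t {s}) (CS n t {Suc s}) (CS n t A) (CS n t ({s} \<union> {Suc s}))
      (CS n t (A \<union> {Suc s})) (CS n t (A \<union> {s})) (CS n t (A \<union> {s} \<union> {Suc s}))"
    unfolding Om_def by (rule Y.Casimir_rotate_123)
  also have "\<dots> = Casimir (CS n c {s}) (CS n c {Suc s}) (CS n c A) (CS n c ({s} \<union> {Suc s}))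
      (CS n c (A \<union> {Suc s})) (CS n c (A \<union> {s})) (CS n c (A \<union> {s} \<union> {Suc s}))"
    unfolding eqs by (rule X.Casimir_swap_123 [OF Y.T_2_3_1 [unfolded eqs]])
  also have "\<dots> = Om n c A {s} {Suc s}"
    unfolding Om_def by (rule X.Casimir_rotate_123 [symmetric])
  finally show 2: "Om n t A {s} {Suc s} = Om n c A {s} {Suc s}" .
  have un: "{Suc s} \<union> (A \<union> F) = A \<union> {Suc s} \<union> F" "{s} \<union> (A \<union> F) = A \<union> {s} \<union> F"
    "{s} \<union> {Suc s} \<union> (A \<union> F) = A \<union> {s} \<union> {Suc s} \<union> F" "A \<union> ({s} \<union> {Suc s}) = A \<union> {s} \<union> {Suc s}"
    by auto
  show 3: "Om n t {s} {Suc s} (A \<union> F) = Om n c {s} {Suc s} (A \<union> F)"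
    unfolding Om_def un eqs by (rule X.Casimir_swap_2341 [OF Y.T_2_3_41 [unfolded eqs]])
  show 4: "Om n t A {Suc s} F = Om n c A {s} F"
    unfolding Om_def eqs by (rule refl)
  have 5: "Om n t A ({s} \<union> {Suc s}) F = Om n c A ({s} \<union> {Suc s}) F"
    unfolding Om_def un eqs by (rule refl)
  \<comment> \<open>Two exchange identities with \<open>u\<close> eliminated, the value in which
    \<open>A\<close> is merged with \<open>{s}\<close>. On the right only values covered by the
    facts 1, 2, 3 and 5 remain.\<close>
  have sum: "d + f = m0 + e0 + b' - c0" if "u + b' = c0 + d" "m0 + e0 = u + f" for u b' c0 d m0 e0 f :: 'a
  proof -
    have "u = c0 + d - b'"
      using that(1) by (simp add: eq_diff_eq)
    with that(2) show ?thesis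
      by (simp add: algebra_simps)
  qed
  have "Om n t A {Suc s} F + Om n t A {s} F = Om n c A {Suc s} F + Om n c A {s} F"
    unfolding sum [OF CF.Om_exchange(1,2) [OF assms]] sum [OF TF.Om_exchange(1,2) [OF assms]]
    by (simp only: 1 2 3 5)
  then show "Om n t A {s} F = Om n c A {Suc s} F"
    unfolding 4 by (simp add: add.commute)
qed

lemma Om_t_same:
  assumes "s \<in> A \<longleftrightarrow> Suc s \<in> A" "s \<in> B \<longleftrightarrow> Suc s \<in> B" "s \<in> C \<longleftrightarrow> Suc s \<in> C"
  shows "Om n t A B C = Om n c A B C"
  unfolding Om_def using assms by (simp add: CS_t_same)

lemma Om_t_swap:
  assumes "s \<notin> A \<union> B \<union> C" "A \<union> B \<union> C \<subseteq> {1..n}"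
  shows "Om n t A B C = Om n c (\<sigma> A) (\<sigma> B) (\<sigma> C)"
proof -
  have "CS n t X = CS n c (\<sigma> X)" if "X \<subseteq> A \<union> B \<union> C" for X
  proof (cases "Suc s \<in> X")
    case True
    then show ?thesis
      using that assms by (intro CS_t_swap) auto
  next
    case False
    moreover have "s \<notin> X"
      using that assms by auto
    ultimately show ?thesis
      by (simp add: \<sigma>_other CS_t_same)
  qed
  moreover have "A \<union> B \<subseteq> A \<union> B \<union> C" "B \<union> C \<subseteq> A \<union> B \<union> C" "A \<union> C \<subseteq> A \<union> B \<union> C" "A \<subseteq> A \<union> B \<union> C"
    "B \<subseteq> A \<union> B \<union> C" "C \<subseteq> A \<union> B \<union> C"
    by auto
  ultimately show ?thesis
    unfolding Om_def image_Un [symmetric] by simp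
qed

lemma \<sigma>_singletons: "\<sigma> {s} = {Suc s}" "\<sigma> {Suc s} = {s}" "\<sigma> {s, Suc s} = {s, Suc s}"
  by auto

text \<open>The same elimination for a neighbouring pair at either end. With \<open>{s}\<close> and
  \<open>{Suc s}\<close> as first two or as last two sets, the sum of the two values in question is
  expressed by values that the twist preserves.\<close>

lemma Om_exchange_outer:
  assumes "aw_family_q a b w n f q qi k h" "ordered4 A B C F" "A \<union> B \<union> C \<union> F \<subseteq> {1..n}"
  shows "Om n f A C F + Om n f B C F = Om n f (A \<union> B) C F - Om n f A B (C \<union> F) + Om n f A B C + Om n f A B F"
proof -
  have "x + y = z - u + v + v'" if "m0 + y = z + v'" "u + x = m0 + v" for x y z u v v' m0 :: 'a
  proof -
    have "m0 = z + v' - y"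
      using that(1) by (simp add: eq_diff_eq)
    with that(2) show ?thesis
      by (simp add: algebra_simps)
  qed
  from this [OF aw_family_q.Om_exchange(2,3) [OF assms]] show ?thesis .
qed

lemma Om_t_left:
  assumes "ordered4 {s} {Suc s} C F" "{s} \<union> {Suc s} \<union> C \<union> F \<subseteq> {1..n}"
  shows "Om n t {s} C F = Om n c {Suc s} C F"
proof -
  have notin: "s \<notin> C" "Suc s \<notin> C" "s \<notin> F" "Suc s \<notin> F"
    using assms(1) by (auto simp: ordered4_def set_less_def)
  have 1: "Om n t {s} {Suc s} K = Om n c {s} {Suc s} K" if "K \<in> {C, F, C \<union> F}" for K
    using that assms by (intro Om_t_cases(1) [of "{}"]) (auto simp: ordered4_def set_less_def)
  have 2: "Om n t ({s} \<union> {Suc s}) C F = Om n c ({s} \<union> {Suc s}) C F"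
    using notin by (intro Om_t_same) auto
  have 3: "Om n t {Suc s} C F = Om n c {s} C F"
    using Om_t_swap [of "{Suc s}" C F] notin assms(2) by (simp add: \<sigma>_other)
  have "Om n t {s} C F + Om n t {Suc s} C F = Om n c {s} C F + Om n c {Suc s} C F"
    unfolding Om_exchange_outer [OF family_c assms] Om_exchange_outer [OF family_t assms]
    by (simp only: 1 [of C] 1 [of F] 1 [of "C \<union> F"] 2 insert_iff simp_thms)
  then show ?thesis
    unfolding 3 by (simp add: add.commute)
qed

lemma Om_t_right:
  assumes "ordered4 A B {s} {Suc s}" "A \<union> B \<union> {s} \<union> {Suc s} \<subseteq> {1..n}"
  shows "Om n t A B {s} = Om n c A B {Suc s}"
proof -
  have notin: "s \<notin> A" "Suc s \<notin> A" "s \<notin> B" "Suc s \<notin> B"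
    using assms(1) by (auto simp: ordered4_def set_less_def)
  have 1: "Om n t K {s} {Suc s} = Om n c K {s} {Suc s}" if "K \<in> {A, B, A \<union> B}" for K
    using that assms by (intro Om_t_cases(2) [of _ "{}"]) (auto simp: ordered4_def set_less_def)
  have 2: "Om n t A B ({s} \<union> {Suc s}) = Om n c A B ({s} \<union> {Suc s})"
    using notin by (intro Om_t_same) auto
  have 3: "Om n t A B {Suc s} = Om n c A B {s}"
    using Om_t_swap [of A B "{Suc s}"] notin assms(2) by (simp add: \<sigma>_other)
  have "Om n t A B {s} + Om n t A B {Suc s} = Om n c A B {s} + Om n c A B {Suc s}"
  proof -
    have swap: "y - z + x + x' = v' + v \<Longrightarrow> x + x' = v + v' - y + z" for x x' y z v v' :: 'a
    proof -
      assume "y - z + x + x' = v' + v"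
      then have "x + x' = v' + v - (y - z)"
        by (simp add: algebra_simps eq_diff_eq)
      then show ?thesis
        by (simp add: algebra_simps)
    qed
    note E = Om_exchange_outer [OF family_c assms] Om_exchange_outer [OF family_t assms]
    have "Om n f A B {s} + Om n f A B {Suc s} = Om n f A {s} {Suc s} + Om n f B {s} {Suc s}
        - Om n f (A \<union> B) {s} {Suc s} + Om n f A B ({s} \<union> {Suc s})" if "f = c \<or> f = t" for f
      using that E by (intro swap) (metis add.commute)
    then show ?thesis
      by (simp only: 1 [of A] 1 [of B] 1 [of "A \<union> B"] 2 insert_iff simp_thms)
  qed
  then show ?thesis
    unfolding 3 by (simp add: add.commute)
qed

lemma pair_subsets: "M \<subseteq> {x, y} \<Longrightarrow> M = {} \<or> M = {x} \<or> M = {y} \<or> M = {x, y}"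
  by auto

text \<open>The transposition acts inside a single argument here; this is the reason to keep
  \<open>s\<close> and \<open>Suc s\<close> in one block of the splitting whenever possible.\<close>

lemma Om_t_block:
  assumes "M \<subseteq> {s, Suc s}" "A \<union> B \<subseteq> {1..n} - {s, Suc s}" "set_less A B"
  shows "set_less A {s, Suc s} \<Longrightarrow> set_less {s, Suc s} B \<Longrightarrow> Om n t A M B = Om n c A (\<sigma> M) B"
    and "set_less {s, Suc s} (A \<union> B) \<Longrightarrow> Om n t M A B = Om n c (\<sigma> M) A B"
    and "set_less (A \<union> B) {s, Suc s} \<Longrightarrow> Om n t A B M = Om n c A B (\<sigma> M)"
proof -
  have notin: "s \<notin> A" "Suc s \<notin> A" "s \<notin> B" "Suc s \<notin> B" and sub: "A \<union> {s} \<union> {Suc s} \<union> B \<subseteq> {1..n}"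
    using assms(2) e by auto
  consider "M = {}" | "M = {s, Suc s}" | "M = {Suc s}" | "M = {s}"
    using pair_subsets [OF assms(1)] by blast
  note cases = this
  note oth = \<sigma>_other [OF notin(1,2)] \<sigma>_other [OF notin(3,4)] \<sigma>_singletons insert_commute [of "Suc s" s "{}"]
  show "Om n t A M B = Om n c A (\<sigma> M) B" if "set_less A {s, Suc s}" "set_less {s, Suc s} B"
  proof (rule cases)
    assume "M = {s}"
    moreover have "Om n t A {s} B = Om n c A {Suc s} B"
      using that assms(3) sub by (intro Om_t_cases(5)) (auto simp: ordered4_def set_less_def)
    ultimately show ?thesis
      by (simp add: oth)
  qed (use notin sub Om_t_swap [of A "{Suc s}" B] Om_t_same [of A M B] in \<open>simp_all add: oth\<close>)
  show "Om n t M A B = Om n c (\<sigma> M) A B" if "set_less {s, Suc s} (A \<union> B)"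
  proof (rule cases)
    assume "M = {s}"
    moreover have "Om n t {s} A B = Om n c {Suc s} A B"
      using that assms(3) sub by (intro Om_t_left) (auto simp: ordered4_def set_less_def)
    ultimately show ?thesis
      by (simp add: oth)
  qed (use notin sub Om_t_swap [of "{Suc s}" A B] Om_t_same [of M A B] in \<open>simp_all add: oth\<close>)
  show "Om n t A B M = Om n c A B (\<sigma> M)" if "set_less (A \<union> B) {s, Suc s}"
  proof (rule cases)
    assume "M = {s}"
    moreover have "Om n t A B {s} = Om n c A B {Suc s}"
      using that assms(3) sub by (intro Om_t_right) (auto simp: ordered4_def set_less_def)
    ultimately show ?thesis
      by (simp add: oth)
  qed (use notin sub Om_t_swap [of A B "{Suc s}"] Om_t_same [of A B M] in \<open>simp_all add: oth\<close>)
qed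

text \<open>The transposition may carry an element from one argument to the next. This does no harm:
  if just one of \<open>s\<close> and \<open>Suc s\<close> is present, both sides have an empty
  argument and vanish by \<open>Om_empty\<close>.\<close>

lemma Om_t_singles:
  assumes "K \<subseteq> {1..n}" "M \<subseteq> {s}" "M' \<subseteq> {Suc s}" "\<sigma> (M \<union> M') = N \<union> N'" "N \<subseteq> {s}" "N' \<subseteq> {Suc s}"
  shows "set_less {s, Suc s} K \<Longrightarrow> Om n t M M' K = Om n c N N' K"
    and "set_less K {s, Suc s} \<Longrightarrow> Om n t K M M' = Om n c K N N'"
proof -
  interpret CF: aw_family_q a b w n c q qi k h
    by (rule family_c)
  interpret TF: aw_family_q a b w n t q qi k h
    by (rule family_t)
  have ss: "s \<in> {1..n}" "Suc s \<in> {1..n}"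
    using e by auto
  have M: "M = {} \<or> M = {s}" "M' = {} \<or> M' = {Suc s}" "N = {} \<or> N = {s}" "N' = {} \<or> N' = {Suc s}"
    using assms(2,3,5,6) by blast+
  have out: "Suc s \<notin> M" "s \<notin> M'" "Suc s \<notin> N" "s \<notin> N'"
    using assms(2,3,5,6) by auto
  have "s \<in> N \<union> N' \<longleftrightarrow> Suc s \<in> M \<union> M'" "Suc s \<in> N \<union> N' \<longleftrightarrow> s \<in> M \<union> M'"
    unfolding assms(4) [symmetric] in_transpose_image by simp_all
  then have h: "s \<in> N \<longleftrightarrow> Suc s \<in> M'" "Suc s \<in> N' \<longleftrightarrow> s \<in> M"
    using out by blast+
  consider "M = {}" "N' = {}" | "M' = {}" "N = {}" | "M = {s}" "M' = {Suc s}" "N = {s}" "N' = {Suc s}"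
    using M h by blast
  note cases = this
  have pair: "M \<subseteq> {s, Suc s}" "M' \<subseteq> {s, Suc s}" "N \<subseteq> {s, Suc s}" "N' \<subseteq> {s, Suc s}"
    using assms(2,3,5,6) by blast+
  have sub: "Z \<union> K \<subseteq> {1..n}" "K \<union> Z \<subseteq> {1..n}" if "Z \<subseteq> {s, Suc s}" for Z
    using that assms(1) ss by blast+
  show "Om n t M M' K = Om n c N N' K" if less: "set_less {s, Suc s} K"
  proof -
    have sl: "set_less Z K" if "Z \<subseteq> {s, Suc s}" for Z
      using that less unfolding set_less_def by blast
    show ?thesis
    proof (rule cases)
      assume eq: "M = {s}" "M' = {Suc s}" "N = {s}" "N' = {Suc s}"
      have "ordered4 {} {s} {Suc s} K" "{} \<union> {s} \<union> {Suc s} \<union> K \<subseteq> {1..n}"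
        using less assms(1) ss unfolding ordered4_def set_less_def by auto
      then show ?thesis
        unfolding eq by (rule Om_t_cases(1))
    next
      assume "M = {}" "N' = {}"
      then show ?thesis
        using TF.Om_empty(1) [OF sl sub(1), OF pair(2) pair(2)] CF.Om_empty(2) [OF sl sub(1), OF pair(3) pair(3)]
        by (simp only:)
    next
      assume "M' = {}" "N = {}"
      then show ?thesis
        using TF.Om_empty(2) [OF sl sub(1), OF pair(1) pair(1)] CF.Om_empty(1) [OF sl sub(1), OF pair(4) pair(4)]
        by (simp only:)
    qed
  qed
  show "Om n t K M M' = Om n c K N N'" if less: "set_less K {s, Suc s}"
  proof -
    have sl: "set_less K Z" if "Z \<subseteq> {s, Suc s}" for Z
      using that less unfolding set_less_def by blast
    show ?thesis
    proof (rule cases)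
      assume eq: "M = {s}" "M' = {Suc s}" "N = {s}" "N' = {Suc s}"
      have "ordered4 K {s} {Suc s} {}" "K \<union> {s} \<union> {Suc s} \<union> {} \<subseteq> {1..n}"
        using less assms(1) ss unfolding ordered4_def set_less_def by auto
      then show ?thesis
        unfolding eq by (rule Om_t_cases(2))
    next
      assume "M = {}" "N' = {}"
      then show ?thesis
        using TF.Om_empty(2) [OF sl sub(2), OF pair(2) pair(2)] CF.Om_empty(3) [OF sl sub(2), OF pair(3) pair(3)]
        by (simp only:)
    next
      assume "M' = {}" "N = {}"
      then show ?thesis
        using TF.Om_empty(3) [OF sl sub(2), OF pair(1) pair(1)] CF.Om_empty(2) [OF sl sub(2), OF pair(4) pair(4)]
        by (simp only:)
    qed
  qed
qed

lemma omega_sum_transfer: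
  assumes "A' \<union> B' \<union> C' = \<sigma> (A \<union> B \<union> C)"
    and "\<And>X. X \<subseteq> A \<union> B \<union> C \<Longrightarrow> Om n t (X \<inter> A) (X \<inter> B) (X \<inter> C) = Om n c (\<sigma> X \<inter> A') (\<sigma> X \<inter> B') (\<sigma> X \<inter> C')"
  shows "omega_sum n t A B C = omega_sum n c A' B' C'"
  unfolding omega_sum_def assms(1) alt_image [OF inj_transpose] by (rule alt_cong) (rule assms(2))

lemma \<sigma>_Int: "\<sigma> (X \<inter> Y) = \<sigma> X \<inter> \<sigma> Y"
  by (rule image_Int) simp

lemma \<sigma>_Int_other: "s \<notin> K \<Longrightarrow> Suc s \<notin> K \<Longrightarrow> \<sigma> X \<inter> K = X \<inter> K"
proof -
  assume "s \<notin> K" "Suc s \<notin> K"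
  then have "x \<in> \<sigma> X \<inter> K \<longleftrightarrow> x \<in> X \<inter> K" for x
    by (cases "x = s"; cases "x = Suc s") (auto simp: in_transpose_image transpose_def)
  then show ?thesis
    by blast
qed

text \<open>By \<open>omega_sum_unique\<close> the splittings of \<open>S\<close> and of its image
  can be chosen at will. If \<open>S\<close> has elements on both sides, its part in
  \<open>{s, Suc s}\<close> is taken as the middle block; if one side is empty, this part is an
  outer block, or two singleton blocks when it has two elements.\<close>

theorem omega_sum_t:
  assumes S: "S \<subseteq> {1..n}" "card S \<ge> 3"
    and split: "ordered_splitting S I1 I2 I3" "ordered_splitting (\<sigma> S) J1 J2 J3"
  shows "omega_sum n t I1 I2 I3 = omega_sum n c J1 J2 J3"
proof -
  interpret CF: aw_family_q a b w n c q qi k h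
    by (rule family_c)
  interpret TF: aw_family_q a b w n t q qi k h
    by (rule family_t)
  have \<sigma>S: "\<sigma> S \<subseteq> {1..n}"
    using S(1) e by (intro transpose_image_subset) auto
  have main: "omega_sum n t I1 I2 I3 = omega_sum n c J1 J2 J3"
    if 1: "ordered_splitting S A B C" "ordered_splitting (\<sigma> S) A' B' C'"
      and 2: "\<And>X. X \<subseteq> S \<Longrightarrow> Om n t (X \<inter> A) (X \<inter> B) (X \<inter> C) = Om n c (\<sigma> X \<inter> A') (\<sigma> X \<inter> B') (\<sigma> X \<inter> C')"
    for A B C A' B' C'
  proof -
    have "A \<union> B \<union> C = S" "A' \<union> B' \<union> C' = \<sigma> S"
      using 1 by (simp_all add: ordered_splitting_def)
    then have "omega_sum n t A B C = omega_sum n c A' B' C'"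
      using 2 by (intro omega_sum_transfer) auto
    then show ?thesis
      using TF.omega_sum_unique [OF S(1) split(1) 1(1)] CF.omega_sum_unique [OF \<sigma>S split(2) 1(2)] by simp
  qed
  define P M Q where P: "P = S \<inter> {..<s}" and M: "M = S \<inter> {s, Suc s}" and Q: "Q = S \<inter> {Suc s<..}"
  have SPMQ: "S = P \<union> M \<union> Q"
    by (auto simp: P M Q)
  have M_sub: "M \<subseteq> {s, Suc s}" and \<sigma>M_sub: "\<sigma> M \<subseteq> {s, Suc s}"
    by (auto simp: M)
  have notin: "s \<notin> P" "Suc s \<notin> P" "s \<notin> Q" "Suc s \<notin> Q"
    by (auto simp: P Q)
  have \<sigma>SPMQ: "\<sigma> S = P \<union> \<sigma> M \<union> Q"
    using notin by (simp add: SPMQ image_Un \<sigma>_other)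
  have fin: "finite P" "finite Q" "finite M"
    using finite_subset [OF S(1)] by (auto simp: P Q M)
  have less: "set_less P {s, Suc s}" "set_less {s, Suc s} Q" "set_less P Q"
    by (auto simp: P Q set_less_def)
  have in_n: "P \<subseteq> {1..n}" "Q \<subseteq> {1..n}" "P \<union> Q \<subseteq> {1..n} - {s, Suc s}"
    using S(1) notin by (auto simp: P Q)
  have lessM: "set_less P M" "set_less M Q" "set_less P (\<sigma> M)" "set_less (\<sigma> M) Q"
    using less M_sub \<sigma>M_sub by (auto simp: set_less_def)
  have mono: "set_less (X \<inter> U) (X \<inter> V)" if "set_less U V" for X U V
    using that by (auto simp: set_less_def)
  consider "M = {}" | "M \<noteq> {}" "P \<noteq> {}" "Q \<noteq> {}" | "M = {s, Suc s}" "P = {}" | "M \<noteq> {s, Suc s}" "M \<noteq> {}" "P = {}"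
    | "M = {s, Suc s}" "Q = {}" | "M \<noteq> {s, Suc s}" "M \<noteq> {}" "Q = {}"
    by blast
  then show ?thesis
  proof cases
    case 1
    then have "s \<notin> S" "Suc s \<notin> S"
      by (auto simp: M)
    moreover from this have "\<sigma> S = S"
      by (rule \<sigma>_other)
    moreover have "\<sigma> X = X" if "X \<subseteq> S" for X
      using that calculation by (intro \<sigma>_other) auto
    ultimately show ?thesis
      using split(1) by (intro main [of I1 I2 I3 I1 I2 I3] Om_t_same [THEN trans]) auto
  next
    case 2
    show ?thesis
    proof (rule main)
      show "ordered_splitting S P M Q" "ordered_splitting (\<sigma> S) P (\<sigma> M) Q"
        using 2 lessM by (simp_all add: ordered_splitting_def flip: SPMQ \<sigma>SPMQ)
      fix X assume "X \<subseteq> S"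
      have "Om n t (X \<inter> P) (X \<inter> M) (X \<inter> Q) = Om n c (X \<inter> P) (\<sigma> (X \<inter> M)) (X \<inter> Q)"
        using M_sub in_n less by (intro Om_t_block) (auto simp: set_less_def)
      then show "Om n t (X \<inter> P) (X \<inter> M) (X \<inter> Q) = Om n c (\<sigma> X \<inter> P) (\<sigma> X \<inter> \<sigma> M) (\<sigma> X \<inter> Q)"
        using notin by (simp add: \<sigma>_Int \<sigma>_Int_other)
    qed
  next
    \<comment> \<open>\<open>S\<close> may have just one further element, so three non-empty blocks
      can force \<open>s\<close> and \<open>Suc s\<close> apart.\<close>
    case 3
    then have \<sigma>S_eq: "\<sigma> S = S" and S_eq: "S = {s} \<union> {Suc s} \<union> Q"
      using \<sigma>SPMQ SPMQ \<sigma>_singletons by auto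
    have "Q \<noteq> {}"
      using S(2) S_eq by auto
    show ?thesis
    proof (rule main)
      show "ordered_splitting S {s} {Suc s} Q"
        using \<open>Q \<noteq> {}\<close> less S_eq by (auto simp: ordered_splitting_def set_less_def)
      then show "ordered_splitting (\<sigma> S) {s} {Suc s} Q"
        by (simp only: \<sigma>S_eq)
      fix X assume "X \<subseteq> S"
      have "\<sigma> (X \<inter> {s} \<union> X \<inter> {Suc s}) = \<sigma> X \<inter> {s} \<union> \<sigma> X \<inter> {Suc s}"
        by (simp only: image_Un \<sigma>_Int \<sigma>_singletons Un_commute)
      then have "Om n t (X \<inter> {s}) (X \<inter> {Suc s}) (X \<inter> Q) = Om n c (\<sigma> X \<inter> {s}) (\<sigma> X \<inter> {Suc s}) (X \<inter> Q)"
        using in_n less by (intro Om_t_singles(1)) (auto simp: set_less_def)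
      then show "Om n t (X \<inter> {s}) (X \<inter> {Suc s}) (X \<inter> Q) = Om n c (\<sigma> X \<inter> {s}) (\<sigma> X \<inter> {Suc s}) (\<sigma> X \<inter> Q)"
        using notin by (simp add: \<sigma>_Int_other)
    qed
  next
    \<comment> \<open>Only one of \<open>s\<close> and \<open>Suc s\<close> belongs to
      \<open>S\<close>, so at least two elements above them are available for the other two
      blocks.\<close>
    case 4
    define Q1 Q2 where Q1: "Q1 = {Min Q}" and Q2: "Q2 = Q - {Min Q}"
    have "card M \<le> 1"
      using pair_subsets [OF M_sub] 4 by auto
    moreover have "card S \<le> card M + card Q"
      using card_Un_le [of M Q] SPMQ 4 by simp
    ultimately have "card Q \<ge> 2"
      using S(2) by simp
    then have Q_ne: "Q \<noteq> {}" and "Q2 \<noteq> {}"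
      using card_mono [of "{Min Q}" Q] by (auto simp: Q2)
    have Q_in: "Min Q \<in> Q"
      by (rule Min_in [OF fin(2) Q_ne])
    then have Q_un: "Q = Q1 \<union> Q2"
      unfolding Q1 Q2 by blast
    have "set_less Q1 Q2"
      unfolding set_less_def Q1 Q2
    proof (intro ballI)
      fix x y assume "x \<in> {Min Q}" "y \<in> Q - {Min Q}"
      then show "x < y"
        using Min_le [OF fin(2), of y] by (intro le_neq_implies_less) blast+
    qed
    note Q_eq = Q_un this Q_in
    have Qsub: "Q1 \<subseteq> Q" "Q2 \<subseteq> Q"
      using Q_in unfolding Q1 Q2 by blast+
    have ne: "Q1 \<noteq> {}" "\<sigma> M \<noteq> {}"
      using 4(2) unfolding Q1 by simp_all
    have lessQ: "set_less M Q1" "set_less (\<sigma> M) Q1"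
      using lessM(2,4) Qsub(1) unfolding set_less_def by blast+
    have SM: "S = M \<union> Q" and \<sigma>SM: "\<sigma> S = \<sigma> M \<union> Q"
      using SPMQ \<sigma>SPMQ unfolding 4(3) Un_empty_left by blast+
    have un: "M \<union> Q1 \<union> Q2 = S" "\<sigma> M \<union> Q1 \<union> Q2 = \<sigma> S"
      unfolding Un_assoc Q_un [symmetric] by (rule SM [symmetric], rule \<sigma>SM [symmetric])
    show ?thesis
    proof (rule main)
      show "ordered_splitting S M Q1 Q2" "ordered_splitting (\<sigma> S) (\<sigma> M) Q1 Q2"
        unfolding ordered_splitting_def
        by (intro conjI 4(2) ne \<open>Q2 \<noteq> {}\<close> lessQ Q_eq(2) un)+
      fix X assume "X \<subseteq> S"
      have block: "Om n t (X \<inter> M) (X \<inter> Q1) (X \<inter> Q2) = Om n c (\<sigma> (X \<inter> M)) (X \<inter> Q1) (X \<inter> Q2)"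
      proof (rule Om_t_block(2))
        show "X \<inter> M \<subseteq> {s, Suc s}"
          using M_sub by blast
        show "X \<inter> Q1 \<union> X \<inter> Q2 \<subseteq> {1..n} - {s, Suc s}"
          using Qsub in_n(3) by blast
        show "set_less (X \<inter> Q1) (X \<inter> Q2)"
          by (rule mono [OF Q_eq(2)])
        show "set_less {s, Suc s} (X \<inter> Q1 \<union> X \<inter> Q2)"
          using less(2) Qsub unfolding set_less_def by blast
      qed
      have "s \<notin> Q1" "Suc s \<notin> Q1" "s \<notin> Q2" "Suc s \<notin> Q2"
        using notin(3,4) Qsub by blast+
      then have "\<sigma> X \<inter> Q1 = X \<inter> Q1" "\<sigma> X \<inter> Q2 = X \<inter> Q2"
        by (simp_all add: \<sigma>_Int_other)
      then show "Om n t (X \<inter> M) (X \<inter> Q1) (X \<inter> Q2) = Om n c (\<sigma> X \<inter> \<sigma> M) (\<sigma> X \<inter> Q1) (\<sigma> X \<inter> Q2)"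
        using block by (simp only: \<sigma>_Int)
    qed
  next
    case 5
    have "S = P \<union> {s, Suc s}"
      using SPMQ unfolding 5 Un_empty_right .
    then have S_eq: "S = P \<union> {s} \<union> {Suc s}"
      by blast
    have "\<sigma> S = P \<union> {s, Suc s}"
      using \<sigma>SPMQ unfolding 5 Un_empty_right \<sigma>_singletons .
    then have \<sigma>S_eq: "\<sigma> S = S"
      unfolding \<open>S = P \<union> {s, Suc s}\<close> .
    have "P \<noteq> {}"
      using S(2) S_eq by auto
    show ?thesis
    proof (rule main)
      have "set_less P {s}" "set_less {s} {Suc s}"
        using less(1) unfolding set_less_def by auto
      then show split5: "ordered_splitting S P {s} {Suc s}"
        unfolding ordered_splitting_def using \<open>P \<noteq> {}\<close> S_eq by (blast | auto)
      show "ordered_splitting (\<sigma> S) P {s} {Suc s}"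
        unfolding \<sigma>S_eq by (rule split5)
      fix X assume "X \<subseteq> S"
      have eq: "\<sigma> (X \<inter> {s} \<union> X \<inter> {Suc s}) = \<sigma> X \<inter> {s} \<union> \<sigma> X \<inter> {Suc s}"
        by (simp only: image_Un \<sigma>_Int \<sigma>_singletons Un_commute)
      have singles: "Om n t (X \<inter> P) (X \<inter> {s}) (X \<inter> {Suc s}) = Om n c (X \<inter> P) (\<sigma> X \<inter> {s}) (\<sigma> X \<inter> {Suc s})"
      proof (rule Om_t_singles(2))
        show "X \<inter> P \<subseteq> {1..n}"
          using in_n(1) by blast
        show "set_less (X \<inter> P) {s, Suc s}"
          using less(1) unfolding set_less_def by blast
        show "\<sigma> (X \<inter> {s} \<union> X \<inter> {Suc s}) = \<sigma> X \<inter> {s} \<union> \<sigma> X \<inter> {Suc s}"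
          by (rule eq)
      qed blast+
      have "\<sigma> X \<inter> P = X \<inter> P"
        using notin(1,2) by (rule \<sigma>_Int_other)
      then show "Om n t (X \<inter> P) (X \<inter> {s}) (X \<inter> {Suc s}) = Om n c (\<sigma> X \<inter> P) (\<sigma> X \<inter> {s}) (\<sigma> X \<inter> {Suc s})"
        using singles by (simp only:)
    qed
  next
    case 6
    define P1 P2 where P1: "P1 = P - {Max P}" and P2: "P2 = {Max P}"
    have "card M \<le> 1"
      using pair_subsets [OF M_sub] 6 by auto
    moreover have "card S \<le> card P + card M"
      using card_Un_le [of P M] SPMQ 6 by simp
    ultimately have "card P \<ge> 2"
      using S(2) by simp
    then have P_ne: "P \<noteq> {}" and "P1 \<noteq> {}"
      using card_mono [of "{Max P}" P] by (auto simp: P1)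
    have P_in: "Max P \<in> P"
      by (rule Max_in [OF fin(1) P_ne])
    then have P_un: "P = P1 \<union> P2"
      unfolding P1 P2 by blast
    have "set_less P1 P2"
      unfolding set_less_def P1 P2
    proof (intro ballI)
      fix x y assume "x \<in> P - {Max P}" "y \<in> {Max P}"
      then show "x < y"
        using Max_ge [OF fin(1), of x] by (intro le_neq_implies_less) blast+
    qed
    note P_eq = P_un this P_in
    have Psub: "P1 \<subseteq> P" "P2 \<subseteq> P"
      using P_in unfolding P1 P2 by blast+
    have ne: "P2 \<noteq> {}" "\<sigma> M \<noteq> {}"
      using 6(2) unfolding P2 by simp_all
    have lessP: "set_less P2 M" "set_less P2 (\<sigma> M)"
      using lessM(1,3) Psub(2) unfolding set_less_def by blast+
    have SM: "S = P \<union> M" and \<sigma>SM: "\<sigma> S = P \<union> \<sigma> M"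
      using SPMQ \<sigma>SPMQ unfolding 6(3) Un_empty_right by blast+
    have un: "P1 \<union> P2 \<union> M = S" "P1 \<union> P2 \<union> \<sigma> M = \<sigma> S"
      unfolding P_un [symmetric] by (rule SM [symmetric], rule \<sigma>SM [symmetric])
    show ?thesis
    proof (rule main)
      show "ordered_splitting S P1 P2 M" "ordered_splitting (\<sigma> S) P1 P2 (\<sigma> M)"
        unfolding ordered_splitting_def
        by (intro conjI 6(2) ne \<open>P1 \<noteq> {}\<close> lessP P_eq(2) un)+
      fix X assume "X \<subseteq> S"
      have block: "Om n t (X \<inter> P1) (X \<inter> P2) (X \<inter> M) = Om n c (X \<inter> P1) (X \<inter> P2) (\<sigma> (X \<inter> M))"
      proof (rule Om_t_block(3))
        show "X \<inter> M \<subseteq> {s, Suc s}"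
          using M_sub by blast
        show "X \<inter> P1 \<union> X \<inter> P2 \<subseteq> {1..n} - {s, Suc s}"
          using Psub in_n(3) by blast
        show "set_less (X \<inter> P1) (X \<inter> P2)"
          by (rule mono [OF P_eq(2)])
        show "set_less (X \<inter> P1 \<union> X \<inter> P2) {s, Suc s}"
          using less(1) Psub unfolding set_less_def by blast
      qed
      have "s \<notin> P1" "Suc s \<notin> P1" "s \<notin> P2" "Suc s \<notin> P2"
        using notin(1,2) Psub by blast+
      then have "\<sigma> X \<inter> P1 = X \<inter> P1" "\<sigma> X \<inter> P2 = X \<inter> P2"
        by (simp_all add: \<sigma>_Int_other)
      then show "Om n t (X \<inter> P1) (X \<inter> P2) (X \<inter> M) = Om n c (\<sigma> X \<inter> P1) (\<sigma> X \<inter> P2) (\<sigma> X \<inter> \<sigma> M)"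
        using block by (simp only: \<sigma>_Int)
    qed
  qed
qed

end

section \<open>The algebra aw(n)\<close>

abbreviation "Fc n \<equiv> carrier (free_aw n)"

lemma Fc_iff: "A \<in> Fc n \<longleftrightarrow> (\<forall>w\<in>Poly_Mapping.keys A. \<forall>I\<in>set (letters w). connected_in n I)"
  by (simp add: free_aw_def)

lemma free_aw_ops:
  "add (free_aw n) = (+)" "mult (free_aw n) = (*)" "one (free_aw n) = 1" "zero (free_aw n) = 0"
  by (simp_all add: free_aw_def)

lemma Fc_single: "(\<And>I. I \<in> set (letters u) \<Longrightarrow> connected_in n I) \<Longrightarrow> Poly_Mapping.single u x \<in> Fc n"
  by (simp add: Fc_iff)

lemma Fc_closed:
  "1 \<in> Fc n" "0 \<in> Fc n" "scalar x \<in> Fc n"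
  "A \<in> Fc n \<Longrightarrow> B \<in> Fc n \<Longrightarrow> A + B \<in> Fc n"
  "A \<in> Fc n \<Longrightarrow> - A \<in> Fc n"
  "A \<in> Fc n \<Longrightarrow> B \<in> Fc n \<Longrightarrow> A - B \<in> Fc n"
  "A \<in> Fc n \<Longrightarrow> B \<in> Fc n \<Longrightarrow> A * B \<in> Fc n"
proof -
  show s: "scalar x \<in> Fc n" for x
    unfolding scalar_def by (rule Fc_single) (simp add: zero_aw_word_def)
  show "1 \<in> Fc n" "0 \<in> Fc n"
    using s [of 1] s [of 0] by (simp_all add: scalar_def)
  show add: "A + B \<in> Fc n" if "A \<in> Fc n" "B \<in> Fc n" for A B
    using that Poly_Mapping.keys_add [of A B] unfolding Fc_iff by blast
  show neg: "- A \<in> Fc n" if "A \<in> Fc n" for A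
    using that unfolding Fc_iff by (simp add: in_keys_iff)
  show "A - B \<in> Fc n" if "A \<in> Fc n" "B \<in> Fc n"
    using add [OF that(1) neg [OF that(2)]] by simp
  show "A * B \<in> Fc n" if "A \<in> Fc n" "B \<in> Fc n"
    unfolding Fc_iff
  proof (intro ballI)
    fix u I assume "u \<in> Poly_Mapping.keys (A * B)" "I \<in> set (letters u)"
    then obtain v v' where "v \<in> Poly_Mapping.keys A" "v' \<in> Poly_Mapping.keys B" "u = v + v'"
      using Poly_Mapping.keys_mult [of A B] by blast
    then show "connected_in n I"
      using that \<open>I \<in> set (letters u)\<close> unfolding Fc_iff by (auto simp: plus_aw_word_def)
  qed
qed

lemma ring_free_aw: "ring (free_aw n)"
proof (rule ringI)
  show "abelian_group (free_aw n)"
  proof (rule abelian_groupI)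
    show "\<exists>y\<in>Fc n. y \<oplus>\<^bsub>free_aw n\<^esub> x = \<zero>\<^bsub>free_aw n\<^esub>" if "x \<in> Fc n" for x
      using that by (intro bexI [of _ "- x"]) (simp_all add: free_aw_ops Fc_closed)
  qed (simp_all add: free_aw_ops Fc_closed add.assoc add.commute)
  show "Group.monoid (free_aw n)"
    by (rule Group.monoidI) (simp_all add: free_aw_ops Fc_closed mult.assoc)
qed (simp_all add: free_aw_ops algebra_simps)

lemma scalar_hom:
  "scalar (x * y) = scalar x * scalar y" "scalar (x + y) = scalar x + scalar y" "scalar (x - y) = scalar x - scalar y"
  "scalar 1 = 1"
  by (simp_all add: scalar_def mult_single single_add single_diff)

lemma scalar_commute: "scalar x * A = A * scalar x"
proof -
  have *: "scalar x * Poly_Mapping.single u y = Poly_Mapping.single u y * scalar x" for u y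
    by (simp add: scalar_def mult_single mult.commute)
  have "scalar x * (\<Sum>u\<in>K. Poly_Mapping.single u (f u)) = (\<Sum>u\<in>K. Poly_Mapping.single u (f u)) * scalar x" for K f
    by (simp add: sum_distrib_left sum_distrib_right *)
  moreover have "A = (\<Sum>u\<in>Poly_Mapping.keys A. Poly_Mapping.single u (Poly_Mapping.lookup A u))"
    by (rule poly_mapping_eqI) (simp add: lookup_sum lookup_single when_def in_keys_iff sum.delta')
  ultimately show ?thesis
    by metis
qed

definition gen :: "nat \<Rightarrow> nat \<Rightarrow> free_alg"
  where "gen i k = C_conn {i<..k}"

lemma gen_unit: "k \<le> i \<Longrightarrow> gen i k = 1"
  by (simp add: gen_def C_conn_def)

lemma connected_greaterThan: "i < k \<Longrightarrow> connected_set {i<..k}"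
  unfolding connected_set_def by (intro exI [of _ "Suc i"] exI [of _ k]) (auto simp: Suc_le_eq)

lemma connected_in_iff: "connected_in n I \<longleftrightarrow> (\<exists>i k. i < k \<and> k \<le> n \<and> I = {i<..k})"
proof
  assume "connected_in n I"
  then obtain l u where lu: "l \<le> u" "I = {l..u}" "I \<subseteq> {1..n}"
    by (auto simp: connected_in_def connected_set_def)
  then have "1 \<le> l" "u \<le> n"
    by auto
  then show "\<exists>i k. i < k \<and> k \<le> n \<and> I = {i<..k}"
    using lu by (intro exI [of _ "l - 1"] exI [of _ u]) auto
next
  assume "\<exists>i k. i < k \<and> k \<le> n \<and> I = {i<..k}"
  then show "connected_in n I"
    using connected_greaterThan by (auto simp: connected_in_def)
qed

lemma gen_closed: "k \<le> n \<Longrightarrow> gen i k \<in> Fc n"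
proof (cases "i < k")
  case True
  assume "k \<le> n"
  with True have "connected_in n {i<..k}"
    by (auto simp: connected_in_iff)
  then show ?thesis
    using True by (auto simp: gen_def C_conn_def intro!: Fc_single)
qed (simp add: gen_unit Fc_closed)

lemma adjacent_iff:
  assumes "i < j" "j \<le> k" "k < l"
  shows "adjacent {i<..j} {k<..l} \<longleftrightarrow> k = j" "adjacent {k<..l} {i<..j} \<longleftrightarrow> k = j"
proof -
  have "connected_set ({i<..j} \<union> {k<..l}) \<longleftrightarrow> k = j"
  proof
    assume "connected_set ({i<..j} \<union> {k<..l})"
    then obtain x y where eq: "{i<..j} \<union> {k<..l} = {x..y}"
      by (auto simp: connected_set_def)
    then have "j \<in> {x..y}" "l \<in> {x..y}"
      using assms by auto
    then have "Suc j \<in> {x..y}"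
      using assms by auto
    then show "k = j"
      using assms unfolding eq [symmetric] by auto
  next
    assume "k = j"
    then have "{i<..j} \<union> {k<..l} = {i<..l}"
      using assms by auto
    then show "connected_set ({i<..j} \<union> {k<..l})"
      using connected_greaterThan [of i l] assms by simp
  qed
  moreover have "{i<..j} \<inter> {k<..l} = {}"
    using assms by auto
  ultimately show "adjacent {i<..j} {k<..l} \<longleftrightarrow> k = j" "adjacent {k<..l} {i<..j} \<longleftrightarrow> k = j"
    unfolding adjacent_def Un_commute [of "{k<..l}"] Int_commute [of "{k<..l}"]
    using connected_greaterThan assms by simp_all
qed

lemma adjacent_commute: "adjacent I J \<longleftrightarrow> adjacent J I"
  unfolding adjacent_def Un_commute [of J] Int_commute [of J] by blast

lemma set_less_interval:
  "i < j \<Longrightarrow> set_less {i<..j} {x} \<longleftrightarrow> j < x" "k < l \<Longrightarrow> set_less {x} {k<..l} \<longleftrightarrow> x \<le> k"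
proof -
  show "set_less {i<..j} {x} \<longleftrightarrow> j < x" if "i < j"
    using that bspec [of "{i<..j}" "\<lambda>y. y < x" j] by (auto simp: set_less_def)
  show "set_less {x} {k<..l} \<longleftrightarrow> x \<le> k" if "k < l"
  proof -
    have "Suc k \<in> {k<..l}"
      using that by simp
    then have "set_less {x} {k<..l} \<Longrightarrow> x < Suc k"
      unfolding set_less_def by blast
    then show ?thesis
      by (auto simp: set_less_def)
  qed
qed

lemma hole_intervals:
  assumes "i < j" "j < k" "k < l"
  shows "hole {i<..j} {k<..l} = {j<..k}" "hole {k<..l} {i<..j} = {j<..k}"
proof -
  have "x \<in> hole {i<..j} {k<..l} \<longleftrightarrow> x \<in> {j<..k}" "x \<in> hole {k<..l} {i<..j} \<longleftrightarrow> x \<in> {j<..k}" for x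
    unfolding hole_def mem_Collect_eq set_less_interval [OF assms(1)] set_less_interval [OF assms(3)]
    using assms by auto
  then show "hole {i<..j} {k<..l} = {j<..k}" "hole {k<..l} {i<..j} = {j<..k}"
    by blast+
qed

lemma Un_intervals:
  "i \<le> j \<Longrightarrow> j \<le> k \<Longrightarrow> {i<..j} \<union> {j<..k} = {i<..k::nat}" "i \<le> j \<Longrightarrow> j \<le> k \<Longrightarrow> {j<..k} \<union> {i<..j} = {i<..k::nat}"
  by auto

text \<open>The forms of \<open>bridge\<close> and \<open>bridge'\<close> in the free algebra, with
  summands and factors in the order in which \<open>C_rec\<close> yields them.\<close>

definition fbridge :: "nat \<Rightarrow> nat \<Rightarrow> nat \<Rightarrow> nat \<Rightarrow> free_alg"
  where "fbridge i j k l = - qcomm (gen i k) (gen j l) + gen i j * gen k l + gen j k * gen i l"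

definition fbridge' :: "nat \<Rightarrow> nat \<Rightarrow> nat \<Rightarrow> nat \<Rightarrow> free_alg"
  where "fbridge' i j k l = - qcomm (gen j l) (gen i k) + gen k l * gen i j + gen j k * gen i l"

lemma C_seq_gen: "C_seq [{i<..k}] = gen i k"
  by (simp add: C_seq_def gen_def C_conn_def)

lemma C_seq_adjacent:
  assumes "i < j" "j < k"
  shows "C_seq [{i<..j}, {j<..k}] = gen i k" "C_seq [{j<..k}, {i<..j}] = gen i k"
  using assms adjacent_iff [of i j j k] by (simp_all add: C_seq_def gen_def Un_intervals)

lemma C_seq_gap:
  assumes "i < j" "j < k" "k < l"
  shows "C_seq [{i<..j}, {k<..l}] = fbridge i j k l" "C_seq [{k<..l}, {i<..j}] = fbridge' i j k l"
proof -
  have "{k<..l} \<union> {j<..k} = {j<..l}" "{j<..k} \<union> {i<..j} = {i<..k}" "{i<..j} \<union> {j<..k} = {i<..k}"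
    "{j<..k} \<union> {k<..l} = {j<..l}" "{i<..k} \<union> {k<..l} = {i<..l}" "{j<..l} \<union> {i<..j} = {i<..l}"
    using assms by auto
  then show "C_seq [{i<..j}, {k<..l}] = fbridge i j k l" "C_seq [{k<..l}, {i<..j}] = fbridge' i j k l"
    using assms adjacent_iff [of i j k l] hole_intervals [OF assms]
    by (simp_all add: C_seq_def Let_def fbridge_def fbridge'_def gen_def)
qed

lemma C_seq_gap_adjacent:
  assumes "i < j" "j < k" "k < l" "l < p"
  shows "C_seq [{i<..j}, {k<..l}, {l<..p}] = fbridge i j k p" "C_seq [{l<..p}, {j<..k}, {i<..j}] = fbridge' i k l p"
proof -
  have "adjacent {k<..l} {l<..p}" "{k<..l} \<union> {l<..p} = {k<..p}" "adjacent {j<..k} {i<..j}" "{j<..k} \<union> {i<..j} = {i<..k}"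
    using assms by (auto simp: adjacent_iff)
  then have "C_seq [{i<..j}, {k<..l}, {l<..p}] = C_seq [{i<..j}, {k<..p}]"
    "C_seq [{l<..p}, {j<..k}, {i<..j}] = C_seq [{l<..p}, {i<..k}]"
    using assms by (simp_all add: C_seq_def)
  then show "C_seq [{i<..j}, {k<..l}, {l<..p}] = fbridge i j k p" "C_seq [{l<..p}, {j<..k}, {i<..j}] = fbridge' i k l p"
    using assms by (simp_all add: C_seq_gap)
qed

lemma C_seq_adjacent3:
  assumes "i < j" "j < k" "k < l"
  shows "C_seq [{i<..j}, {j<..k}, {k<..l}] = gen i l" "C_seq [{k<..l}, {j<..k}, {i<..j}] = gen i l"
proof -
  have "adjacent {j<..k} {k<..l}" "{j<..k} \<union> {k<..l} = {j<..l}" "adjacent {j<..k} {i<..j}" "{j<..k} \<union> {i<..j} = {i<..k}"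
    "adjacent {i<..j} {j<..l}" "{i<..j} \<union> {j<..l} = {i<..l}" "adjacent {k<..l} {i<..k}" "{k<..l} \<union> {i<..k} = {i<..l}"
    using assms by (auto simp: adjacent_iff)
  then show "C_seq [{i<..j}, {j<..k}, {k<..l}] = gen i l" "C_seq [{k<..l}, {j<..k}, {i<..j}] = gen i l"
    using assms by (simp_all add: C_seq_def gen_def)
qed

lemma monotonic_adjacent_chain:
  assumes "monotonic_adjacent Is" "\<forall>I\<in>set Is. I \<subseteq> {1..n}" "I \<in> set Is"
  shows "connected_in n I"
  using assms by (auto simp: monotonic_adjacent_def monotonic_def connected_in_def)

lemma adjacent_split:
  assumes "adjacent I {k<..l}" "k < l" "connected_in n I"
  shows "set_less I {k<..l} \<Longrightarrow> \<exists>i<k. I = {i<..k}" "set_less {k<..l} I \<Longrightarrow> \<exists>p>l. p \<le> n \<and> I = {l<..p}"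
proof -
  obtain i j where I: "i < j" "j \<le> n" "I = {i<..j}"
    using assms(3) by (auto simp: connected_in_iff)
  have mem: "j \<in> I" "Suc i \<in> I" "Suc k \<in> {k<..l}" "l \<in> {k<..l}"
    using I assms(2) by simp_all
  show "\<exists>i<k. I = {i<..k}" if "set_less I {k<..l}"
  proof -
    have "j < Suc k"
      using that mem unfolding set_less_def by blast
    then have "k = j"
      using adjacent_iff(1) [of i j k l] assms(1,2) I by simp
    then show ?thesis
      using I by blast
  qed
  show "\<exists>p>l. p \<le> n \<and> I = {l<..p}" if "set_less {k<..l} I"
  proof -
    have "l < Suc i"
      using that mem unfolding set_less_def by blast
    then have "i = l"
      using adjacent_iff(2) [of k l i j] assms(1,2) I by simp
    then show ?thesis
      using I by blast
  qed
qed

text \<open>Up to direction such a chain is given by its cut points, and then every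
  \<open>C_seq\<close> occurring in a relator can be computed.\<close>

lemma monotonic_adjacent3:
  assumes "monotonic_adjacent [I1, I2, I3]" "\<forall>I\<in>{I1, I2, I3}. I \<subseteq> {1..n}"
  obtains i j k l where "i < j" "j < k" "k < l" "l \<le> n" "I1 = {i<..j}" "I2 = {j<..k}" "I3 = {k<..l}"
    | i j k l where "i < j" "j < k" "k < l" "l \<le> n" "I3 = {i<..j}" "I2 = {j<..k}" "I1 = {k<..l}"
proof -
  have c: "connected_in n I1" "connected_in n I2" "connected_in n I3"
    using monotonic_adjacent_chain [OF assms(1)] assms(2) by simp_all
  obtain j k where I2: "j < k" "k \<le> n" "I2 = {j<..k}"
    using c(2) unfolding connected_in_iff by blast
  have adj: "adjacent I1 {j<..k}" "adjacent I3 {j<..k}"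
    using assms(1) adjacent_commute [of I3] unfolding monotonic_adjacent_def I2(3) [symmetric] by simp_all
  consider "set_less I1 {j<..k}" "set_less {j<..k} I3" | "set_less {j<..k} I1" "set_less I3 {j<..k}"
    using assms(1) unfolding monotonic_adjacent_def monotonic_def I2(3) [symmetric] by auto
  then show thesis
  proof cases
    case 1
    obtain i where "i < j" "I1 = {i<..j}"
      using adjacent_split(1) [OF adj(1) I2(1) c(1) 1(1)] by blast
    moreover obtain l where "k < l" "l \<le> n" "I3 = {k<..l}"
      using adjacent_split(2) [OF adj(2) I2(1) c(3) 1(2)] by blast
    ultimately show thesis
      using I2 by (intro that(1))
  next
    case 2
    obtain i where "i < j" "I3 = {i<..j}"
      using adjacent_split(1) [OF adj(2) I2(1) c(3) 2(2)] by blast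
    moreover obtain l where "k < l" "l \<le> n" "I1 = {k<..l}"
      using adjacent_split(2) [OF adj(1) I2(1) c(1) 2(1)] by blast
    ultimately show thesis
      using I2 by (intro that(2))
  qed
qed

lemma monotonic_adjacent4:
  assumes "monotonic_adjacent [I1, I2, I3, I4]" "\<forall>I\<in>{I1, I2, I3, I4}. I \<subseteq> {1..n}"
  obtains i j k l p where "i < j" "j < k" "k < l" "l < p" "p \<le> n" "I1 = {i<..j}" "I2 = {j<..k}" "I3 = {k<..l}" "I4 = {l<..p}"
    | i j k l p where "i < j" "j < k" "k < l" "l < p" "p \<le> n" "I4 = {i<..j}" "I3 = {j<..k}" "I2 = {k<..l}" "I1 = {l<..p}"
proof -
  have m3: "monotonic_adjacent [I1, I2, I3]" and adj: "adjacent I4 I3"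
    using assms(1) adjacent_commute [of I4] unfolding monotonic_adjacent_def monotonic_def by auto
  have c4: "connected_in n I4"
    using monotonic_adjacent_chain [OF assms(1)] assms(2) by simp
  have sub: "\<forall>I\<in>{I1, I2, I3}. I \<subseteq> {1..n}"
    using assms(2) by simp
  have ord: "set_less I1 I2 \<and> set_less I3 I4 \<or> set_less I2 I1 \<and> set_less I4 I3"
    using assms(1) unfolding monotonic_adjacent_def monotonic_def by auto
  have contra: "\<not> set_less {j<..k} {i<..j}" if "i < j" "j < k" for i j k :: nat
  proof
    assume "set_less {j<..k} {i<..j}"
    moreover have "k \<in> {j<..k}" "j \<in> {i<..j}"
      using that by simp_all
    ultimately have "k < j"
      unfolding set_less_def by blast
    then show False
      using that by simp
  qed
  show thesis
    using m3 sub
  proof (rule monotonic_adjacent3)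
    fix i j k l
    assume *: "i < j" "j < k" "k < l" "l \<le> n" "I1 = {i<..j}" "I2 = {j<..k}" "I3 = {k<..l}"
    then have "set_less {k<..l} I4"
      using ord contra [of i j k] by simp
    then obtain p where "l < p" "p \<le> n" "I4 = {l<..p}"
      using adjacent_split(2) [of I4 k l n] adj c4 * by auto
    with * show thesis
      by (intro that(1))
  next
    fix i j k l
    assume *: "i < j" "j < k" "k < l" "l \<le> n" "I3 = {i<..j}" "I2 = {j<..k}" "I1 = {k<..l}"
    then have "set_less I4 {i<..j}"
      using ord contra [of j k l] by simp
    then obtain p where "p < i" "I4 = {p<..i}"
      using adjacent_split(1) [of I4 i j n] adj c4 * by auto
    with * show thesis
      by (intro that(2))
  qed
qed

lemma qcomm_closed: "A \<in> Fc n \<Longrightarrow> B \<in> Fc n \<Longrightarrow> qcomm A B \<in> Fc n"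
  unfolding qcomm_def smult_q_def by (intro Fc_closed)

lemma fbridge_closed: "j \<le> n \<Longrightarrow> k \<le> n \<Longrightarrow> l \<le> n \<Longrightarrow> fbridge i j k l \<in> Fc n" "j \<le> n \<Longrightarrow> k \<le> n \<Longrightarrow> l \<le> n \<Longrightarrow> fbridge' i j k l \<in> Fc n"
  unfolding fbridge_def fbridge'_def by (intro Fc_closed qcomm_closed gen_closed; simp)+

lemma comm_relator:
  "connected_in n I \<Longrightarrow> connected_in n J \<Longrightarrow> I \<inter> J = {} \<or> I \<subseteq> J \<Longrightarrow> comm (C_seq [I]) (C_seq [J]) \<in> aw_relators n"
  unfolding aw_relators_def by (rule UnI1, rule UnI1, rule CollectI, intro exI conjI, rule refl, assumption+)

lemma triple_relator:
  "monotonic_adjacent [I1, I2, I3] \<Longrightarrow> \<forall>I\<in>{I1, I2, I3}. I \<subseteq> {1..n} \<Longrightarrow>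
    C_seq [I1, I2] - (- qcomm (C_seq [I2, I3]) (C_seq [I1, I3])
      + C_seq [I1] * C_seq [I2] + C_seq [I3] * C_seq [I1, I2, I3]) \<in> aw_relators n"
  unfolding aw_relators_def by (rule UnI1, rule UnI2, rule CollectI, intro exI conjI, rule refl, assumption+)

lemma quadruple_relator:
  "monotonic_adjacent [I1, I2, I3, I4] \<Longrightarrow> \<forall>I\<in>{I1, I2, I3, I4}. I \<subseteq> {1..n} \<Longrightarrow>
    C_seq [I1, I4] - (- qcomm (C_seq [I1, I3]) (C_seq [I3, I4])
      + C_seq [I1] * C_seq [I4] + C_seq [I3] * C_seq [I1, I3, I4]) \<in> aw_relators n"
  unfolding aw_relators_def by (rule UnI2, rule CollectI, intro exI conjI, rule refl, assumption+)

lemmas aw_relatorsI = comm_relator triple_relator quadruple_relator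

text \<open>Required before \<open>genideal\<close> can be used, whose laws are stated for
  generators inside the carrier.\<close>

lemma relators_closed: "aw_relators n \<subseteq> Fc n"
proof -
  have r1: "comm (C_seq [I]) (C_seq [J]) \<in> Fc n" if IJ: "connected_in n I" "connected_in n J" for I J
  proof -
    obtain i j k l where "j \<le> n" "l \<le> n" "I = {i<..j}" "J = {k<..l}"
      using IJ unfolding connected_in_iff by blast
    then show ?thesis
      by (simp add: C_seq_gen comm_def Fc_closed gen_closed)
  qed
  have r2: "C_seq [I1, I2] - (- qcomm (C_seq [I2, I3]) (C_seq [I1, I3])
          + C_seq [I1] * C_seq [I2] + C_seq [I3] * C_seq [I1, I2, I3]) \<in> Fc n"
    if "monotonic_adjacent [I1, I2, I3]" "\<forall>I\<in>{I1, I2, I3}. I \<subseteq> {1..n}" for I1 I2 I3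
    using that
    by (rule monotonic_adjacent3)
      (simp_all add: C_seq_gen C_seq_adjacent C_seq_gap C_seq_adjacent3 Fc_closed gen_closed fbridge_closed qcomm_closed)
  have r3: "C_seq [I1, I4] - (- qcomm (C_seq [I1, I3]) (C_seq [I3, I4])
          + C_seq [I1] * C_seq [I4] + C_seq [I3] * C_seq [I1, I3, I4]) \<in> Fc n"
    if "monotonic_adjacent [I1, I2, I3, I4]" "\<forall>I\<in>{I1, I2, I3, I4}. I \<subseteq> {1..n}" for I1 I2 I3 I4
    using that
    by (rule monotonic_adjacent4)
      (simp_all add: C_seq_gen C_seq_adjacent C_seq_gap C_seq_gap_adjacent Fc_closed gen_closed fbridge_closed qcomm_closed)
  show ?thesis
    unfolding aw_relators_def
    by (intro Un_least subsetI; elim CollectE exE conjE; hypsubst; rule r1 r2 r3; assumption)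
qed

lemma ideal_aw: "ideal (aw_ideal n) (free_aw n)"
  unfolding aw_ideal_def by (rule ring.genideal_ideal [OF ring_free_aw relators_closed])

lemma ring_aw: "ring (aw n)"
  unfolding aw_def by (rule ideal.quotient_is_ring [OF ideal_aw])

lemma aw_class_hom: "aw_class n \<in> ring_hom (free_aw n) (aw n)"
  unfolding aw_def aw_class_def [abs_def] by (rule ideal.rcos_ring_hom [OF ideal_aw])

lemma aw_class_closed: "A \<in> Fc n \<Longrightarrow> aw_class n A \<in> carrier (aw n)"
  by (rule ring_hom_closed [OF aw_class_hom])

lemma aw_class_add: "A \<in> Fc n \<Longrightarrow> B \<in> Fc n \<Longrightarrow> aw_class n (A + B) = aw_class n A \<oplus>\<^bsub>aw n\<^esub> aw_class n B"
  using ring_hom_add [OF aw_class_hom, of A n B] by (simp add: free_aw_ops)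

lemma aw_class_mult: "A \<in> Fc n \<Longrightarrow> B \<in> Fc n \<Longrightarrow> aw_class n (A * B) = aw_class n A \<otimes>\<^bsub>aw n\<^esub> aw_class n B"
  using ring_hom_mult [OF aw_class_hom, of A n B] by (simp add: free_aw_ops)

lemma aw_class_one: "aw_class n 1 = \<one>\<^bsub>aw n\<^esub>"
  using ring_hom_one [OF aw_class_hom, of n] by (simp add: free_aw_ops)

lemma aw_class_surj: "x \<in> carrier (aw n) \<Longrightarrow> \<exists>A\<in>Fc n. x = aw_class n A"
  by (auto simp: aw_def aw_class_def FactRing_def A_RCOSETS_defs a_r_coset_def)

lemma aw_class_relator:
  assumes "A \<in> aw_relators n"
  shows "aw_class n A = \<zero>\<^bsub>aw n\<^esub>"
proof -
  have "A \<in> aw_ideal n" "A \<in> Fc n"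
    using assms ring.genideal_self [OF ring_free_aw relators_closed] relators_closed
    unfolding aw_ideal_def by blast+
  then have "aw_ideal n +>\<^bsub>free_aw n\<^esub> A = aw_ideal n"
    by (intro abelian_group.a_coset_join2 [OF ring.is_abelian_group [OF ring_free_aw]]
        additive_subgroup.a_subgroup [OF ideal.axioms(1) [OF ideal_aw]])
  then show ?thesis
    by (simp add: aw_class_def aw_def FactRing_def)
qed

text \<open>A single type has to carry the algebras \<open>aw(m)\<close> for all \<open>m\<close>, hence their product.\<close>

typedef aw_elt = "{F :: nat \<Rightarrow> free_alg set. \<forall>m. F m \<in> carrier (aw m)}"
  by (rule exI [of _ "\<lambda>m. \<one>\<^bsub>aw m\<^esub>"]) (simp add: ring.ring_simprules [OF ring_aw])

definition component :: "nat \<Rightarrow> aw_elt \<Rightarrow> free_alg set"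
  where "component m x = Rep_aw_elt x m"

lemma component_closed: "component m x \<in> carrier (aw m)"
  using Rep_aw_elt [of x] by (simp add: component_def)

lemma component_eqI: "(\<And>m. component m x = component m y) \<Longrightarrow> x = y"
  by (metis component_def Rep_aw_elt_inject ext)

lemma component_Abs: "(\<And>m. F m \<in> carrier (aw m)) \<Longrightarrow> component m (Abs_aw_elt F) = F m"
  by (simp add: component_def Abs_aw_elt_inverse)

instantiation aw_elt :: "{zero, one, plus, minus, uminus, times}"
begin

definition zero_aw_elt :: aw_elt
  where "0 = Abs_aw_elt (\<lambda>m. \<zero>\<^bsub>aw m\<^esub>)"

definition one_aw_elt :: aw_elt
  where "1 = Abs_aw_elt (\<lambda>m. \<one>\<^bsub>aw m\<^esub>)"

definition plus_aw_elt :: "aw_elt \<Rightarrow> aw_elt \<Rightarrow> aw_elt"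
  where "x + y = Abs_aw_elt (\<lambda>m. component m x \<oplus>\<^bsub>aw m\<^esub> component m y)"

definition times_aw_elt :: "aw_elt \<Rightarrow> aw_elt \<Rightarrow> aw_elt"
  where "x * y = Abs_aw_elt (\<lambda>m. component m x \<otimes>\<^bsub>aw m\<^esub> component m y)"

definition minus_aw_elt :: "aw_elt \<Rightarrow> aw_elt \<Rightarrow> aw_elt"
  where "x - y = Abs_aw_elt (\<lambda>m. component m x \<ominus>\<^bsub>aw m\<^esub> component m y)"

definition uminus_aw_elt :: "aw_elt \<Rightarrow> aw_elt"
  where "- x = Abs_aw_elt (\<lambda>m. \<ominus>\<^bsub>aw m\<^esub> component m x)"

instance ..

end

lemma component_ops:
  "component m (x + y) = component m x \<oplus>\<^bsub>aw m\<^esub> component m y"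
  "component m (x * y) = component m x \<otimes>\<^bsub>aw m\<^esub> component m y"
  "component m (x - y) = component m x \<ominus>\<^bsub>aw m\<^esub> component m y"
  "component m (- x) = \<ominus>\<^bsub>aw m\<^esub> component m x"
  "component m 1 = \<one>\<^bsub>aw m\<^esub>" "component m 0 = \<zero>\<^bsub>aw m\<^esub>"
  unfolding plus_aw_elt_def times_aw_elt_def minus_aw_elt_def uminus_aw_elt_def one_aw_elt_def zero_aw_elt_def
  by (rule component_Abs, simp add: ring.ring_simprules [OF ring_aw] component_closed)+

instance aw_elt :: "{ring, monoid_mult}"
  by standard (rule component_eqI, simp add: component_ops component_closed ring.ring_simprules [OF ring_aw]
    Group.monoid.r_one [OF ring.is_monoid [OF ring_aw]])+

definition scal :: "coeff \<Rightarrow> aw_elt"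
  where "scal x = Abs_aw_elt (\<lambda>m. aw_class m (scalar x))"

lemma component_scal: "component m (scal x) = aw_class m (scalar x)"
  by (simp add: scal_def component_Abs aw_class_closed Fc_closed)

lemma scal_mult: "scal (x * y) = scal x * scal y"
  by (rule component_eqI) (simp add: component_ops component_scal scalar_hom aw_class_mult Fc_closed)

lemma scal_add: "scal (x + y) = scal x + scal y"
  by (rule component_eqI) (simp add: component_ops component_scal scalar_hom aw_class_add Fc_closed)

lemma scal_one: "scal 1 = 1"
  by (rule component_eqI) (simp add: component_ops component_scal scalar_hom aw_class_one)

lemma scal_diff: "scal (x - y) = scal x - scal y"
  using scal_add [of "x - y" y] by (simp add: eq_diff_eq)

lemma scal_minus_one: "scal (- 1) = - 1"
  using scal_diff [of 0 1] scal_diff [of 0 0] by (simp add: scal_one)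

lemma scal_central: "scal x * y = y * scal x"
proof (rule component_eqI)
  fix m
  obtain A where "A \<in> Fc m" "component m y = aw_class m A"
    using aw_class_surj [OF component_closed] by blast
  then show "component m (scal x * y) = component m (y * scal x)"
    by (simp add: component_ops component_scal Fc_closed scalar_commute flip: aw_class_mult)
qed

lemma q_facts: "q \<noteq> 0" "q - inverse q \<noteq> 0" "q + inverse q \<noteq> 0"
proof -
  show nz: "q \<noteq> 0"
    by (simp add: q_def Zero_fract_def eq_fract)
  have "q * q \<noteq> 1" "q * q \<noteq> - 1"
    by (simp_all add: q_def One_fract_def eq_fract one_pCons)
  then show "q - inverse q \<noteq> 0" "q + inverse q \<noteq> 0"
    using nz by (auto simp: field_simps eq_neg_iff_add_eq_0)
qed

section \<open>The scalars and the interval family inside the product ring\<close>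

definition "qA = scal q"
definition "qiA = scal (inverse q)"
definition "kA = scal (1 / (q - inverse q))"
definition "hA = scal (1 / (q + inverse q))"
definition "aA = scal (q / (q - inverse q))"
definition "bA = scal (inverse q / (q - inverse q))"
definition "wA = scal ((q - inverse q) / (q + inverse q))"

lemma qscalars_aw: "qscalars aA bA wA qA qiA kA hA"
proof
  show "aA - bA = 1"
    using q_facts by (simp add: aA_def bA_def scal_one flip: scal_diff diff_divide_distrib)
  show "wA * (aA + bA) = 1"
    using q_facts by (simp add: aA_def bA_def wA_def scal_one flip: scal_mult scal_add add_divide_distrib)
  show "aA = kA * qA" "bA = kA * qiA" "qA * qiA = 1"
    using q_facts by (simp_all add: aA_def bA_def kA_def qA_def qiA_def scal_one flip: scal_mult)
  show "hA * (qA + qiA) = 1"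
    using q_facts by (simp add: hA_def qA_def qiA_def scal_one flip: scal_mult scal_add)
  show "z * x = x * z" if "z \<in> {qA, qiA, kA, hA}" for z x
    using that by (auto simp: qA_def qiA_def kA_def hA_def scal_central)
qed (simp_all add: aA_def bA_def scal_central)

interpretation AW: qscalars aA bA wA qA qiA kA hA
  by (rule qscalars_aw)

text \<open>Links the free algebra, the quotient and the product ring; the comparison takes place in
  the component at \<open>n\<close>.\<close>

definition rep :: "nat \<Rightarrow> free_alg \<Rightarrow> aw_elt \<Rightarrow> bool"
  where "rep n A x \<longleftrightarrow> A \<in> Fc n \<and> aw_class n A = component n x"

lemma rep_scal: "rep n (scalar x) (scal x)"
  by (simp add: rep_def component_scal Fc_closed)

lemma rep_one: "rep n 1 1"
  by (simp add: rep_def component_ops aw_class_one Fc_closed)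

lemma rep_add: "rep n A x \<Longrightarrow> rep n B y \<Longrightarrow> rep n (A + B) (x + y)"
  by (simp add: rep_def component_ops aw_class_add Fc_closed)

lemma rep_mult: "rep n A x \<Longrightarrow> rep n B y \<Longrightarrow> rep n (A * B) (x * y)"
  by (simp add: rep_def component_ops aw_class_mult Fc_closed)

lemma rep_minus: "rep n A x \<Longrightarrow> rep n (- A) (- x)"
proof -
  have "scalar (- 1) = - 1"
    using scalar_hom(3) [of 0 1] by (simp add: scalar_hom(4)) (simp add: scalar_def)
  then show "rep n (- A) (- x)" if "rep n A x"
    using rep_mult [OF rep_scal [of n "- 1"] that] by (simp add: scal_minus_one)
qed

lemma rep_diff: "rep n A x \<Longrightarrow> rep n B y \<Longrightarrow> rep n (A - B) (x - y)"
  using rep_add [OF _ rep_minus, of n A x B y] by simp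

lemma rep_qcomm: "rep n A x \<Longrightarrow> rep n B y \<Longrightarrow> rep n (qcomm A B) (AW.qb x y)"
proof -
  assume "rep n A x" "rep n B y"
  then have "rep n (qcomm A B) (kA * (qA * (x * y) - qiA * (y * x)))"
    unfolding qcomm_def smult_q_def kA_def qA_def qiA_def by (intro rep_mult rep_diff rep_scal)
  then show ?thesis
    unfolding AW.qb_def unfolding AW.a_eq AW.b_eq by (simp add: right_diff_distrib mult.assoc)
qed

text \<open>The default 1 also covers \<open>k > n\<close>, where \<open>gen i k\<close> may fall
  outside the carrier of \<open>free_aw n\<close>.\<close>

definition fam :: "nat \<Rightarrow> nat \<Rightarrow> nat \<Rightarrow> aw_elt"
  where "fam n i k = Abs_aw_elt (\<lambda>m. if m = n \<and> k \<le> n then aw_class n (gen i k) else \<one>\<^bsub>aw m\<^esub>)"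

lemma component_fam: "component m (fam n i k) = (if m = n \<and> k \<le> n then aw_class n (gen i k) else \<one>\<^bsub>aw m\<^esub>)"
  unfolding fam_def by (rule component_Abs) (simp add: aw_class_closed gen_closed ring.ring_simprules [OF ring_aw])

lemma rep_gen: "k \<le> n \<Longrightarrow> rep n (gen i k) (fam n i k)"
  by (simp add: rep_def component_fam gen_closed)

lemma fam_unit: "i \<le> n \<Longrightarrow> fam n i i = 1"
  by (rule component_eqI) (simp add: component_fam component_ops gen_unit aw_class_one)

text \<open>The family of \<open>aw(n)\<close> is extended to the other factors of the product by \<open>1\<close>, which satisfies all relations.\<close>

definition off :: "nat \<Rightarrow> aw_elt \<Rightarrow> bool"
  where "off n x \<longleftrightarrow> (\<forall>m. m \<noteq> n \<longrightarrow> component m x = component m 1)"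

lemma off_fam: "off n (fam n i k)"
  by (simp add: off_def component_fam component_ops)

lemma off_mult: "off n x \<Longrightarrow> off n y \<Longrightarrow> off n (x * y)"
proof -
  assume "off n x" "off n y"
  then have "component m (x * y) = component m (1 * 1)" if "m \<noteq> n" for m
    using that by (simp only: off_def component_ops(2) simp_thms)
  then show ?thesis
    by (simp add: off_def)
qed

lemma off_add_diff: "off n x \<Longrightarrow> off n y \<Longrightarrow> off n z \<Longrightarrow> off n (x + y - z)"
proof -
  assume "off n x" "off n y" "off n z"
  then have "component m (x + y - z) = component m (1 + 1 - 1)" if "m \<noteq> n" for m
    using that by (simp only: off_def component_ops(1,3) simp_thms)
  then show ?thesis
    by (simp add: off_def)
qed

lemma off_qb: "off n x \<Longrightarrow> off n y \<Longrightarrow> off n (AW.qb x y)"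
proof -
  assume "off n x" "off n y"
  then have "component m (AW.qb x y) = component m (AW.qb 1 1)" if "m \<noteq> n" for m
    unfolding AW.qb_def using that by (simp only: off_def component_ops(2,3) simp_thms)
  then show ?thesis
    by (simp add: off_def AW.qb_com)
qed

lemma off_bridge: "off n (AW.bridge (fam n) i j k l)" "off n (AW.bridge' (fam n) i j k l)"
  unfolding AW.bridge_def AW.bridge'_def by (intro off_add_diff off_mult off_qb off_fam)+

lemmas off_rules = off_add_diff off_mult off_qb off_fam off_bridge

text \<open>A relator vanishes in the component at \<open>n\<close>, and elsewhere both sides agree
  with 1. Together this gives an identity in the product ring, where the locales live.\<close>

lemma relator_eq:
  assumes "A \<in> aw_relators n" "rep n A z" "x = z + y" "off n x" "off n y"
  shows "x = y"
proof (rule component_eqI)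
  fix m
  show "component m x = component m y"
  proof (cases "m = n")
    case True
    have "component n z = component n 0"
      using assms(1,2) aw_class_relator by (simp add: rep_def component_ops)
    then have "component n (z + y) = component n (0 + y)"
      by (simp only: component_ops(1))
    then show ?thesis
      using True assms(3) by simp
  next
    case False
    then show ?thesis
      using assms(4,5) by (simp add: off_def)
  qed
qed

lemma rep_bridge:
  assumes "j \<le> n" "k \<le> n" "l \<le> n"
  shows "rep n (fbridge i j k l) (AW.bridge (fam n) i j k l)"
proof -
  have "rep n (fbridge i j k l) (- AW.qb (fam n i k) (fam n j l) + fam n i j * fam n k l + fam n j k * fam n i l)"
    unfolding fbridge_def using assms by (intro rep_add rep_minus rep_mult rep_qcomm rep_gen)
  then show ?thesis
    by (simp add: AW.bridge_def algebra_simps)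
qed

lemma com_fam:
  assumes "i \<le> j" "j \<le> n" "k \<le> l" "l \<le> n" "j \<le> k \<or> k \<le> i \<and> j \<le> l"
  shows "com (fam n i j) (fam n k l)"
proof (cases "i = j \<or> k = l")
  case True
  then show ?thesis
    using assms by (auto simp: fam_unit)
next
  case False
  then have "i < j" "k < l"
    using assms by auto
  then have "connected_in n {i<..j}" "connected_in n {k<..l}"
    using assms unfolding connected_in_iff by blast+
  moreover have "{i<..j} \<inter> {k<..l} = {} \<or> {i<..j} \<subseteq> {k<..l}"
    using assms by auto
  ultimately have "comm (C_seq [{i<..j}]) (C_seq [{k<..l}]) \<in> aw_relators n"
    by (rule aw_relatorsI)
  moreover have "rep n (comm (C_seq [{i<..j}]) (C_seq [{k<..l}])) (fam n i j * fam n k l - fam n k l * fam n i j)"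
    unfolding comm_def C_seq_gen using assms by (intro rep_diff rep_mult rep_gen)
  ultimately have "fam n i j * fam n k l = fam n k l * fam n i j"
    by (rule relator_eq) (simp_all add: off_rules)
  then show ?thesis
    by (simp add: com_def)
qed

lemma com_family_fam: "com_family aA bA wA n (fam n)"
  by unfold_locales (auto simp: fam_unit intro!: com_fam)

lemma rep_bridge':
  assumes "i \<le> j" "j \<le> k" "k \<le> l" "l \<le> n"
  shows "rep n (fbridge' i j k l) (AW.bridge' (fam n) i j k l)"
proof -
  have "rep n (fbridge' i j k l) (- AW.qb (fam n j l) (fam n i k) + fam n k l * fam n i j + fam n j k * fam n i l)"
    unfolding fbridge'_def using assms by (intro rep_add rep_minus rep_mult rep_qcomm rep_gen) auto
  moreover have "fam n k l * fam n i j = fam n i j * fam n k l"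
    using assms by (intro com_sw com_fam) auto
  ultimately show ?thesis
    by (simp add: AW.bridge'_def algebra_simps)
qed

lemma monotonic_adjacentI:
  assumes "i < j" "j < k" "k < l"
  shows "monotonic_adjacent [{i<..j}, {j<..k}, {k<..l}]" "monotonic_adjacent [{k<..l}, {j<..k}, {i<..j}]"
    and "l < p \<Longrightarrow> monotonic_adjacent [{i<..j}, {j<..k}, {k<..l}, {l<..p}]"
      "l < p \<Longrightarrow> monotonic_adjacent [{l<..p}, {k<..l}, {j<..k}, {i<..j}]"
  using assms by (auto simp: monotonic_adjacent_def monotonic_def connected_greaterThan adjacent_iff set_less_def)

text \<open>The relators on non-empty intervals are what \<open>aw_family_strictI\<close> asks for.
  Those of decreasing sequences become the primed relations after \<open>bridge_flip\<close> or an
  exchange of commuting factors.\<close>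

theorem aw_family_fam: "aw_family aA bA wA n (fam n)"
proof -
  interpret com_family aA bA wA n "fam n"
    by (rule com_family_fam)
  have sub: "{i<..j} \<subseteq> {1..n}" if "j \<le> n" for i j
    using that by auto
  show ?thesis
  proof (rule AW.aw_family_strictI)
    fix i j k l
    assume ord: "i < j" "j < k" "k < l" "l \<le> n"
    have "gen i k - (- qcomm (gen j l) (fbridge i j k l) + gen i j * gen j k + gen k l * gen i l) \<in> aw_relators n"
    proof -
      have "C_seq [{i<..j}, {j<..k}] - (- qcomm (C_seq [{j<..k}, {k<..l}]) (C_seq [{i<..j}, {k<..l}])
          + C_seq [{i<..j}] * C_seq [{j<..k}] + C_seq [{k<..l}] * C_seq [{i<..j}, {j<..k}, {k<..l}]) \<in> aw_relators n"
        by (rule triple_relator [OF monotonic_adjacentI(1) [OF ord(1-3)]]) (use ord in auto)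
      then show ?thesis
        using ord by (simp add: C_seq_gen C_seq_adjacent C_seq_gap C_seq_adjacent3)
    qed
    moreover have "rep n (gen i k - (- qcomm (gen j l) (fbridge i j k l) + gen i j * gen j k + gen k l * gen i l))
        (fam n i k - (- AW.qb (fam n j l) (AW.bridge (fam n) i j k l) + fam n i j * fam n j k + fam n k l * fam n i l))"
      using ord by (intro rep_diff rep_add rep_minus rep_mult rep_qcomm rep_gen rep_bridge) auto
    ultimately show "AW.tri (fam n) i j k l"
      unfolding AW.tri_def by (rule relator_eq) (simp_all add: off_rules)
    have "gen j l - (- qcomm (gen i k) (fbridge' i j k l) + gen k l * gen j k + gen i j * gen i l) \<in> aw_relators n"
    proof -
      have "C_seq [{k<..l}, {j<..k}] - (- qcomm (C_seq [{j<..k}, {i<..j}]) (C_seq [{k<..l}, {i<..j}])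
          + C_seq [{k<..l}] * C_seq [{j<..k}] + C_seq [{i<..j}] * C_seq [{k<..l}, {j<..k}, {i<..j}]) \<in> aw_relators n"
        by (rule triple_relator [OF monotonic_adjacentI(2) [OF ord(1-3)]]) (use ord in auto)
      then show ?thesis
        using ord by (simp add: C_seq_gen C_seq_adjacent C_seq_gap C_seq_adjacent3)
    qed
    moreover have "rep n (gen j l - (- qcomm (gen i k) (fbridge' i j k l) + gen k l * gen j k + gen i j * gen i l))
        (fam n j l - (- AW.qb (fam n i k) (AW.bridge' (fam n) i j k l) + fam n k l * fam n j k + fam n i j * fam n i l))"
      using ord by (intro rep_diff rep_add rep_minus rep_mult rep_qcomm rep_gen rep_bridge') auto
    ultimately have "AW.qb (fam n i k) (AW.bridge' (fam n) i j k l) = fam n k l * fam n j k + fam n i j * fam n i l - fam n j l"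
      by (rule relator_eq) (simp_all add: off_rules)
    moreover have "fam n k l * fam n j k = fam n j k * fam n k l"
      using ord by (intro com_sw com_fam) auto
    ultimately show "AW.tri' (fam n) i j k l"
      unfolding AW.tri'_def using bridge_flip(2) [of i j k l] ord by simp
  next
    fix i j k l p
    assume ord: "i < j" "j < k" "k < l" "l < p" "p \<le> n"
    have "fbridge i j l p - (- qcomm (fbridge i j k l) (gen k p) + gen i j * gen l p + gen k l * fbridge i j k p) \<in> aw_relators n"
    proof -
      have "C_seq [{i<..j}, {l<..p}] - (- qcomm (C_seq [{i<..j}, {k<..l}]) (C_seq [{k<..l}, {l<..p}])
          + C_seq [{i<..j}] * C_seq [{l<..p}] + C_seq [{k<..l}] * C_seq [{i<..j}, {k<..l}, {l<..p}]) \<in> aw_relators n"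
        by (rule quadruple_relator [OF monotonic_adjacentI(3) [OF ord(1-4)]]) (use ord in auto)
      then show ?thesis
        using ord by (simp add: C_seq_gen C_seq_adjacent C_seq_gap C_seq_gap_adjacent)
    qed
    moreover have "rep n (fbridge i j l p - (- qcomm (fbridge i j k l) (gen k p) + gen i j * gen l p + gen k l * fbridge i j k p))
        (AW.bridge (fam n) i j l p - (- AW.qb (AW.bridge (fam n) i j k l) (fam n k p) + fam n i j * fam n l p + fam n k l * AW.bridge (fam n) i j k p))"
      using ord by (intro rep_diff rep_add rep_minus rep_mult rep_qcomm rep_gen rep_bridge) auto
    ultimately show "AW.quad (fam n) i j k l p"
      unfolding AW.quad_def by (rule relator_eq) (simp_all add: off_rules)
    have "fbridge' i j l p - (- qcomm (fbridge' j k l p) (gen i k) + gen l p * gen i j + gen j k * fbridge' i k l p) \<in> aw_relators n"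
    proof -
      have "C_seq [{l<..p}, {i<..j}] - (- qcomm (C_seq [{l<..p}, {j<..k}]) (C_seq [{j<..k}, {i<..j}])
          + C_seq [{l<..p}] * C_seq [{i<..j}] + C_seq [{j<..k}] * C_seq [{l<..p}, {j<..k}, {i<..j}]) \<in> aw_relators n"
        by (rule quadruple_relator [OF monotonic_adjacentI(4) [OF ord(1-4)]]) (use ord in auto)
      then show ?thesis
        using ord by (simp add: C_seq_gen C_seq_adjacent C_seq_gap C_seq_gap_adjacent)
    qed
    moreover have "rep n (fbridge' i j l p - (- qcomm (fbridge' j k l p) (gen i k) + gen l p * gen i j + gen j k * fbridge' i k l p))
        (AW.bridge' (fam n) i j l p - (- AW.qb (AW.bridge' (fam n) j k l p) (fam n i k) + fam n l p * fam n i j + fam n j k * AW.bridge' (fam n) i k l p))"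
      using ord by (intro rep_diff rep_add rep_minus rep_mult rep_qcomm rep_gen rep_bridge') auto
    ultimately have "AW.qb (AW.bridge' (fam n) j k l p) (fam n i k) = fam n l p * fam n i j
        + fam n j k * AW.bridge' (fam n) i k l p - AW.bridge' (fam n) i j l p"
      by (rule relator_eq) (simp_all add: off_rules)
    moreover have "fam n l p * fam n i j = fam n i j * fam n l p"
      using ord by (intro com_sw com_fam) auto
    ultimately show "AW.quad' (fam n) i j k l p"
      unfolding AW.quad'_def by simp
  qed (auto simp: fam_unit intro!: com_fam)
qed

section \<open>Components, cut points and the recursion defining C\<close>

fun ivls :: "nat list \<Rightarrow> nat set list"
  where
    "ivls (i # k # r) = {i<..k} # ivls r"
  | "ivls _ = []"

text \<open>The bound \<open>{Suc k<..}\<close> leaves at least the element \<open>Suc k\<close>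
  free, so no connected subset reaches from the interval into \<open>S\<close>.\<close>

lemma components_insert:
  assumes "i < k" "S \<subseteq> {Suc k<..}"
  shows "components ({i<..k} \<union> S) = insert {i<..k} (components S)"
proof -
  let ?X = "{i<..k}"
  have X: "connected_set ?X" "?X \<noteq> {}" "?X \<inter> S = {}"
    using assms connected_greaterThan by auto
  have split: "T \<subseteq> ?X \<or> T \<subseteq> S" if T: "connected_set T" "T \<subseteq> ?X \<union> S" for T
  proof -
    obtain l u where lu: "T = {l..u}"
      using T(1) unfolding connected_set_def by blast
    show ?thesis
    proof (cases "l \<le> k")
      case True
      have "t \<in> ?X" if "t \<in> T" for t
      proof (rule ccontr)
        assume "t \<notin> ?X"
        then have "t \<in> S"
          using that T(2) by blast
        then have "Suc k < t"
          using assms(2) by auto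
        then have "Suc k \<in> T"
          using that True unfolding lu by simp
        then show False
          using T(2) assms(2) by auto
      qed
      then show ?thesis
        by blast
    next
      case False
      then show ?thesis
        using T(2) unfolding lu by auto
    qed
  qed
  have ne: "T \<noteq> {}" if "connected_set T" for T
    using that by (auto simp: connected_set_def)
  show ?thesis
  proof (intro equalityI subsetI)
    fix T assume "T \<in> components (?X \<union> S)"
    then have T: "connected_set T" "T \<subseteq> ?X \<union> S"
      "\<And>T'. connected_set T' \<Longrightarrow> T \<subseteq> T' \<Longrightarrow> T' \<subseteq> ?X \<union> S \<Longrightarrow> T' = T"
      by (auto simp: components_def)
    from split [OF T(1,2)] show "T \<in> insert ?X (components S)"
    proof
      assume "T \<subseteq> ?X"
      then have "?X = T"
        using X(1) by (intro T(3)) auto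
      then show ?thesis
        by simp
    next
      assume "T \<subseteq> S"
      moreover have "T' = T" if "connected_set T'" "T \<subseteq> T'" "T' \<subseteq> S" for T'
        using that by (intro T(3)) auto
      ultimately have "T \<in> components S"
        using T(1) by (simp add: components_def)
      then show ?thesis
        by simp
    qed
  next
    fix T assume "T \<in> insert ?X (components S)"
    then consider "T = ?X" | "T \<in> components S"
      by blast
    then show "T \<in> components (?X \<union> S)"
    proof cases
      case 1
      have "T' = ?X" if "connected_set T'" "?X \<subseteq> T'" "T' \<subseteq> ?X \<union> S" for T'
        using split [OF that(1,3)] that(2) X by blast
      then show ?thesis
        using 1 X(1) by (simp add: components_def)
    next
      case 2
      then have T: "connected_set T" "T \<subseteq> S" "\<And>T'. connected_set T' \<Longrightarrow> T \<subseteq> T' \<Longrightarrow> T' \<subseteq> S \<Longrightarrow> T' = T"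
        by (auto simp: components_def)
      have "T' = T" if "connected_set T'" "T \<subseteq> T'" "T' \<subseteq> ?X \<union> S" for T'
        using split [OF that(1,3)] that(1,2) T ne [OF T(1)] X(3) by blast
      then show ?thesis
        using T(1,2) by (simp add: components_def le_supI2)
    qed
  qed
qed

lemma ivls_components:
  assumes "sorted_wrt (<) L" "even (length L)"
  shows "components {x. odd_below L x} = set (ivls L)"
  using assms
proof (induction L rule: ivls.induct)
  case (1 i k r)
  have "Suc k < x" if "odd_below r x" for x
  proof (rule ccontr)
    assume "\<not> Suc k < x"
    then have "\<forall>y\<in>set r. x \<le> y"
      using "1.prems" by fastforce
    then show False
      using odd_below_bot that by blast
  qed
  then have "{x. odd_below r x} \<subseteq> {Suc k<..}" and "{x. odd_below (i # k # r) x} = {i<..k} \<union> {x. odd_below r x}"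
    using "1.prems" by fastforce+
  then show ?case
    using 1 components_insert [of i k "{x. odd_below r x}"] by simp
qed (auto simp: components_def connected_set_def)

lemma ivls_mins:
  assumes "sorted_wrt (<) L"
  shows "sorted_wrt (<) (map Min (ivls L)) \<and> (\<forall>y\<in>set (map Min (ivls L)). \<exists>x\<in>set L. y = Suc x)"
  using assms
proof (induction L rule: ivls.induct)
  case (1 i k r)
  have "Min {i<..k} = Suc i"
    using "1.prems" by (intro Min_eqI) auto
  then show ?case
    using 1 by fastforce
qed simp_all

lemma (in linorder) sorted_key_list_of_set_eq:
  assumes "inj_on f (set l)" "sorted_wrt (<) (map f l)" "length l = card (set l)"
  shows "sorted_key_list_of_set f (set l) = l"
proof -
  interpret folding_insort_key "(\<le>)" "(<)" "set l" f
    by unfold_locales (rule assms(1))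
  show ?thesis
    using sorted_key_list_of_set_unique [of "set l" l] assms(2,3) by simp
qed

lemma component_list_ivls:
  assumes "sorted_wrt (<) L" "even (length L)"
  shows "component_list {x. odd_below L x} = ivls L"
proof -
  have strict: "sorted_wrt (<) (map Min (ivls L))"
    using ivls_mins [OF assms(1)] by blast
  then have dist: "distinct (map Min (ivls L))"
    by (simp add: strict_sorted_iff)
  then have "inj_on Min (set (ivls L))" "length (ivls L) = card (set (ivls L))"
    by (simp_all add: distinct_map distinct_card)
  then show ?thesis
    using strict by (simp add: component_list_def ivls_components [OF assms] sorted_key_list_of_set_eq)
qed

text \<open>Strictly increasing cut points leave every hole non-empty, so there is nothing to merge
  or to drop.\<close>

lemma merge_index_ivls:
  assumes "sorted_wrt (<) L" "even (length L)"
  shows "merge_index (ivls L) = ivls L"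
  using assms
proof (induction L rule: ivls.induct)
  case (1 i k r)
  then have IH: "merge_index (ivls r) = ivls r" and "{i<..k} \<noteq> {}"
    by auto
  show ?case
  proof (cases r)
    case Nil
    then show ?thesis
      using \<open>{i<..k} \<noteq> {}\<close> by simp
  next
    case (Cons l r')
    then obtain m r'' where r: "r = l # m # r''"
      using "1.prems" by (cases r') auto
    then have "\<not> adjacent {i<..k} {l<..m}"
      using "1.prems" adjacent_iff(1) [of i k l m] by auto
    then show ?thesis
      using IH \<open>{i<..k} \<noteq> {}\<close> by (simp add: r)
  qed
qed simp_all

text \<open>Both recursions split at the first hole, so they run in parallel.\<close>

lemma rep_C_rec:
  assumes "sorted_wrt (<) L" "even (length L)" "set L \<subseteq> {..n}"
  shows "rep n (C_rec (ivls L)) (AW.E (fam n) L)"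
  using assms
proof (induction L rule: AW.cut_list_induct)
  case (pair i k)
  then show ?case
    using rep_gen [of k n i] by (simp add: gen_def)
next
  case (step i k l r)
  then obtain m r' where r: "r = m # r'"
    by (cases r) auto
  have ord: "i < k" "k < l" "l < m" "l \<le> n"
    using step.prems r by auto
  have "{i<..k} \<union> {k<..l} = {i<..l}" "{k<..l} \<union> {l<..m} = {k<..m}" "{i<..l} \<union> {l<..m} = {i<..m}"
    using ord by auto
  then have eq: "C_rec (ivls (i # k # l # r)) = - qcomm (gen i l) (C_rec (ivls (k # r)))
      + gen i k * C_rec (ivls (l # r)) + gen k l * C_rec (ivls (i # r))"
    using ord by (simp add: r hole_intervals Let_def gen_def)
  have "rep n (C_rec (ivls (l # r))) (AW.E (fam n) (l # r))" "rep n (C_rec (ivls (i # r))) (AW.E (fam n) (i # r))"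
    "rep n (C_rec (ivls (k # r))) (AW.E (fam n) (k # r))"
    using step.prems ord by (auto intro!: step.IH)
  then have "rep n (C_rec (ivls (i # k # l # r)))
      (- AW.qb (fam n i l) (AW.E (fam n) (k # r)) + fam n i k * AW.E (fam n) (l # r) + fam n k l * AW.E (fam n) (i # r))"
    unfolding eq using ord by (intro rep_add rep_minus rep_mult rep_qcomm rep_gen) auto
  then show ?case
    by (simp add: algebra_simps del: ivls.simps)
qed (simp_all add: rep_one)

lemma cuts_strict: "sorted_wrt (<) (cuts n S)"
  using cuts_props by (simp add: strict_sorted_iff)

lemma rep_C_set:
  assumes "S \<subseteq> {1..n}"
  shows "rep n (C_set S) (AW.CS n (fam n) S)"
proof -
  note L = cuts_strict [of n S] even_length_cuts [OF assms]
  have "{x. odd_below (cuts n S) x} = S"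
    using odd_below_cuts [OF assms] by simp
  then have "C_set S = C_rec (ivls (cuts n S))"
    using component_list_ivls [OF L] merge_index_ivls [OF L] by (simp add: C_set_def C_seq_def)
  then show ?thesis
    using rep_C_rec [OF L cuts_props(3)] by (simp add: AW.CS_def)
qed

lemma rep_Omega:
  assumes "I1 \<union> I2 \<union> I3 \<subseteq> {1..n}"
  shows "rep n (Omega I1 I2 I3) (AW.Om n (fam n) I1 I2 I3)"
proof -
  let ?X = "AW.CS n (fam n)"
  have "rep n (Omega I1 I2 I3)
    (scal q * (?X (I1 \<union> I2) * ?X (I2 \<union> I3) * ?X (I1 \<union> I3))
      + scal (1 / (q + inverse q)) * (scal (q * q) * (?X (I1 \<union> I2) * ?X (I1 \<union> I2))
        + scal (inverse q * inverse q) * (?X (I2 \<union> I3) * ?X (I2 \<union> I3)) + scal (q * q) * (?X (I1 \<union> I3) * ?X (I1 \<union> I3))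
        + ?X (I1 \<union> I2 \<union> I3) * ?X (I1 \<union> I2 \<union> I3) + ?X I1 * ?X I1 + ?X I2 * ?X I2 + ?X I3 * ?X I3)
      - scal q * (?X (I1 \<union> I2) * (?X I1 * ?X I2 + ?X I3 * ?X (I1 \<union> I2 \<union> I3)))
      - scal (inverse q) * (?X (I2 \<union> I3) * (?X I2 * ?X I3 + ?X I1 * ?X (I1 \<union> I2 \<union> I3)))
      - scal q * (?X (I1 \<union> I3) * (?X I1 * ?X I3 + ?X I2 * ?X (I1 \<union> I2 \<union> I3)))
      + scal (q + inverse q) * (?X I1 * ?X I2 * ?X I3 * ?X (I1 \<union> I2 \<union> I3))
      - scal (1 / (q + inverse q)))"
    unfolding Omega_def Let_def smult_q_def power2_eq_square
    by (intro rep_add rep_diff rep_mult rep_scal rep_C_set) (use assms in auto)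
  then show ?thesis
    unfolding AW.Om_def AW.Casimir_def unfolding scal_mult scal_add qA_def qiA_def hA_def .
qed

lemma rep_zero: "rep n 0 0"
  using rep_diff [OF rep_one rep_one] by simp

lemma rep_sum: "(\<And>X. X \<in> K \<Longrightarrow> rep n (F X) (G X)) \<Longrightarrow> rep n (sum F K) (sum G K)"
  by (induction K rule: infinite_finite_induct) (simp_all add: rep_zero rep_add)

lemma rep_alt: "(\<And>X. X \<subseteq> S \<Longrightarrow> rep n (F X) (G X)) \<Longrightarrow> rep n (alt S F) (alt S G)"
  unfolding alt_def by (rule rep_sum) (simp add: rep_minus)

text \<open>A subset of a disjoint union corresponds to the triple of its traces on the three
  blocks.\<close>

lemma omega_alt:
  assumes fin: "finite I1" "finite I2" "finite I3" and disj: "I1 \<inter> I2 = {}" "I1 \<inter> I3 = {}" "I2 \<inter> I3 = {}"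
  shows "omega I1 I2 I3 = alt (I1 \<union> I2 \<union> I3) (\<lambda>X. Omega (X \<inter> I1) (X \<inter> I2) (X \<inter> I3))"
proof -
  let ?S = "I1 \<union> I2 \<union> I3"
  have sgn: "(if even (card (?S - (I \<union> J \<union> K))) then Omega ((I \<union> J \<union> K) \<inter> I1) ((I \<union> J \<union> K) \<inter> I2) ((I \<union> J \<union> K) \<inter> I3)
      else - Omega ((I \<union> J \<union> K) \<inter> I1) ((I \<union> J \<union> K) \<inter> I2) ((I \<union> J \<union> K) \<inter> I3))
    = (- 1) ^ (card ?S - card I - card J - card K) * Omega I J K"
    if IJK: "I \<subseteq> I1" "J \<subseteq> I2" "K \<subseteq> I3" for I J K
  proof -
    have f: "finite I" "finite J" "finite K"
      using IJK fin finite_subset by blast+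
    have "(I \<union> J \<union> K) \<inter> I1 = I" "(I \<union> J \<union> K) \<inter> I2 = J" "(I \<union> J \<union> K) \<inter> I3 = K"
      using IJK disj by blast+
    moreover have "I \<inter> J = {}" "(I \<union> J) \<inter> K = {}"
      using IJK disj by blast+
    \<comment> \<open>Hence the subtraction of natural numbers in the exponent does not truncate and
      gives the size of the complement.\<close>
    then have "card (I \<union> J \<union> K) = card I + card J + card K"
      using f by (simp add: card_Un_disjoint)
    moreover have "I \<union> J \<union> K \<subseteq> ?S"
      using IJK by blast
    then have "card (?S - (I \<union> J \<union> K)) = card ?S - card (I \<union> J \<union> K)"
      using f by (intro card_Diff_subset) auto
    ultimately show ?thesis
      by (simp add: diff_diff_left)
  qed
  have "omega I1 I2 I3 = (\<Sum>(I, J, K)\<in>Pow I1 \<times> Pow I2 \<times> Pow I3. (- 1) ^ (card ?S - card I - card J - card K) * Omega I J K)"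
    by (simp add: omega_def sum.cartesian_product)
  also have "\<dots> = alt ?S (\<lambda>X. Omega (X \<inter> I1) (X \<inter> I2) (X \<inter> I3))"
    unfolding alt_def
  proof (rule sum.reindex_bij_witness [where i = "\<lambda>X. (X \<inter> I1, X \<inter> I2, X \<inter> I3)" and j = "\<lambda>(I, J, K). I \<union> J \<union> K"])
    fix u assume u: "u \<in> Pow I1 \<times> Pow I2 \<times> Pow I3"
    obtain I J K where u_eq: "u = (I, J, K)"
      by (cases u)
    have IJK: "I \<subseteq> I1" "J \<subseteq> I2" "K \<subseteq> I3"
      using u unfolding u_eq by simp_all
    let ?X = "case u of (I, J, K) \<Rightarrow> I \<union> J \<union> K"
    show "(?X \<inter> I1, ?X \<inter> I2, ?X \<inter> I3) = u"
      unfolding u_eq prod.case using IJK disj by auto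
    show "?X \<in> Pow ?S"
      unfolding u_eq prod.case using IJK by blast
    show "(if even (card (?S - ?X)) then Omega (?X \<inter> I1) (?X \<inter> I2) (?X \<inter> I3) else - Omega (?X \<inter> I1) (?X \<inter> I2) (?X \<inter> I3))
      = (case u of (I, J, K) \<Rightarrow> (- 1) ^ (card ?S - card I - card J - card K) * Omega I J K)"
      unfolding u_eq prod.case by (rule sgn [OF IJK])
  next
    fix X assume "X \<in> Pow ?S"
    then show "(case (X \<inter> I1, X \<inter> I2, X \<inter> I3) of (I, J, K) \<Rightarrow> I \<union> J \<union> K) = X"
      by auto
    show "(X \<inter> I1, X \<inter> I2, X \<inter> I3) \<in> Pow I1 \<times> Pow I2 \<times> Pow I3"
      by auto
  qed
  finally show ?thesis .
qed

lemma rep_omega: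
  assumes "ordered_splitting S I1 I2 I3" "S \<subseteq> {1..n}"
  shows "rep n (omega I1 I2 I3) (AW.omega_sum n (fam n) I1 I2 I3)"
proof -
  have S: "S = I1 \<union> I2 \<union> I3" and ne: "I2 \<noteq> {}"
    and less: "\<And>x y. x \<in> I1 \<Longrightarrow> y \<in> I2 \<Longrightarrow> x < y" "\<And>x y. x \<in> I2 \<Longrightarrow> y \<in> I3 \<Longrightarrow> x < y"
    using assms(1) by (auto simp: ordered_splitting_def set_less_def)
  have fin: "finite I1" "finite I2" "finite I3"
    using assms(2) finite_subset [of _ "{1..n}"] unfolding S by auto
  obtain z where "z \<in> I2"
    using ne by blast
  then have "x < y" if "x \<in> I1" "y \<in> I3" for x y
    using less that order_less_trans by blast
  then have disj: "I1 \<inter> I2 = {}" "I1 \<inter> I3 = {}" "I2 \<inter> I3 = {}"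
    using less by blast+
  show ?thesis
    unfolding omega_alt [OF fin disj] AW.omega_sum_def
    by (rule rep_alt, rule rep_Omega) (use assms(2) S in auto)
qed

section \<open>Transport along the automorphism\<close>

locale aw_hom =
  fixes n :: nat and r :: "free_alg set \<Rightarrow> free_alg set"
  assumes hom: "r \<in> ring_hom (aw n) (aw n)"
    and fixes_scalars: "r (aw_class n (scalar x)) = aw_class n (scalar x)"
begin

text \<open>A relation rather than a map, since \<open>r\<close> acts on \<open>aw(n)\<close> and
  says nothing about the other components of the product.\<close>

definition rr :: "aw_elt \<Rightarrow> aw_elt \<Rightarrow> bool"
  where "rr x y \<longleftrightarrow> r (component n x) = component n y"

lemma rr_scal: "rr (scal x) (scal x)"
  by (simp add: rr_def component_scal fixes_scalars)

lemma rr_one: "rr 1 1"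
  using rr_scal [of 1] by (simp add: scal_one)

lemma rr_add: "rr x y \<Longrightarrow> rr x' y' \<Longrightarrow> rr (x + x') (y + y')"
  by (simp add: rr_def component_ops ring_hom_add [OF hom] component_closed)

lemma rr_mult: "rr x y \<Longrightarrow> rr x' y' \<Longrightarrow> rr (x * x') (y * y')"
  by (simp add: rr_def component_ops ring_hom_mult [OF hom] component_closed)

lemma rr_minus: "rr x y \<Longrightarrow> rr (- x) (- y)"
  using rr_mult [OF rr_scal [of "- 1"]] by (simp add: scal_minus_one)

lemma rr_diff: "rr x y \<Longrightarrow> rr x' y' \<Longrightarrow> rr (x - x') (y - y')"
  using rr_add [OF _ rr_minus, of x y x' y'] by simp

lemma rr_qb: "rr x y \<Longrightarrow> rr x' y' \<Longrightarrow> rr (AW.qb x x') (AW.qb y y')"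
  unfolding AW.qb_def unfolding aA_def bA_def by (intro rr_diff rr_mult rr_scal)

lemma rr_E:
  assumes "\<And>i k. i < k \<Longrightarrow> k \<le> n \<Longrightarrow> rr (c i k) (d i k)" "sorted_wrt (<) L" "set L \<subseteq> {..n}"
  shows "rr (AW.E c L) (AW.E d L)"
  using assms(2,3)
proof (induction L rule: AW.cut_list_induct)
  case (step i k l L)
  then have "rr (AW.E c (l # L)) (AW.E d (l # L))" "rr (AW.E c (i # L)) (AW.E d (i # L))" "rr (AW.E c (k # L)) (AW.E d (k # L))"
    by simp_all
  moreover have "rr (c i k) (d i k)" "rr (c k l) (d k l)" "rr (c i l) (d i l)"
    using step.prems by (auto intro!: assms(1))
  ultimately show ?case
    by (simp add: rr_add rr_mult rr_diff rr_qb)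
qed (simp_all add: rr_one assms(1))

lemma rr_Om:
  assumes "\<And>i k. i < k \<Longrightarrow> k \<le> n \<Longrightarrow> rr (c i k) (d i k)"
  shows "rr (AW.Om n c A B C) (AW.Om n d A B C)"
proof -
  have CS: "rr (AW.CS n c S) (AW.CS n d S)" for S
    unfolding AW.CS_def using assms cuts_strict cuts_props(3) by (rule rr_E)
  show ?thesis
    unfolding AW.Om_def AW.Casimir_def unfolding qA_def qiA_def hA_def
    by (intro rr_add rr_diff rr_mult rr_scal CS)
qed

lemma rr_sum: "(\<And>X. X \<in> K \<Longrightarrow> rr (F X) (G X)) \<Longrightarrow> rr (sum F K) (sum G K)"
proof (induction K rule: infinite_finite_induct)
  have "rr (1 - 1) (1 - 1)"
    by (intro rr_diff rr_one)
  then have zero: "rr 0 0"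
    by simp
  then show "rr (sum F K) (sum G K)" if "infinite K" for K
    using that by simp
  show "rr (sum F {}) (sum G {})"
    using zero by simp
qed (simp add: rr_add)

lemma rr_omega_sum:
  assumes "\<And>i k. i < k \<Longrightarrow> k \<le> n \<Longrightarrow> rr (c i k) (d i k)"
  shows "rr (AW.omega_sum n c A B C) (AW.omega_sum n d A B C)"
  unfolding AW.omega_sum_def alt_def by (rule rr_sum) (simp add: rr_minus rr_Om [OF assms])

lemma rr_rep: "rep n A x \<Longrightarrow> rep n B y \<Longrightarrow> r (aw_class n A) = aw_class n B \<Longrightarrow> rr x y"
  by (simp add: rr_def rep_def)

end

lemma C_seq_drop: "i < k \<Longrightarrow> C_seq [{i<..k}, {}] = gen i k"
  by (simp add: C_seq_def gen_def)

text \<open>The prescribed values say that \<open>r\<close> carries the family \<open>fam n\<close>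
  to its twist. Being a homomorphism that fixes scalars, it carries \<omega> of the one to \<omega>
  of the other, and \<open>omega_sum_t\<close> identifies the latter.\<close>

theorem is_r_omega:
  assumes "i \<in> {1..n - 1}" "is_r n i r" "S \<subseteq> {1..n}" "card S \<ge> 3"
    and split: "ordered_splitting S I1 I2 I3" "ordered_splitting (transpose i (i + 1) ` S) J1 J2 J3"
  shows "r (aw_class n (omega I1 I2 I3)) = aw_class n (omega J1 J2 J3)"
proof -
  obtain e where e: "i = Suc e"
    using assms(1) by (cases i) auto
  have en: "Suc (Suc e) \<le> n"
    using assms(1) e by auto
  note R = assms(2) [unfolded is_r_def aw_automorphism_def ring_iso_def]
  interpret H: aw_hom n r
    by unfold_locales (use R in auto)
  interpret FQ: qscalars aA bA wA qA qiA kA hA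
    by (rule qscalars_aw)
  interpret W: aw_twist aA bA wA n "fam n" e
    using aw_family_fam en by (simp add: aw_twist_def aw_twist_axioms_def)
  interpret W: aw_twist_q aA bA wA n "fam n" e qA qiA kA hA
    by unfold_locales
  have interval: "{Suc j..k} = {j<..k}" for j k :: nat
    by auto
  have t: "H.rr (fam n j k) (W.t j k)" if jk: "j < k" "k \<le> n" for j k
  proof -
    consider "j = Suc e" | "k = Suc e" | "j \<noteq> Suc e" "k \<noteq> Suc e"
      by blast
    then show ?thesis
    proof cases
      case 1
      have "r (aw_class n (C_seq [{i+1..k}])) = aw_class n (C_seq [{i}, {i+2..k}])"
        using R jk 1 e by auto
      moreover have "{i+1..k} = {j<..k}" "{i} = {e<..Suc e}" "{i+2..k} = {Suc (Suc e)<..k}"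
        using 1 e by auto
      ultimately have r: "r (aw_class n (gen j k)) = aw_class n (C_seq [{e<..Suc e}, {Suc (Suc e)<..k}])"
        by (simp add: C_seq_gen)
      \<comment> \<open>For \<open>k = i + 1\<close> the second set in the prescribed value is empty
        and dropped; the bridge on the other side degenerates accordingly.\<close>
      show ?thesis
      proof (cases "k = Suc (Suc e)")
        case True
        then have "W.t j k = fam n e (Suc e)"
          using 1 en by (simp add: W.t_right_bridge W.bridge_degenerate)
        then show ?thesis
          using H.rr_rep [OF rep_gen [of k n j] rep_gen [of "Suc e" n e]] r jk True en by (simp add: C_seq_drop)
      next
        case False
        then have "Suc (Suc e) < k"
          using 1 jk by simp
        then show ?thesis
          using H.rr_rep [OF rep_gen [of k n j] rep_bridge [of "Suc e" n "Suc (Suc e)" k e]] r jk 1 en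
          by (simp add: W.t_right_bridge C_seq_gap)
      qed
    next
      case 2
      have "r (aw_class n (C_seq [{j+1..i}])) = aw_class n (C_seq [{i+1}, {j+1..i-1}])"
        using R jk 2 e by auto
      moreover have "{j+1..i} = {j<..k}" "{i+1} = {Suc e<..Suc (Suc e)}" "{j+1..i-1} = {j<..e}"
        using 2 e by auto
      ultimately have r: "r (aw_class n (gen j k)) = aw_class n (C_seq [{Suc e<..Suc (Suc e)}, {j<..e}])"
        by (simp add: C_seq_gen)
      show ?thesis
      proof (cases "j = e")
        case True
        then have "W.t j k = fam n (Suc e) (Suc (Suc e))"
          using 2 en by (simp add: W.t_left_bridge W.bridge_degenerate)
        then show ?thesis
          using H.rr_rep [OF rep_gen [of k n j] rep_gen [of "Suc (Suc e)" n "Suc e"]] r jk True en by (simp add: C_seq_drop)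
      next
        case False
        then have "j < e"
          using 2 jk by simp
        then show ?thesis
          using H.rr_rep [OF rep_gen [of k n j] rep_bridge' [of j e "Suc e" "Suc (Suc e)" n]] r jk 2 en
          by (simp add: W.t_left_bridge C_seq_gap)
      qed
    next
      case 3
      have "{i, i+1} \<subseteq> {j+1..k} \<or> {i, i+1} \<inter> {j+1..k} = {}"
        using 3 e by auto
      moreover have "1 \<le> j + 1" "j + 1 \<le> k"
        using jk by simp_all
      ultimately have "r (aw_class n (C_seq [{j+1..k}])) = aw_class n (C_seq [{j+1..k}])"
        using R jk(2) by blast
      moreover have "{j+1..k} = {j<..k}"
        by auto
      ultimately have "r (aw_class n (gen j k)) = aw_class n (gen j k)"
        by (simp add: C_seq_gen)
      then show ?thesis
        using H.rr_rep [OF rep_gen rep_gen] jk 3 by (simp add: W.t_other)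
    qed
  qed
  have \<sigma>S: "transpose i (i + 1) ` S \<subseteq> {1..n}"
  proof -
    have "0 < i" "Suc i \<le> n"
      using assms(1) by auto
    then show ?thesis
      using transpose_image_subset [OF assms(3)] by simp
  qed
  have "r (aw_class n (omega I1 I2 I3)) = r (component n (AW.omega_sum n (fam n) I1 I2 I3))"
    using rep_omega [OF split(1) assms(3)] by (simp add: rep_def)
  also have "\<dots> = component n (AW.omega_sum n W.t I1 I2 I3)"
    using H.rr_omega_sum [OF t] by (simp add: H.rr_def)
  also have "AW.omega_sum n W.t I1 I2 I3 = AW.omega_sum n (fam n) J1 J2 J3"
    using split assms(3,4) by (intro W.omega_sum_t) (simp_all add: e)
  also have "component n \<dots> = aw_class n (omega J1 J2 J3)"
    using rep_omega [OF split(2) \<sigma>S] by (simp add: rep_def)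
  finally show ?thesis .
qed

theorem proposition5p7:
  fixes n i :: nat and S I1 I2 I3 J1 J2 J3 :: "nat set"
    and r :: "free_alg set \<Rightarrow> free_alg set"
  assumes "n \<ge> 3"
    and "S \<subseteq> {1..n}" and "card S \<ge> 3"
    and "i \<in> {1..n-1}"
    and "is_r n i r"
    and "ordered_splitting S I1 I2 I3"
    and "ordered_splitting (transpose i (i+1) ` S) J1 J2 J3"
  shows "r (aw_class n (omega I1 I2 I3)) = aw_class n (omega J1 J2 J3)
    \<and> inv_into (carrier (aw n)) r (aw_class n (omega I1 I2 I3)) = aw_class n (omega J1 J2 J3)"
proof
  show "r (aw_class n (omega I1 I2 I3)) = aw_class n (omega J1 J2 J3)"
    using assms by (intro is_r_omega)
  let ?S = "transpose i (i+1) ` S"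
  have "0 < i" "Suc i \<le> n"
    using assms(4) by auto
  then have S: "?S \<subseteq> {1..n}"
    using transpose_image_subset [OF assms(2)] by simp
  have "card ?S = card S"
    by (rule card_image) (rule inj_on_subset [OF inj_transpose subset_UNIV])
  then have card: "card ?S \<ge> 3"
    using assms(3) by simp
  \<comment> \<open>The transposition is an involution, so the statement for the exchanged set says
    that \<open>r\<close> sends its \<omega> back to that of \<open>S\<close>; injectivity then
    gives the value of the inverse.\<close>
  have "transpose i (i+1) ` ?S = S"
    by (simp add: image_comp)
  then have "r (aw_class n (omega J1 J2 J3)) = aw_class n (omega I1 I2 I3)"
    using is_r_omega [OF assms(4,5) S card assms(7), of I1 I2 I3] assms(6) by simp
  moreover have "inj_on r (carrier (aw n))"
    using assms(5) by (auto simp: is_r_def aw_automorphism_def ring_iso_def bij_betw_def)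
  moreover have "aw_class n (omega J1 J2 J3) \<in> carrier (aw n)"
    using rep_omega [OF assms(7) S] by (simp add: rep_def component_closed)
  ultimately show "inv_into (carrier (aw n)) r (aw_class n (omega I1 I2 I3)) = aw_class n (omega J1 J2 J3)"
    by (metis inv_into_f_f)
qed

end
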